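(* Let $1\le p<\infty$ and let $f$ be a somewhere convergent Dirichlet series that is not identically zero, with analytic continuation to $\mathbb C_0$ satisfying $$\sup_{\sigma>0}\sup_{T\ge1}\frac1{2T}\int_{-T}^T|f(\sigma+it)|^p\,\mathrm dt<\infty .$$ Then the Jessen function $$\mathscr J(f,\sigma)=\lim_{T\to\infty}\frac1{2T}\int_{-T}^T\log|f(\sigma+it)|\,\mathrm dt$$ exists and is finite for all $\sigma>0$, and the limit converges uniformly in $\sigma$ on $(\alpha,\beta)$ for all $0<\alpha<\beta$. Furthermore, the function $\sigma\mapsto\mathscr J(f,\sigma)$ is decreasing and convex on $(0,\infty)$, and for all $k>3$ it holds that $$\lim_{N\to\infty}\mathscr J(R_N^kf,\sigma)=\mathscr J(f,\sigma)$$ uniformly in $\sigma$ on $(\alpha,\beta)$ for all $0<\alpha<\beta$. Finally, if $f(+\infty)\ne0$, then the limits are uniform in $\sigma$ on $(\kappa,\infty)$ for all $\kappa>0$.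
   Context: For real $\kappa$, $\mathbb C_\kappa=\{s\in\mathbb C:\operatorname{Re}s>\kappa\}$. A somewhere convergent Dirichlet series is a series $f(s)=\sum_{n\ge1}a_nn^{-s}$ that converges at some $s\in\mathbb C$ (hence in some half-plane); its analytic continuation to $\mathbb C_0$ is again denoted $f$. $f(+\infty)=a_1$ denotes the constant term. For $k>0$ and $N\ge2$ the Riesz means of $f$ are the Dirichlet polynomials $R_N^kf(s)=\sum_{n=1}^Na_n\left(1-\frac{\log n}{\log N}\right)^kn^{-s}$. $\mathscr J(R_N^kf,\sigma)$ is defined by the same formula as $\mathscr J(f,\sigma)$, with $R_N^kf$ in place of $f$. "Decreasing" means non-increasing. *)

theory Defs
  imports "HOL-Complex_Analysis.Complex_Analysis"
begin

definition half_plane :: "real \<Rightarrow> complex set" where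
  "half_plane \<kappa> = {s. Re s > \<kappa>}"

text \<open>
  A Dirichlet series is given by its coefficient sequence \<open>a\<close>, indexed from 1; the value \<open>a 0\<close>
  is never used. The shift by \<open>Suc\<close> matches the library's series indexed from 0.
\<close>

definition dirichlet_term :: "(nat \<Rightarrow> complex) \<Rightarrow> complex \<Rightarrow> nat \<Rightarrow> complex" where
  "dirichlet_term a s n = a (Suc n) * of_nat (Suc n) powr (- s)"

definition somewhere_convergent :: "(nat \<Rightarrow> complex) \<Rightarrow> bool" where
  "somewhere_convergent a \<longleftrightarrow> (\<exists>s. summable (dirichlet_term a s))"

text \<open>
  The agreement is required on some half-plane inside the right half-plane; by the identity
  theorem the continuation is then unique there. Values of \<open>f\<close> outside the right half-plane
  are unconstrained.
\<close>

definition dirichlet_continuation :: "(nat \<Rightarrow> complex) \<Rightarrow> (complex \<Rightarrow> complex) \<Rightarrow> bool" where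
  "dirichlet_continuation a f \<longleftrightarrow>
     f holomorphic_on half_plane 0 \<and>
     (\<exists>\<kappa>\<ge>0. \<forall>s\<in>half_plane \<kappa>. dirichlet_term a s sums f s)"

definition jessen_mean :: "(complex \<Rightarrow> complex) \<Rightarrow> real \<Rightarrow> real \<Rightarrow> real" where
  "jessen_mean f \<sigma> T = 1 / (2 * T) * (LBINT t:{-T..T}. ln (norm (f (Complex \<sigma> t))))"

text \<open>
  The library sets \<open>ln 0 = 0\<close> and gives non-integrable functions the integral 0. The first two
  conjuncts below exclude both conventions: zeros of \<open>f\<close> on the line form a null set, and the
  integrals are genuine Lebesgue integrals. The third says the limit exists and is finite.
\<close>

definition jessen_exists :: "(complex \<Rightarrow> complex) \<Rightarrow> real \<Rightarrow> bool" where
  "jessen_exists f \<sigma> \<longleftrightarrow>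
     (AE t in lborel. f (Complex \<sigma> t) \<noteq> 0) \<and>
     (\<forall>T>0. set_integrable lborel {-T..T} (\<lambda>t. ln (norm (f (Complex \<sigma> t))))) \<and>
     (\<exists>L. (jessen_mean f \<sigma> \<longlongrightarrow> L) at_top)"

definition jessen :: "(complex \<Rightarrow> complex) \<Rightarrow> real \<Rightarrow> real" where
  "jessen f \<sigma> = Lim at_top (jessen_mean f \<sigma>)"

definition riesz_mean :: "real \<Rightarrow> (nat \<Rightarrow> complex) \<Rightarrow> nat \<Rightarrow> complex \<Rightarrow> complex" where
  "riesz_mean k a N s =
     (\<Sum>n=1..N. a n * of_real ((1 - ln (real n) / ln (real N)) powr k) * of_nat n powr (- s))"

end

theory Submission
  imports Defs
begin

text \<open>
  Convergence in mean of functions does not give convergence of the means of their logarithms,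
  because the logarithm is unbounded near zeros. The logarithm is therefore truncated:
  \<open>log max(|f|, \<epsilon>)\<close> is a Lipschitz function of \<open>f\<close> with constant \<open>1/\<epsilon>\<close>, and where \<open>f\<close> does not
  vanish it differs from \<open>log |f|\<close> by at most \<open>(log |f|)^2 / log(1/\<epsilon>)\<close> if \<open>\<epsilon> < 1\<close>. Everything then rests on a
  bound for the mean square of \<open>log |f|\<close> on vertical lines that is uniform in the line and
  in the function.

  That bound (\<open>log_square_mean\<close>) is local. Far to the right a Dirichlet series is dominated by its
  leading term and so is bounded away from zero on some vertical line. Around each point of that
  line there is a disc that almost reaches the imaginary axis; on it \<open>|f|\<close> is bounded by a circle
  mean of \<open>|f|\<close>. Dividing by Blaschke factors removes the zeros. Their number is bounded because
  \<open>f\<close> is not small at the centre; each factor has a square integrable logarithm on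
  vertical segments, and the zero-free quotient obeys Harnack's inequality. Averaging over the
  centre of the disc leaves only first-power means of \<open>|f|\<close>, which is why the \<open>p\<close>-th power
  hypothesis enters just through \<open>x \<le> 1 + x^p\<close>.

  A Riesz mean is a vertical average \<open>R_N f(s) = \<integral> f(s + i X / log N) d\<kappa>\<close> against a complex
  measure whose Fourier transform on the nonnegative half-line is \<open>(1 - x)^k\<close>, cut off at \<open>x = 1\<close>.
  For \<open>k > 3\<close> such a measure with finite first moment is obtained as a mixture of dilations of a
  spline kernel of cubic decay (\<open>riesz_kernel_exists\<close>). By Cauchy's estimate for \<open>f'\<close>, the mean of
  \<open>|f(\<sigma> + i(t + u)) - f(\<sigma> + it)|\<close> is \<open>O(|u|)\<close>. Hence the mean of \<open>|R_N f - f|\<close> is \<open>O(1 / log N)\<close>, the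
  means of \<open>|R_N f|\<close> are bounded uniformly in \<open>N\<close>, and the truncation argument makes the logarithmic
  means of \<open>f\<close> and \<open>R_N f\<close> close, uniformly in \<open>T \<ge> 1\<close> and in \<open>\<sigma>\<close> on compact intervals
  (\<open>jessen_mean_riesz_close\<close>).

  This reduces matters to a Dirichlet polynomial \<open>P\<close>. There \<open>log max(|P|, \<epsilon>)\<close> is a uniform limit of
  polynomials in \<open>|P|^2\<close>, which are trigonometric polynomials in \<open>t\<close>, so its means converge uniformly
  in \<open>\<sigma>\<close> (\<open>dpoly_tlog_ucauchy\<close>). Jensen's inequality on discs, averaged over a vertical line, says
  that the limit \<open>J(\<sigma>)\<close> is at most the average of \<open>J(\<sigma> + r cos \<theta>)\<close> over \<open>\<theta>\<close>, and a continuous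
  function of one variable with this property is convex (\<open>submean_imp_convex\<close>). Convexity survives
  \<open>\<epsilon> \<rightarrow> 0\<close> and \<open>N \<rightarrow> \<infinity>\<close>. The Jessen function of \<open>f\<close> is bounded above by the bound for the mean of
  \<open>|f|\<close>, and a convex function on \<open>(0, \<infinity>)\<close> that is bounded above is decreasing. Finally, if
  \<open>a_1 \<noteq> 0\<close>, then \<open>f\<close> and all its Riesz means are uniformly close to \<open>a_1\<close> far to the right, which
  extends the uniformity from compact intervals to half-lines.
\<close>

section \<open>Circle means and Cauchy estimates\<close>

text \<open>
  The point of the circle of radius \<open>r\<close> about 0 reached after the fraction \<open>x\<close> of a full turn, so
  that circle means are plain integrals over the unit interval.
\<close>

definition circ :: "real \<Rightarrow> real \<Rightarrow> complex" where
  "circ r x = of_real r * exp (2 * of_real pi * \<i> * of_real x)"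

lemma norm_circ [simp]: "norm (circ r x) = \<bar>r\<bar>"
  by (simp add: circ_def norm_mult)

lemma continuous_on_circ [continuous_intros]: "continuous_on S (circ r)"
  unfolding circ_def by (intro continuous_intros)

lemma circ_measurable [measurable]: "circ r \<in> borel_measurable borel"
  by (intro borel_measurable_continuous_onI continuous_on_circ)

lemma Re_circ: "Re (circ r x) = r * cos (2 * pi * x)"
  by (simp add: circ_def Re_exp)

lemma circle_cauchy_higher:
  assumes "g holomorphic_on cball s r" "0 < r" "w \<in> ball s r"
  shows "((\<lambda>x. g (s + circ r x) * circ r x / (s + circ r x - w) ^ Suc k)
           has_integral (deriv ^^ k) g w / fact k) {0..1}"
proof -
  have cp: "circlepath s r x = s + circ r x" for x by (simp add: circ_def circlepath)
  have vd: "vector_derivative (circlepath s r) (at x within {0..1}) = 2 * pi * \<i> * circ r x"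
    if "x \<in> {0..1}" for x
    using that by (simp add: vector_derivative_circlepath01 circ_def)
  have "continuous_on (cball s r) g" "g holomorphic_on ball s r"
    using assms(1) by (auto intro: holomorphic_on_imp_continuous_on holomorphic_on_subset)
  then have "((\<lambda>u. g u / (u - w) ^ Suc k) has_contour_integral
          (2 * pi * \<i> / fact k * (deriv ^^ k) g w)) (circlepath s r)"
    using Cauchy_has_contour_integral_higher_derivative_circlepath[of s r g w k] assms by simp
  then have "((\<lambda>x. g (circlepath s r x) / (circlepath s r x - w) ^ Suc k *
      vector_derivative (circlepath s r) (at x within {0..1})) has_integral
          (2 * pi * \<i> / fact k * (deriv ^^ k) g w)) {0..1}"
    by (simp add: has_contour_integral_def)
  then have "((\<lambda>x. (2 * pi * \<i>) * (g (s + circ r x) * circ r x / (s + circ r x - w) ^ Suc k)) has_integral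
          (2 * pi * \<i> / fact k * (deriv ^^ k) g w)) {0..1}"
    by (rule has_integral_eq[rotated]) (simp add: cp vd)
  then have "((\<lambda>x. 1 / (2 * pi * \<i>) * ((2 * pi * \<i>) * (g (s + circ r x) * circ r x / (s + circ r x - w) ^ Suc k))) has_integral
          1 / (2 * pi * \<i>) * (2 * pi * \<i> / fact k * (deriv ^^ k) g w)) {0..1}"
    by (rule has_integral_mult_right)
  moreover have "1 / (2 * pi * \<i>) * ((2 * pi * \<i>) * u) = u" for u :: complex by simp
  moreover have "1 / (2 * pi * \<i>) * (2 * pi * \<i> / fact k * u) = u / fact k" for u :: complex by simp
  ultimately show ?thesis by simp
qed

lemma circle_mean_value:
  assumes "g holomorphic_on cball s r" "0 < r"
  shows "((\<lambda>x. g (s + circ r x)) has_integral g s) {0..1}"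
proof -
  have "circ r x \<noteq> 0" for x using assms(2) norm_circ[of r x] by fastforce
  with circle_cauchy_higher[of g s r s 0] assms show ?thesis by simp
qed

lemma circle_mean_integrable:
  fixes F :: "complex \<Rightarrow> real"
  assumes "continuous_on (sphere s r) F" "0 < r"
  shows "(\<lambda>x. F (s + circ r x)) integrable_on {0..1}"
proof (rule integrable_continuous_real)
  show "continuous_on {0..1} (\<lambda>x. F (s + circ r x))"
    by (rule continuous_on_compose2[OF assms(1)])
      (use assms(2) in \<open>auto intro!: continuous_intros simp: dist_norm\<close>)
qed

text \<open>
  Cauchy's formula bounds a holomorphic function inside a disc by its first-power mean on the
  boundary; only such means are controlled for the functions considered below.
\<close>

lemma circle_bound:
  assumes g: "g holomorphic_on cball s r" and q: "dist s z \<le> q" "q < r"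
  shows "norm (g z) \<le> r / (r - q) * integral {0..1} (\<lambda>x. norm (g (s + circ r x)))"
proof -
  have r: "0 < r" using q zero_le_dist[of s z] by linarith
  have c: "continuous_on (sphere s r) (\<lambda>x. norm (g x))"
    using g by (intro continuous_intros holomorphic_on_imp_continuous_on)
      (auto elim: holomorphic_on_subset)
  have "((\<lambda>x. g (s + circ r x) * circ r x / (s + circ r x - z)) has_integral g z) {0..1}"
    using circle_cauchy_higher[of g s r z 0] g q r by simp
  then have "norm (g z) \<le> integral {0..1} (\<lambda>x. r / (r - q) * norm (g (s + circ r x)))"
  proof (subst integral_unique[symmetric], assumption, intro integral_norm_bound_integral)
    fix x
    have "norm (circ r x + s - z) \<ge> r - q"
      using norm_triangle_ineq2[of "circ r x" "z - s"] q r
      by (simp add: dist_norm norm_minus_commute algebra_simps)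
    then have "r / norm (s + circ r x - z) \<le> r / (r - q)"
      using q r by (intro divide_left_mono mult_pos_pos) (auto simp: add.commute)
    then have "norm (g (s + circ r x)) * (r / norm (s + circ r x - z)) \<le> norm (g (s + circ r x)) * (r / (r - q))"
      by (intro mult_left_mono) auto
    then show "norm (g (s + circ r x) * circ r x / (s + circ r x - z)) \<le> r / (r - q) * norm (g (s + circ r x))"
      using r by (simp add: norm_mult norm_divide mult_ac)
  next
    show "(\<lambda>x. r / (r - q) * norm (g (s + circ r x))) integrable_on {0..1}"
      using circle_mean_integrable[OF c r] by (intro integrable_on_mult_right)
  qed auto
  then show ?thesis by simp
qed

lemma deriv_circle_bound:
  assumes g: "g holomorphic_on cball s r" and r: "0 < r"
  shows "norm (deriv g s) \<le> 1 / r * integral {0..1} (\<lambda>x. norm (g (s + circ r x)))"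
proof -
  have c: "continuous_on (sphere s r) (\<lambda>x. norm (g x))"
    using g by (intro continuous_intros holomorphic_on_imp_continuous_on)
      (auto elim: holomorphic_on_subset)
  have "((\<lambda>x. g (s + circ r x) * circ r x / (s + circ r x - s)^2) has_integral deriv g s) {0..1}"
    using circle_cauchy_higher[of g s r s 1] g r
    by (simp add: power2_eq_square)
  then have "norm (deriv g s) \<le> integral {0..1} (\<lambda>x. 1 / r * norm (g (s + circ r x)))"
  proof (subst integral_unique[symmetric], assumption, intro integral_norm_bound_integral)
    show "norm (g (s + circ r x) * circ r x / (s + circ r x - s)^2) \<le> 1 / r * norm (g (s + circ r x))" for x
      using r by (simp add: norm_mult norm_divide norm_power power2_eq_square)
  next
    show "(\<lambda>x. 1 / r * norm (g (s + circ r x))) integrable_on {0..1}"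
      using circle_mean_integrable[OF c r] by (intro integrable_on_mult_right)
  qed auto
  then show ?thesis by simp
qed

section \<open>Blaschke factorization\<close>

definition blaschke :: "complex \<Rightarrow> complex \<Rightarrow> complex" where
  "blaschke a z = (z - a) / (1 - cnj a * z)"

lemma norm_one_minus_cnj:
  assumes "norm z = 1" shows "norm (1 - cnj a * z) = norm (z - a)"
proof -
  have zz: "z * cnj z = 1" using assms by (simp add: complex_norm_square[symmetric])
  have "1 - cnj a * z = z * cnj (z - a)"
    using zz by (simp add: algebra_simps)
  then show ?thesis using assms by (simp add: norm_mult del: complex_cnj_diff)
qed

lemma one_minus_cnj_nz:
  assumes "norm a < 1" "norm z \<le> 1" shows "1 - cnj a * z \<noteq> 0"
proof
  assume "1 - cnj a * z = 0"
  then have "cnj a * z = 1" by simp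
  then have "norm a * norm z = 1" by (metis complex_mod_cnj norm_mult norm_one)
  moreover have "norm a * norm z \<le> norm a * 1" using assms by (intro mult_left_mono) auto
  ultimately show False using assms by simp
qed

lemma norm_blaschke_le:
  assumes a: "norm a < 1" and z: "norm z \<le> 1" shows "norm (blaschke a z) \<le> 1"
proof (rule maximum_modulus_frontier[of "blaschke a" "cball 0 1"])
  show "blaschke a holomorphic_on interior (cball 0 1)"
    unfolding blaschke_def using one_minus_cnj_nz[OF a] by (intro holomorphic_intros) auto
  show "continuous_on (closure (cball 0 1)) (blaschke a)"
    unfolding blaschke_def using one_minus_cnj_nz[OF a] by (intro continuous_intros) auto
  fix w :: complex assume "w \<in> frontier (cball 0 1)"
  then have w: "norm w = 1" by (simp add: dist_norm)
  then have "w \<noteq> a" using a by auto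
  then show "norm (blaschke a w) \<le> 1"
    by (simp add: blaschke_def norm_divide norm_one_minus_cnj[OF w])
qed (use z in \<open>auto simp: dist_norm\<close>)

text \<open>
  A Blaschke factor is small only near its zero, with the distance as the order of magnitude. This
  makes its logarithm integrable to every power along a line.
\<close>

lemma norm_blaschke_ge:
  assumes a: "norm a < 1" and z: "norm z \<le> 1" shows "norm (z - a) / 2 \<le> norm (blaschke a z)"
proof -
  have "norm (1 - cnj a * z) \<le> 1 + norm a * norm z"
    by (metis complex_mod_cnj norm_mult norm_one norm_triangle_ineq4)
  also have "norm a * norm z \<le> 1 * 1" using a z by (intro mult_mono) auto
  finally have "norm (1 - cnj a * z) \<le> 2" by simp
  then have "norm (z - a) * norm (1 - cnj a * z) \<le> norm (z - a) * 2" by (intro mult_left_mono) auto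
  moreover have "0 < norm (1 - cnj a * z)" using one_minus_cnj_nz[OF a z] by (simp del: right_minus_eq)
  ultimately show ?thesis by (simp add: blaschke_def norm_divide pos_le_divide_eq)
qed

lemma norm_prod_list: "norm (prod_list xs) = prod_list (map norm (xs :: 'a :: real_normed_field list))"
  by (induction xs) (auto simp: norm_mult)

lemma prod_list_mono_le:
  fixes F :: "'a \<Rightarrow> real"
  assumes "\<And>a. a \<in> set as \<Longrightarrow> 0 \<le> F a" "\<And>a. a \<in> set as \<Longrightarrow> F a \<le> c" "0 \<le> c"
  shows "(\<Prod>a\<leftarrow>as. F a) \<le> c ^ length as \<and> 0 \<le> (\<Prod>a\<leftarrow>as. F a)"
  using assms by (induction as) (auto intro!: mult_mono)

lemma holomorphic_divide_zero:
  assumes "h holomorphic_on S" "open S" "a \<in> S" "h a = 0"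
  obtains k where "k holomorphic_on S" "\<And>z. z \<in> S \<Longrightarrow> h z = (z - a) * k z"
proof
  show "(\<lambda>z. if z = a then deriv h a else h z / (z - a)) holomorphic_on S"
    by (rule pole_theorem_open_0[OF assms(1,2)]) (use assms in auto)
  show "h z = (z - a) * (if z = a then deriv h a else h z / (z - a))" for z
    using assms by auto
qed

text \<open>
  The equation is the factorization \<open>g = h * \<Prod> blaschke a\<close> with denominators cleared, which avoids
  any division. On the unit circle the Blaschke factors have modulus 1, so \<open>|h| = |g|\<close> there and the
  maximum principle carries the bound inside. At the centre each factor has modulus \<open>|a| \<le> \<rho>\<close>, and
  comparing with \<open>|g 0|\<close> limits how many factors there can be.
\<close>

lemma blaschke_count:
  assumes h: "h holomorphic_on ball 0 R0" "1 < R0"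
    and g1: "\<And>z. norm z = 1 \<Longrightarrow> norm (g z) \<le> 1" and g0: "g 0 \<noteq> 0"
    and \<rho>: "0 < \<rho>" "\<rho> < 1" and zs: "set zs \<subseteq> cball 0 \<rho>"
    and eq: "\<And>z. z \<in> ball 0 R0 \<Longrightarrow> g z * (\<Prod>a\<leftarrow>zs. 1 - cnj a * z) = (\<Prod>a\<leftarrow>zs. z - a) * h z"
  shows "\<And>z. norm z \<le> 1 \<Longrightarrow> norm (h z) \<le> 1" "norm (g 0) \<le> norm (h 0)"
    "real (length zs) * ln (1 / \<rho>) \<le> ln (1 / norm (g 0))"
proof -
  show h1: "norm (h z) \<le> 1" if "norm z \<le> 1" for z
  proof (rule maximum_modulus_frontier[of h "cball 0 1"])
    show "h holomorphic_on interior (cball 0 1)" using h by (auto elim!: holomorphic_on_subset)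
    show "continuous_on (closure (cball 0 1)) h"
      using h by (auto intro!: holomorphic_on_imp_continuous_on elim!: holomorphic_on_subset)
    fix w :: complex assume "w \<in> frontier (cball 0 1)"
    then have w: "norm w = 1" by (simp add: dist_norm)
    have wa: "norm (1 - cnj a * w) = norm (w - a)" for a
      by (rule norm_one_minus_cnj[OF w])
    have nz: "(\<Prod>a\<leftarrow>zs. norm (w - a)) \<noteq> 0"
      using zs w \<rho> by (auto simp: prod_list_zero_iff dist_norm)
    have "norm (g w) * (\<Prod>a\<leftarrow>zs. norm (1 - cnj a * w)) = (\<Prod>a\<leftarrow>zs. norm (w - a)) * norm (h w)"
      using arg_cong[OF eq[of w], of norm] w h(2)
      by (simp add: norm_mult norm_prod_list o_def)
    then have "norm (g w) = norm (h w)" using nz by (simp add: wa)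
    then show "norm (h w) \<le> 1" using g1[OF w] by simp
  qed (use that in \<open>auto simp: dist_norm\<close>)
  have "norm (g 0) = (\<Prod>a\<leftarrow>zs. norm a) * norm (h 0)"
    using arg_cong[OF eq[of 0], of norm] h(2) by (simp add: norm_mult norm_prod_list o_def map_replicate_const)
  moreover have pr: "(\<Prod>a\<leftarrow>zs. norm a) \<le> \<rho> ^ length zs \<and> 0 \<le> (\<Prod>a\<leftarrow>zs. norm a)"
    using zs \<rho> by (intro prod_list_mono_le) auto
  moreover have pr1: "\<rho> ^ length zs \<le> 1" using \<rho> by (simp add: power_le_one)
  ultimately show "norm (g 0) \<le> norm (h 0)"
    using mult_right_mono[of "\<Prod>a\<leftarrow>zs. norm a" 1 "norm (h 0)"] by simp
  have "norm (g 0) \<le> \<rho> ^ length zs * 1"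
    unfolding \<open>norm (g 0) = _\<close> using pr h1[of 0] \<rho> by (intro mult_mono) auto
  then have "ln (norm (g 0)) \<le> ln (\<rho> ^ length zs)"
    using g0 \<rho> by (subst ln_le_cancel_iff) auto
  then show "real (length zs) * ln (1 / \<rho>) \<le> ln (1 / norm (g 0))"
    using \<rho> g0 by (simp add: ln_div ln_realpow)
qed

text \<open>
  Take a factorization with the largest possible number of zeros in the disc of radius \<open>\<rho>\<close>; the count
  above bounds this number. If the quotient still vanished at a point of that disc, one more factor
  could be split off.
\<close>

lemma blaschke_factorization:
  assumes g: "g holomorphic_on ball 0 R0" "1 < R0"
    and g1: "\<And>z. norm z = 1 \<Longrightarrow> norm (g z) \<le> 1" and g0: "g 0 \<noteq> 0"
    and \<rho>: "0 < \<rho>" "\<rho> < 1"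
  obtains zs h where "set zs \<subseteq> cball 0 \<rho>" "h holomorphic_on ball 0 R0"
    "\<And>z. norm z \<le> 1 \<Longrightarrow> g z = (\<Prod>a\<leftarrow>zs. blaschke a z) * h z"
    "\<And>z. norm z \<le> \<rho> \<Longrightarrow> h z \<noteq> 0" "\<And>z. norm z \<le> 1 \<Longrightarrow> norm (h z) \<le> 1"
    "norm (g 0) \<le> norm (h 0)" "real (length zs) * ln (1 / \<rho>) \<le> ln (1 / norm (g 0))"
proof -
  define P where "P n \<longleftrightarrow> (\<exists>zs h. length zs = n \<and> set zs \<subseteq> cball 0 \<rho> \<and> h holomorphic_on ball 0 R0 \<and>
     (\<forall>z\<in>ball 0 R0. g z * (\<Prod>a\<leftarrow>zs. 1 - cnj a * z) = (\<Prod>a\<leftarrow>zs. z - a) * h z))" for n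
  have "P 0" unfolding P_def using g by auto
  have bound: "n \<le> nat \<lfloor>ln (1 / norm (g 0)) / ln (1 / \<rho>)\<rfloor>" if "P n" for n
  proof -
    from that obtain zs h where *: "length zs = n" "set zs \<subseteq> cball 0 \<rho>" "h holomorphic_on ball 0 R0"
     "\<And>z. z\<in>ball 0 R0 \<Longrightarrow> g z * (\<Prod>a\<leftarrow>zs. 1 - cnj a * z) = (\<Prod>a\<leftarrow>zs. z - a) * h z"
      unfolding P_def by blast
    have "real n * ln (1 / \<rho>) \<le> ln (1 / norm (g 0))"
      using blaschke_count(3)[of h R0 g, OF *(3) g(2) g1 g0 \<rho> *(2,4)] *(1) by simp
    moreover have "0 < ln (1 / \<rho>)" using \<rho> by simp
    ultimately have "real n \<le> ln (1 / norm (g 0)) / ln (1 / \<rho>)"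
      by (simp add: pos_le_divide_eq)
    then show ?thesis by (simp add: le_nat_floor)
  qed
  obtain n where "P n" and nmax: "\<And>m. P m \<Longrightarrow> m \<le> n"
    using GreatestI_nat[of P 0] Greatest_le_nat[of P] \<open>P 0\<close> bound by blast
  then obtain zs h where *: "length zs = n" "set zs \<subseteq> cball 0 \<rho>" "h holomorphic_on ball 0 R0"
     "\<And>z. z\<in>ball 0 R0 \<Longrightarrow> g z * (\<Prod>a\<leftarrow>zs. 1 - cnj a * z) = (\<Prod>a\<leftarrow>zs. z - a) * h z"
      unfolding P_def by blast
  note cnt = blaschke_count[of h R0 g, OF *(3) g(2) g1 g0 \<rho> *(2,4)]
  show thesis
  proof (rule that[OF *(2,3) _ _ cnt])
    fix z :: complex assume z: "norm z \<le> 1"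
    have nz: "(\<Prod>a\<leftarrow>zs. 1 - cnj a * z) \<noteq> 0"
      using one_minus_cnj_nz[OF _ z] *(2) \<rho> by (force simp: prod_list_zero_iff)
    have "(\<Prod>a\<leftarrow>zs. blaschke a z) * (\<Prod>a\<leftarrow>zs. 1 - cnj a * z) = (\<Prod>a\<leftarrow>zs. z - a)"
    proof -
      have "\<forall>a\<in>set zs. 1 - cnj a * z \<noteq> 0" using one_minus_cnj_nz[OF _ z] *(2) \<rho> by force
      then show ?thesis by (induction zs) (auto simp: blaschke_def)
    qed
    then have "g z * (\<Prod>a\<leftarrow>zs. 1 - cnj a * z) = ((\<Prod>a\<leftarrow>zs. blaschke a z) * h z) * (\<Prod>a\<leftarrow>zs. 1 - cnj a * z)"
      using *(4)[of z] z g(2) by (simp add: mult_ac)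
    then show "g z = (\<Prod>a\<leftarrow>zs. blaschke a z) * h z" using nz by simp
  next
    fix a :: complex assume a: "norm a \<le> \<rho>"
    show "h a \<noteq> 0"
    proof
      assume "h a = 0"
      then obtain k where k: "k holomorphic_on ball 0 R0" "\<And>z. z \<in> ball 0 R0 \<Longrightarrow> h z = (z - a) * k z"
        using holomorphic_divide_zero[OF *(3), of a] a \<rho> g(2) by auto
      have "P (Suc n)"
        unfolding P_def
      proof (intro exI conjI ballI)
        show "length (a # zs) = Suc n" "set (a # zs) \<subseteq> cball 0 \<rho>" using * a by auto
        show "(\<lambda>z. k z * (1 - cnj a * z)) holomorphic_on ball 0 R0"
          using k by (intro holomorphic_intros)
        show "g z * (\<Prod>a\<leftarrow>a # zs. 1 - cnj a * z) = (\<Prod>a\<leftarrow>a # zs. z - a) * (k z * (1 - cnj a * z))"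
          if "z \<in> ball 0 R0" for z
          using arg_cong[OF *(4)[OF that], of "\<lambda>u. u * (1 - cnj a * z)"] k(2)[OF that] by (simp add: mult_ac)
      qed
      then show False using nmax by fastforce
    qed
  qed
qed

section \<open>Logarithms of bounded holomorphic functions on a disc\<close>

text \<open>
  The branch \<open>l\<close> of \<open>log h - 1\<close>, normalized to be real at 0, has negative real part, so the Cayley transform
  \<open>(l + c) / (l - c)\<close> with \<open>c = - l 0\<close> maps the disc into the unit disc and vanishes at 0. The
  Schwarz lemma then bounds \<open>|l|\<close>. The extra \<open>- 1\<close> keeps the real part strictly negative even when
  \<open>|h| = 1\<close>.
\<close>

lemma zero_free_harnack:
  assumes h: "h holomorphic_on ball 0 \<rho>" and nz: "\<And>z. z \<in> ball 0 \<rho> \<Longrightarrow> h z \<noteq> 0"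
    and h1: "\<And>z. z \<in> ball 0 \<rho> \<Longrightarrow> norm (h z) \<le> 1" and r: "norm z \<le> r" "r < \<rho>"
  shows "- ln (norm (h z)) \<le> (\<rho> + r) / (\<rho> - r) * (1 - ln (norm (h 0)))"
proof -
  have r0: "0 \<le> r" "0 < \<rho>" using r norm_ge_zero[of z] by linarith+
  obtain l0 where l0: "l0 holomorphic_on ball 0 \<rho>" "\<And>z. z \<in> ball 0 \<rho> \<Longrightarrow> exp (l0 z) = h z"
    using holomorphic_logarithm_exists[of "ball 0 \<rho>" h 0] h nz r0 by auto
  define l where "l z = l0 z - \<i> * Im (l0 0) - 1" for z
  have l: "l holomorphic_on ball 0 \<rho>" unfolding l_def using l0 by (intro holomorphic_intros) auto
  have Rel: "Re (l z) = ln (norm (h z)) - 1" if "z \<in> ball 0 \<rho>" for z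
    unfolding l_def using l0(2)[OF that, symmetric] by (simp add: norm_exp_eq_Re)
  have Rel1: "Re (l z) \<le> - 1" if "z \<in> ball 0 \<rho>" for z
    using Rel[OF that] h1[OF that] nz[OF that] by (simp add: ln_le_zero_iff)
  define c where "c = 1 - ln (norm (h 0))"
  have l00: "l 0 = - of_real c" and c: "c \<ge> 1"
    using Rel[of 0] Rel1[of 0] r0 by (auto simp: complex_eq_iff c_def l_def)
  have den: "l (of_real \<rho> * w) - of_real c \<noteq> 0" and
    q1: "norm ((l (of_real \<rho> * w) + of_real c) / (l (of_real \<rho> * w) - of_real c)) < 1"
    if "norm w < 1" for w
  proof -
    have "of_real \<rho> * w \<in> ball 0 \<rho>" using that r0 by (simp add: norm_mult)
    then have R: "Re (l (of_real \<rho> * w)) \<le> - 1" by (rule Rel1)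
    show *: "l (of_real \<rho> * w) - of_real c \<noteq> 0" using R c by (auto simp: complex_eq_iff)
    have "(norm (l (of_real \<rho> * w) + of_real c))\<^sup>2 < (norm (l (of_real \<rho> * w) - of_real c))\<^sup>2"
    proof -
      have "(Re u + c)\<^sup>2 + (Im u)\<^sup>2 < (Re u - c)\<^sup>2 + (Im u)\<^sup>2" if "Re u \<le> -1" for u
        using that c mult_strict_left_mono[of "Re u" 0 c] by (simp add: power2_eq_square algebra_simps)
      from this[OF R] show ?thesis unfolding cmod_power2 by simp
    qed
    then have "norm (l (of_real \<rho> * w) + of_real c) < norm (l (of_real \<rho> * w) - of_real c)"
      by (simp add: power2_less_imp_less)
    then show "norm ((l (of_real \<rho> * w) + of_real c) / (l (of_real \<rho> * w) - of_real c)) < 1"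
      using * by (simp add: norm_divide divide_less_eq)
  qed
  define q where "q w = (l (of_real \<rho> * w) + of_real c) / (l (of_real \<rho> * w) - of_real c)" for w
  have qhol: "q holomorphic_on ball 0 1"
    unfolding q_def using den r0
    by (intro holomorphic_intros holomorphic_on_compose_gen[OF _ l, unfolded o_def])
       (auto simp: norm_mult)
  define w where "w = z / of_real \<rho>"
  have w: "norm w < 1" "z = of_real \<rho> * w" "norm w \<le> r / \<rho>"
    using r r0 by (auto simp: w_def norm_divide divide_simps)
  define t where "t = r / \<rho>"
  have t: "0 \<le> t" "t < 1" using r0 r by (auto simp: t_def)
  have "norm (q w) \<le> norm w"
    by (rule Schwarz_Lemma(1)[OF qhol]) (use q1 w l00 in \<open>auto simp: q_def\<close>)
  then have qt: "norm (q w) \<le> t" using w(3) by (simp add: t_def)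
  have "q w * (l z - of_real c) = l z + of_real c"
    using den[OF w(1)] by (simp add: q_def w(2))
  then have "l z * (1 - q w) = - of_real c * (1 + q w)" by (simp add: algebra_simps)
  then have "norm (l z * (1 - q w)) = norm (- of_real c * (1 + q w))" by (rule arg_cong)
  then have "norm (l z) * norm (1 - q w) = c * norm (1 + q w)"
    using c unfolding norm_mult norm_minus_cancel norm_of_real by simp
  moreover have "1 - t \<le> norm (1 - q w)"
    using norm_triangle_ineq2[of 1 "q w"] qt by simp
  then have "norm (l z) * (1 - t) \<le> norm (l z) * norm (1 - q w)" by (intro mult_left_mono) auto
  moreover have "norm (1 + q w) \<le> 1 + t" using norm_triangle_ineq[of 1 "q w"] qt by simp
  then have "c * norm (1 + q w) \<le> c * (1 + t)" using c by (intro mult_left_mono) auto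
  ultimately have "norm (l z) \<le> c * ((1 + t) / (1 - t))" using t by (simp add: pos_le_divide_eq)
  moreover have "(1 + t) / (1 - t) = (\<rho> + r) / (\<rho> - r)"
    using r0 r by (simp add: t_def field_simps)
  moreover have "- ln (norm (h z)) \<le> norm (l z)"
    using Rel[of z] r abs_Re_le_cmod[of "l z"] by simp
  ultimately show ?thesis by (simp add: c_def mult.commute)
qed

lemma ln_squared_le_root:
  fixes u :: real assumes "0 < u" "u \<le> 1" shows "(ln u)\<^sup>2 \<le> 16 * u powr (-1/2)"
proof -
  have "- ln u = 4 * ln (u powr (-1/4))" using assms by (simp add: ln_powr)
  also have "\<dots> \<le> 4 * u powr (-1/4)" using ln_bound[of "u powr (-1/4)"] assms by simp
  finally have "(- ln u)\<^sup>2 \<le> (4 * u powr (-1/4))\<^sup>2" using assms by (intro power_mono) auto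
  also have "\<dots> = 16 * u powr (-1/2)"
    by (simp add: power_mult_distrib power2_eq_square powr_add[symmetric])
  finally show ?thesis by simp
qed

lemma ln_squared_le:
  fixes x :: real assumes "1 \<le> x" shows "(ln x)\<^sup>2 \<le> 4 * x"
proof -
  have "ln x = 2 * ln (sqrt x)" using assms by (simp add: ln_sqrt)
  also have "\<dots> \<le> 2 * sqrt x" using ln_bound[of "sqrt x"] assms by simp
  finally have "(ln x)\<^sup>2 \<le> (2 * sqrt x)\<^sup>2" using assms by (intro power_mono) auto
  then show ?thesis using assms by (simp add: power_mult_distrib)
qed

lemma inverse_root_integral_finite:
  obtains K :: real where "0 \<le> K"
    "\<And>c. (\<integral>\<^sup>+y. ennreal (indicator {-2..2} (y - c) * \<bar>(y - c) / 2\<bar> powr (-1/2)) \<partial>lborel) \<le> ennreal K"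
proof -
  define F where "F y = ennreal (indicator {-2..2} y * \<bar>y / 2\<bar> powr (-1/2))" for y :: real
  have Fm [measurable]: "F \<in> borel_measurable borel" unfolding F_def by measurable
  define G where "G y = ennreal (indicator {0..1} y * y powr (-1/2))" for y :: real
  have Gm [measurable]: "G \<in> borel_measurable borel" unfolding G_def by measurable
  have "((\<lambda>y::real. y powr (-1/2)) has_integral (1 powr (-1/2+1) / (-1/2+1))) {0..1}"
    by (rule has_integral_powr_from_0) auto
  then have G: "(\<integral>\<^sup>+y. G y \<partial>lborel) = ennreal 2"
    unfolding G_def using nn_integral_has_integral_lebesgue[of "{0..1}" "\<lambda>y::real. y powr (-1/2)"] by simp
  have "(\<integral>\<^sup>+y. F y \<partial>lborel) \<le> (\<integral>\<^sup>+y. G (y / 2) + G (- y / 2) \<partial>lborel)"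
    by (intro nn_integral_mono) (auto simp: F_def G_def indicator_def)
  also have "\<dots> = (\<integral>\<^sup>+y. G (y / 2) \<partial>lborel) + (\<integral>\<^sup>+y. G (- y / 2) \<partial>lborel)"
    by (intro nn_integral_add) auto
  also have "\<dots> = ennreal 8"
    using nn_integral_real_affine[of "\<lambda>y. G (y / 2)" 2 0] nn_integral_real_affine[of "\<lambda>y. G (- y / 2)" "-2" 0] G
    by (simp flip: ennreal_numeral ennreal_mult ennreal_plus)
  finally have "(\<integral>\<^sup>+y. F y \<partial>lborel) < \<infinity>" by (rule le_less_trans) simp
  then obtain K where K: "0 \<le> K" "(\<integral>\<^sup>+y. F y \<partial>lborel) = ennreal K"
    by (cases "\<integral>\<^sup>+y. F y \<partial>lborel") auto
  have "(\<integral>\<^sup>+y. F (y - c) \<partial>lborel) = ennreal K" for c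
    using nn_integral_real_affine[of F 1 "-c"] K by simp
  then show thesis using that[of K] K by (simp add: F_def)
qed

text \<open>
  The heart of the local estimate: on a vertical chord the square of \<open>log |g|\<close> has an integral bounded
  in terms of \<open>log (1 / |g 0|)\<close> alone. Each Blaschke factor is at least half the vertical distance to
  its zero, so the square of its logarithm is below an integrable inverse square root; the number of
  factors is at most a multiple of \<open>log (1 / |g 0|)\<close>; Harnack's inequality controls the zero-free factor.
\<close>

lemma local_log_square:
  assumes r: "0 < r" "r < 1"
  obtains C :: real where "0 < C"
    "\<And>g R0 x. g holomorphic_on ball 0 R0 \<Longrightarrow> 1 < R0 \<Longrightarrow> (\<And>z. norm z = 1 \<Longrightarrow> norm (g z) \<le> 1) \<Longrightarrow> g 0 \<noteq> 0 \<Longrightarrow>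
       (\<integral>\<^sup>+y. ennreal ((ln (norm (g (Complex x y))))\<^sup>2) * indicator {y. norm (Complex x y) \<le> r} y \<partial>lborel)
         \<le> ennreal (C * (1 + ln (1 / norm (g 0)))\<^sup>2)"
proof -
  define \<rho> where "\<rho> = (1 + r) / 2"
  have \<rho>: "r < \<rho>" "\<rho> < 1" "0 < \<rho>" using r by (auto simp: \<rho>_def)
  obtain K :: real where K: "0 \<le> K"
    "\<And>c. (\<integral>\<^sup>+y. ennreal (indicator {-2..2} (y - c) * \<bar>(y - c) / 2\<bar> powr (-1/2)) \<partial>lborel) \<le> ennreal K"
    using inverse_root_integral_finite by blast
  define L where "L = 1 / ln (1 / \<rho>)"
  have L: "L > 0" using \<rho> by (simp add: L_def)
  define c where "c = (\<rho> + r) / (\<rho> - r)"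
  have c: "c > 0" using \<rho> r by (simp add: c_def)
  define C where "C = 32 * L\<^sup>2 * K + 4 * c\<^sup>2"
  have C: "C > 0" using K c by (simp add: C_def add_nonneg_pos)
  have main: "(\<integral>\<^sup>+y. ennreal ((ln (norm (g (Complex x y))))\<^sup>2) * indicator {y. norm (Complex x y) \<le> r} y \<partial>lborel)
         \<le> ennreal (C * (1 + ln (1 / norm (g 0)))\<^sup>2)"
    if g: "g holomorphic_on ball 0 R0" "1 < R0" and g1: "\<And>z. norm z = 1 \<Longrightarrow> norm (g z) \<le> 1"
      and g0: "g 0 \<noteq> 0" for g R0 x
  proof -
    obtain zs h where zs: "set zs \<subseteq> cball 0 \<rho>" and h: "h holomorphic_on ball 0 R0"
      and fact: "\<And>z. norm z \<le> 1 \<Longrightarrow> g z = (\<Prod>a\<leftarrow>zs. blaschke a z) * h z"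
      and hnz: "\<And>z. norm z \<le> \<rho> \<Longrightarrow> h z \<noteq> 0" and h1: "\<And>z. norm z \<le> 1 \<Longrightarrow> norm (h z) \<le> 1"
      and h0: "norm (g 0) \<le> norm (h 0)" and len: "real (length zs) * ln (1 / \<rho>) \<le> ln (1 / norm (g 0))"
      using blaschke_factorization[OF g g1 g0 \<rho>(3,2)] by blast
    define H where "H = ln (1 / norm (g 0))"
    define n where "n = length zs"
    have nH: "real n \<le> L * H" using len \<rho> by (simp add: L_def H_def n_def field_simps)
    then have H0: "H \<ge> 0" using L by (metis of_nat_0_le_iff order_trans zero_le_mult_iff not_le)
    have zero: "z \<in> set zs" if "norm z \<le> r" "g z = 0" for z
    proof -
      have "(\<Prod>a\<leftarrow>zs. blaschke a z) = 0" using fact[of z] that hnz[of z] \<rho> r by auto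
      then obtain a where "a \<in> set zs" "blaschke a z = 0" by (auto simp: prod_list_zero_iff)
      moreover have "1 - cnj a * z \<noteq> 0" using one_minus_cnj_nz[of a z] zs \<rho> that r calculation by force
      ultimately show ?thesis by (auto simp: blaschke_def)
    qed
    \<comment> \<open>Majorant of the Blaschke part; the factor \<open>n\<close> comes from the Cauchy-Schwarz inequality for \<open>n\<close> summands.\<close>
    define D where "D y = (\<Sum>i<n. 2 * real n * 16 * (indicator {-2..2} (y - Im (zs ! i)) * \<bar>(y - Im (zs ! i)) / 2\<bar> powr (-1/2)))" for y
    \<comment> \<open>Majorant of the zero-free part.\<close>
    define E where "E y = 2 * (c * (1 + H))\<^sup>2 * indicator {-1..1} y" for y :: real
    have pw: "ennreal ((ln (norm (g (Complex x y))))\<^sup>2) * indicator {y. norm (Complex x y) \<le> r} y \<le> ennreal (D y) + ennreal (E y)"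
      if y: "y \<notin> Im ` set zs" for y
    proof (cases "norm (Complex x y) \<le> r")
      case True
      define z where "z = Complex x y"
      have z: "norm z \<le> r" "norm z \<le> 1" "norm z \<le> \<rho>" using True r \<rho> by (auto simp: z_def)
      have Imz: "\<bar>y\<bar> \<le> 1" using abs_Im_le_cmod[of z] z by (simp add: z_def)
      have gz: "g z \<noteq> 0" using zero[of z] z y by (force simp: z_def)
      have bl: "(ln (norm (blaschke a z)))\<^sup>2 \<le> 16 * (indicator {-2..2} (y - Im a) * \<bar>(y - Im a) / 2\<bar> powr (-1/2))"
        and blnz: "blaschke a z \<noteq> 0" and bl1: "norm (blaschke a z) \<le> 1" if a: "a \<in> set zs" for a
      proof -
        have na: "norm a < 1" using zs a \<rho> by force
        have ia: "\<bar>Im a\<bar> \<le> 1" using abs_Im_le_cmod[of a] na by simp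
        show b1: "norm (blaschke a z) \<le> 1" using norm_blaschke_le[OF na] z by simp
        have "\<bar>(y - Im a) / 2\<bar> \<le> norm (z - a) / 2" using abs_Im_le_cmod[of "z - a"] by (simp add: z_def)
        also have "\<dots> \<le> norm (blaschke a z)" using norm_blaschke_ge[OF na] z by simp
        finally have b2: "\<bar>(y - Im a) / 2\<bar> \<le> norm (blaschke a z)" .
        have p: "0 < \<bar>(y - Im a) / 2\<bar>" using y a by auto
        then show "blaschke a z \<noteq> 0" using b2 by auto
        have "ln \<bar>(y - Im a) / 2\<bar> \<le> ln (norm (blaschke a z))" using p b2 by (subst ln_le_cancel_iff) auto
        moreover have "0 < norm (blaschke a z)" using p b2 by linarith
        then have "ln (norm (blaschke a z)) \<le> 0" using b1 by (subst ln_le_zero_iff) auto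
        ultimately have "(ln (norm (blaschke a z)))\<^sup>2 \<le> (ln \<bar>(y - Im a) / 2\<bar>)\<^sup>2"
          by (simp add: abs_le_square_iff[symmetric])
        also have "\<dots> \<le> 16 * \<bar>(y - Im a) / 2\<bar> powr (-1/2)"
          using p b2 b1 by (intro ln_squared_le_root) auto
        finally have "(ln (norm (blaschke a z)))\<^sup>2 \<le> 16 * \<bar>(y - Im a) / 2\<bar> powr (-1/2)" .
        then show "(ln (norm (blaschke a z)))\<^sup>2 \<le> 16 * (indicator {-2..2} (y - Im a) * \<bar>(y - Im a) / 2\<bar> powr (-1/2))"
        proof -
          have "y - Im a \<in> {-2..2}" using Imz ia by auto
          then show ?thesis using \<open>(ln (norm (blaschke a z)))\<^sup>2 \<le> 16 * \<bar>(y - Im a) / 2\<bar> powr (-1/2)\<close>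
            by (simp only: indicator_simps mult_1)
        qed
      qed
      have "ln (norm (\<Prod>a\<leftarrow>zs. blaschke a z)) = (\<Sum>a\<leftarrow>zs. ln (norm (blaschke a z)))"
        using blnz by (induction zs) (auto simp: norm_mult ln_mult prod_list_zero_iff)
      also have "\<dots> = (\<Sum>i<n. ln (norm (blaschke (zs ! i) z)))"
        by (simp add: sum_list_sum_nth n_def atLeast0LessThan)
      finally have lg: "ln (norm (g z)) = (\<Sum>i<n. ln (norm (blaschke (zs ! i) z))) + ln (norm (h z))"
        using fact[OF z(2)] gz by (simp add: norm_mult ln_mult)
      have h2: "(ln (norm (h z)))\<^sup>2 \<le> (c * (1 + H))\<^sup>2"
      proof -
        have "- ln (norm (h z)) \<le> c * (1 - ln (norm (h 0)))"
          unfolding c_def using h \<rho> g(2) hnz h1 z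
          by (intro zero_free_harnack) (auto elim!: holomorphic_on_subset)
        also have "\<dots> \<le> c * (1 + H)"
        proof -
          have "ln (norm (g 0)) \<le> ln (norm (h 0))" using h0 g0 by (subst ln_le_cancel_iff) (auto intro: less_le_trans)
          then have "- ln (norm (h 0)) \<le> H" using g0 by (simp add: H_def ln_div)
          then show ?thesis using c by simp
        qed
        finally have "- ln (norm (h z)) \<le> c * (1 + H)" .
        moreover have "ln (norm (h z)) \<le> 0" using h1[OF z(2)] hnz[OF z(3)] by (simp add: ln_le_zero_iff)
        ultimately have "(- ln (norm (h z)))\<^sup>2 \<le> (c * (1 + H))\<^sup>2" by (intro power_mono) auto
        then show ?thesis by simp
      qed
      define Q where "Q = (\<Sum>i<n. 16 * (indicator {-2..2} (y - Im (zs!i)) * \<bar>(y - Im (zs!i)) / 2\<bar> powr (-1/2)))"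
      have "(\<Sum>i<n. (ln (norm (blaschke (zs ! i) z)))\<^sup>2) \<le> Q"
        unfolding Q_def by (intro sum_mono bl) (simp add: n_def)
      then have "(\<Sum>i<n. (ln (norm (blaschke (zs ! i) z)))\<^sup>2) * real n \<le> Q * real n"
        by (intro mult_right_mono) auto
      moreover have "(\<Sum>i<n. ln (norm (blaschke (zs ! i) z)))\<^sup>2 \<le> (\<Sum>i<n. (ln (norm (blaschke (zs ! i) z)))\<^sup>2) * real n"
        using sum_squared_le_sum_of_squares[of "\<lambda>i. ln (norm (blaschke (zs ! i) z))" "{..<n}"] by simp
      moreover have "(ln (norm (g z)))\<^sup>2 \<le> 2 * (\<Sum>i<n. ln (norm (blaschke (zs ! i) z)))\<^sup>2 + 2 * (ln (norm (h z)))\<^sup>2"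
        unfolding lg using sum_squares_bound[of "\<Sum>i<n. ln (norm (blaschke (zs ! i) z))" "ln (norm (h z))"]
        by (simp add: power2_sum)
      moreover have "D y = 2 * (Q * real n)"
        by (simp add: D_def Q_def sum_distrib_left sum_distrib_right mult_ac)
      ultimately have "(ln (norm (g z)))\<^sup>2 \<le> D y + 2 * (c * (1 + H))\<^sup>2"
        using h2 by linarith
      moreover have "D y \<ge> 0" unfolding D_def by (intro sum_nonneg) auto
      moreover have "E y = 2 * (c * (1 + H))\<^sup>2" using Imz by (simp add: E_def indicator_def abs_le_iff)
      ultimately show ?thesis using True by (simp add: z_def flip: ennreal_plus)
    qed auto
    have "(\<integral>\<^sup>+y. ennreal ((ln (norm (g (Complex x y))))\<^sup>2) * indicator {y. norm (Complex x y) \<le> r} y \<partial>lborel)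
       \<le> (\<integral>\<^sup>+y. ennreal (D y) + ennreal (E y) \<partial>lborel)"
    proof (rule nn_integral_mono_AE)
      have "AE y in lborel. y \<notin> Im ` set zs" 
        by (rule AE_not_in) (auto intro: finite_imp_null_set_lborel)
      then show "AE y in lborel. ennreal ((ln (norm (g (Complex x y))))\<^sup>2) * indicator {y. norm (Complex x y) \<le> r} y
         \<le> ennreal (D y) + ennreal (E y)"
        by eventually_elim (rule pw)
    qed
    also have "\<dots> = (\<integral>\<^sup>+y. ennreal (D y) \<partial>lborel) + (\<integral>\<^sup>+y. ennreal (E y) \<partial>lborel)"
      unfolding D_def E_def by (intro nn_integral_add) auto
    also have "(\<integral>\<^sup>+y. ennreal (D y) \<partial>lborel) = (\<Sum>i<n. \<integral>\<^sup>+y. ennreal (2 * real n * 16) * ennreal (indicator {-2..2} (y - Im (zs ! i)) * \<bar>(y - Im (zs ! i)) / 2\<bar> powr (-1/2)) \<partial>lborel)"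
      unfolding D_def by (subst nn_integral_sum[symmetric]) (auto simp: ennreal_mult[symmetric] simp flip: sum_ennreal)
    also have "\<dots> = (\<Sum>i<n. ennreal (2 * real n * 16) * (\<integral>\<^sup>+y. ennreal (indicator {-2..2} (y - Im (zs ! i)) * \<bar>(y - Im (zs ! i)) / 2\<bar> powr (-1/2)) \<partial>lborel))"
      by (intro sum.cong nn_integral_cmult) auto
    also have "\<dots> \<le> (\<Sum>i<n. ennreal (2 * real n * 16) * ennreal K)"
      by (intro sum_mono mult_left_mono K) auto
    also have "\<dots> = ennreal (32 * (real n)\<^sup>2 * K)"
      using K by (simp add: ennreal_mult[symmetric] ennreal_of_nat_eq_real_of_nat power2_eq_square mult_ac)
    also have "\<dots> \<le> ennreal (32 * (L * (1 + H))\<^sup>2 * K)"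
    proof -
      have "real n \<le> L * (1 + H)" using nH L by (simp add: algebra_simps)
      then show ?thesis using K by (intro ennreal_leI mult_right_mono mult_left_mono power_mono) auto
    qed
    also have "(\<integral>\<^sup>+y. ennreal (E y) \<partial>lborel) = ennreal (4 * (c * (1 + H))\<^sup>2)"
    proof -
      have "(\<integral>\<^sup>+y. ennreal (E y) \<partial>lborel) = (\<integral>\<^sup>+(y::real). ennreal (2 * (c * (1 + H))\<^sup>2) * indicator {-1..1} y \<partial>lborel)"
        by (intro nn_integral_cong) (simp add: E_def indicator_def)
      also have "\<dots> = ennreal (2 * (c * (1 + H))\<^sup>2) * ennreal 2"
        by (subst nn_integral_cmult_indicator) auto
      finally show ?thesis by (simp add: ennreal_mult[symmetric] mult_ac del: ennreal_numeral)
    qed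
    also have "ennreal (32 * (L * (1 + H))\<^sup>2 * K) + ennreal (4 * (c * (1 + H))\<^sup>2) = ennreal (C * (1 + H)\<^sup>2)"
    proof -
      have "32 * (L * (1 + H))\<^sup>2 * K + 4 * (c * (1 + H))\<^sup>2 = C * (1 + H)\<^sup>2"
        unfolding C_def power_mult_distrib by algebra
      then show ?thesis using K by (simp flip: ennreal_plus)
    qed
    finally show ?thesis by (auto simp: H_def add_right_mono)
  qed
  show thesis by (rule that[OF C main])
qed

section \<open>Jensen's inequality for truncated logarithms\<close>

text \<open>
  A function without zeros on the closed disc has a holomorphic logarithm on a slightly larger disc,
  whose real part satisfies the mean value property.
\<close>

lemma ln_norm_circle_mean:
  assumes h: "h holomorphic_on ball 0 R" "1 < R" and nz: "\<And>z. norm z \<le> 1 \<Longrightarrow> h z \<noteq> 0"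
  shows "integral {0..1} (\<lambda>x. ln (norm (h (circ 1 x)))) = ln (norm (h 0))"
proof -
  define U where "U = {z \<in> ball 0 R. h z \<noteq> 0}"
  have "open (ball 0 R \<inter> h -` (- {0}))"
    using h by (intro continuous_open_preimage holomorphic_on_imp_continuous_on) auto
  also have "ball 0 R \<inter> h -` (- {0}) = U" by (auto simp: U_def)
  finally have "open U" .
  moreover have sU: "cball 0 1 \<subseteq> U" using nz h by (auto simp: U_def)
  ultimately obtain e where e: "e > 0" "(\<Union>x\<in>cball 0 1. cball x e) \<subseteq> U"
    using compact_subset_open_imp_cball_epsilon_subset[of "cball 0 1" U] by auto
  have sub: "ball 0 (1 + e) \<subseteq> U"
  proof
    fix z :: complex assume "z \<in> ball 0 (1 + e)"
    then have z: "norm z < 1 + e" by simp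
    show "z \<in> U"
    proof (cases "norm z \<le> 1")
      case True then show ?thesis using sU by auto
    next
      case False
      then have "z \<noteq> 0" by auto
      then have "z = norm z *\<^sub>R sgn z" by (simp add: sgn_div_norm)
      then have "z - sgn z = (norm z - 1) *\<^sub>R sgn z" by (metis scaleR_left_diff_distrib scaleR_one)
      then have "dist (sgn z) z = norm z - 1"
        using False \<open>z \<noteq> 0\<close> by (simp add: dist_norm norm_minus_commute[of "sgn z"] norm_sgn)
      then have "z \<in> cball (sgn z) e" "sgn z \<in> cball 0 1" using z by (auto simp: norm_sgn)
      then show ?thesis using e by blast
    qed
  qed
  obtain l where l: "l holomorphic_on ball 0 (1 + e)" "\<And>z. z \<in> ball 0 (1 + e) \<Longrightarrow> exp (l z) = h z"
  proof (rule holomorphic_logarithm_exists[of "ball 0 (1 + e)" h 0])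
    show "h holomorphic_on ball 0 (1 + e)"
      by (rule holomorphic_on_subset[OF h(1)]) (use sub in \<open>auto simp: U_def\<close>)
    show "\<And>x. x \<in> ball 0 (1 + e) \<Longrightarrow> h x \<noteq> 0" using sub by (auto simp: U_def)
  qed (use e in auto)
  have "((\<lambda>x. l (0 + circ 1 x)) has_integral l 0) {0..1}"
    using l e by (intro circle_mean_value) (auto elim!: holomorphic_on_subset)
  then have "((\<lambda>x. Re (l (0 + circ 1 x))) has_integral Re (l 0)) {0..1}"
    by (rule has_integral_Re)
  moreover have "Re (l z) = ln (norm (h z))" if "norm z \<le> 1" for z
    using l(2)[of z, symmetric] that e by simp
  ultimately show ?thesis by (simp add: integral_unique)
qed

text \<open>
  Choosing \<open>\<rho>\<close> beyond all zeros in the disc, the Blaschke factorization leaves a quotient that is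
  zero-free on the closed disc, has the same modulus on the boundary and is at least as large at the centre.
\<close>

lemma jensen_unit_disc:
  assumes g: "g holomorphic_on ball 0 R" "1 < R" and nz: "\<And>z. norm z = 1 \<Longrightarrow> g z \<noteq> 0" and g0: "g 0 \<noteq> 0"
  shows "ln (norm (g 0)) \<le> integral {0..1} (\<lambda>x. ln (norm (g (circ 1 x))))"
proof -
  have cont: "continuous_on (cball 0 1) g"
    using g by (auto intro!: holomorphic_on_imp_continuous_on elim!: holomorphic_on_subset)
  have "compact (g ` cball 0 1)" by (intro compact_continuous_image cont compact_cball)
  then obtain M where M: "\<And>z. norm z \<le> 1 \<Longrightarrow> norm (g z) \<le> M"
    by (meson bounded_iff compact_imp_bounded imageI mem_cball_0)
  have Mp: "M > 0" using M[of 0] g0 by (auto intro: less_le_trans[of 0 "norm (g 0)"])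
  define Z where "Z = {z \<in> cball 0 1. g z = 0}"
  have "compact Z" unfolding Z_def
    using continuous_closed_preimage_constant[OF cont closed_cball, of 0]
    by (intro compact_eq_bounded_closed[THEN iffD2] conjI bounded_subset[OF bounded_cball[of 0 1]]) auto
  have "\<exists>\<rho>. 0 < \<rho> \<and> \<rho> < 1 \<and> (\<forall>z\<in>Z. norm z \<le> \<rho>)"
  proof (cases "Z = {}")
    case False
    then obtain z0 where z0: "z0 \<in> Z" "\<And>z. z \<in> Z \<Longrightarrow> norm z \<le> norm z0"
      using continuous_attains_sup[OF \<open>compact Z\<close> False, of norm] by (auto intro: continuous_intros)
    have "norm z0 < 1" using z0(1) nz[of z0] by (auto simp: Z_def less_le)
    moreover have "z0 \<noteq> 0" using z0 g0 by (auto simp: Z_def)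
    ultimately show ?thesis using z0 by (intro exI[of _ "norm z0"]) auto
  qed (auto intro: exI[of _ "1/2"])
  then obtain \<rho> where \<rho>: "0 < \<rho>" "\<rho> < 1" "\<And>z. norm z \<le> 1 \<Longrightarrow> g z = 0 \<Longrightarrow> norm z \<le> \<rho>"
    by (auto simp: Z_def)
  obtain zs h where zs: "set zs \<subseteq> cball 0 \<rho>" and h: "h holomorphic_on ball 0 R"
    and fact: "\<And>z. norm z \<le> 1 \<Longrightarrow> g z / of_real M = (\<Prod>a\<leftarrow>zs. blaschke a z) * h z"
    and hnz: "\<And>z. norm z \<le> \<rho> \<Longrightarrow> h z \<noteq> 0" and h0: "norm (g 0 / of_real M) \<le> norm (h 0)"
  proof (rule blaschke_factorization[of "\<lambda>z. g z / of_real M" R \<rho>])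
    show "(\<lambda>z. g z / of_real M) holomorphic_on ball 0 R"
      using g(1) Mp by (intro holomorphic_intros) auto
    show "norm (g z / of_real M) \<le> 1" if "norm z = 1" for z
      using M[of z] that Mp by (simp add: norm_divide)
  qed (use g g0 Mp \<rho> in auto)
  have hnz1: "h z \<noteq> 0" if "norm z \<le> 1" for z
    using hnz[of z] fact[OF that] \<rho>(3)[OF that] Mp by force
  have hg: "norm (h z) = norm (g z) / M" if "norm z = 1" for z
  proof -
    have "norm (blaschke a z) = 1" if "a \<in> set zs" for a
    proof -
      have "z \<noteq> a" using that zs \<rho> \<open>norm z = 1\<close> by force
      then show ?thesis by (simp add: blaschke_def norm_divide norm_one_minus_cnj[OF \<open>norm z = 1\<close>])
    qed
    then have "(\<Prod>a\<leftarrow>zs. norm (blaschke a z)) = 1" by (induction zs) auto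
    then show ?thesis using arg_cong[OF fact[of z], of norm] that Mp
      by (simp add: norm_mult norm_divide norm_prod_list o_def)
  qed
  have "ln (norm (g 0)) - ln M = ln (norm (g 0) / M)" using g0 Mp by (simp add: ln_div)
  also have "\<dots> \<le> ln (norm (h 0))"
    using h0 g0 Mp hnz1[of 0] by (subst ln_le_cancel_iff) (auto simp: norm_divide)
  also have "\<dots> = integral {0..1} (\<lambda>x. ln (norm (h (circ 1 x))))"
    using ln_norm_circle_mean[OF h g(2)] hnz1 by simp
  also have "\<dots> = integral {0..1} (\<lambda>x. ln (norm (g (circ 1 x))) - ln M)"
    using nz Mp by (intro integral_cong) (simp add: hg ln_div)
  also have "\<dots> = integral {0..1} (\<lambda>x. ln (norm (g (circ 1 x)))) - ln M"
  proof -
    have "continuous_on {0..1} (\<lambda>x. ln (norm (g (circ 1 x))))"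
      using nz by (intro continuous_on_ln continuous_on_norm continuous_on_compose2[OF cont] continuous_intros) auto
    then show ?thesis by (subst integral_diff) (auto intro: integrable_continuous_real)
  qed
  finally show ?thesis by simp
qed

text \<open>
  The logarithm of the modulus truncated from below. Unlike \<open>log |z|\<close> it is continuous everywhere and
  globally Lipschitz, but it keeps the submean property along holomorphic functions.
\<close>

definition tlog :: "real \<Rightarrow> complex \<Rightarrow> real" where
  "tlog \<epsilon> z = ln (max (norm z) \<epsilon>)"

lemma continuous_on_tlog [continuous_intros]:
  assumes "0 < \<epsilon>" "continuous_on S g" shows "continuous_on S (\<lambda>x. tlog \<epsilon> (g x))"
  unfolding tlog_def using assms by (intro continuous_intros) (auto simp: max_def)

text \<open>
  Jensen's inequality applies on circles free of zeros. All but finitely many radii are of this kind,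
  and both sides depend continuously on the radius.
\<close>

lemma jensen_truncated:
  assumes g: "g holomorphic_on ball s R" and r: "0 < r" "r < R" and \<epsilon>: "0 < \<epsilon>"
  shows "tlog \<epsilon> (g s) \<le> integral {0..1} (\<lambda>x. tlog \<epsilon> (g (s + circ r x)))"
proof (cases "g s = 0")
  case True
  have cont: "continuous_on (sphere s r) (\<lambda>z. tlog \<epsilon> (g z))"
    using g r \<epsilon> by (intro continuous_intros holomorphic_on_imp_continuous_on) (auto elim!: holomorphic_on_subset)
  have "tlog \<epsilon> (g s) = integral {0..1} (\<lambda>x::real. ln \<epsilon>)" using True \<epsilon> by (simp add: tlog_def max_def)
  also have "\<dots> \<le> integral {0..1} (\<lambda>x. tlog \<epsilon> (g (s + circ r x)))"
    using \<epsilon> by (intro integral_le circle_mean_integrable[OF cont] r) (auto simp: tlog_def)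
  finally show ?thesis .
next
  case False
  define A where "A t = integral {0..1} (\<lambda>x. tlog \<epsilon> (g (s + circ t x)))" for t
  define r1 where "r1 = (r + R) / 2"
  have r1: "r < r1" "r1 < R" using r by (auto simp: r1_def)
  have good: "tlog \<epsilon> (g s) \<le> A t" if t: "0 < t" "t < R" and nz: "\<And>z. dist s z = t \<Longrightarrow> g z \<noteq> 0" for t
  proof -
    have cont: "continuous_on (sphere s t) g"
      using g t by (intro continuous_intros holomorphic_on_imp_continuous_on) (auto elim!: holomorphic_on_subset)
    have "ln (norm (g (s + of_real t * 0))) \<le> integral {0..1} (\<lambda>x. ln (norm (g (s + of_real t * circ 1 x))))"
    proof (rule jensen_unit_disc[of "\<lambda>z. g (s + of_real t * z)" "R / t"])
      show "(\<lambda>z. g (s + of_real t * z)) holomorphic_on ball 0 (R / t)"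
        using t by (intro holomorphic_on_compose_gen[OF _ g, unfolded o_def] holomorphic_intros)
          (auto simp: dist_norm norm_mult field_simps)
      show "1 < R / t" using t by simp
      show "g (s + of_real t * z) \<noteq> 0" if "norm z = 1" for z
        using that t by (intro nz) (auto simp: dist_norm norm_mult)
      show "g (s + of_real t * 0) \<noteq> 0" using False by simp
    qed
    moreover have "of_real t * circ 1 x = circ t x" for x by (simp add: circ_def)
    ultimately have 1: "ln (norm (g s)) \<le> integral {0..1} (\<lambda>x. ln (norm (g (s + circ t x))))" by simp
    have i1: "(\<lambda>x. ln (norm (g (s + circ t x)))) integrable_on {0..1}"
      by (rule circle_mean_integrable) (use nz t cont in \<open>auto intro!: continuous_intros\<close>)
    have i2: "(\<lambda>x. tlog \<epsilon> (g (s + circ t x))) integrable_on {0..1}"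
      by (rule circle_mean_integrable) (use t cont \<epsilon> in \<open>auto intro!: continuous_intros\<close>)
    have "integral {0..1} (\<lambda>x. ln (norm (g (s + circ t x)))) \<le> A t"
      unfolding A_def using nz t \<epsilon> by (intro integral_le i1 i2) (auto simp: tlog_def dist_norm)
    moreover have "integral {0..1} (\<lambda>x::real. ln \<epsilon>) \<le> A t"
      unfolding A_def using \<epsilon> by (intro integral_le i2) (auto simp: tlog_def)
    ultimately show ?thesis using 1 by (auto simp: tlog_def max_def)
  qed
  define Z where "Z = {z \<in> cball s r1. g z = 0}"
  have "finite Z"
  proof (rule ccontr)
    assume inf: "infinite Z"
    have "compact (cball s r1)" by simp
    then obtain w where w: "w \<in> cball s r1" "w islimpt Z"
      using inf unfolding compact_eq_Bolzano_Weierstrass by (auto simp: Z_def)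
    have "g s = 0"
      by (rule analytic_continuation[OF g, of Z w s]) (use w r r1 in \<open>auto simp: Z_def\<close>)
    then show False using False by simp
  qed
  define B where "B = dist s ` Z"
  have "finite B" using \<open>finite Z\<close> by (simp add: B_def)
  then have "\<not> r islimpt B" using islimpt_finite by blast
  then have "\<forall>\<^sub>F t in at r. t \<notin> B" by (simp add: islimpt_iff_eventually)
  moreover have "\<forall>\<^sub>F t in at r. 0 < t \<and> t < r1"
    using r r1 by (intro eventually_at_in_open'[of "{0<..<r1}" r, simplified]) auto
  ultimately have ev: "\<forall>\<^sub>F t in at r. tlog \<epsilon> (g s) \<le> A t"
  proof eventually_elim
    case (elim t)
    then show ?case using r1 by (intro good) (auto simp: B_def Z_def)
  qed
  have "continuous_on (cbox 0 r1) (\<lambda>t. integral (cbox 0 1) (\<lambda>x. tlog \<epsilon> (g (s + circ t x))))"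
  proof (rule integral_continuous_on_param)
    have c: "continuous_on (ball s R) g" using g by (rule holomorphic_on_imp_continuous_on)
    have "continuous_on (cbox 0 r1 \<times> cbox 0 1) (\<lambda>(t, x). tlog \<epsilon> (g (s + circ t x)))"
      unfolding split_def
      by (intro continuous_on_tlog[OF \<epsilon>] continuous_on_compose2[OF c])
         (use r1 in \<open>auto intro!: continuous_intros simp: circ_def dist_norm norm_mult\<close>)
    then show "continuous_on (cbox 0 r1 \<times> cbox 0 1) (\<lambda>(t, x). tlog \<epsilon> (g (s + circ t x)))" .
  qed
  then have "continuous_on {0<..<r1} A" unfolding A_def by (auto elim!: continuous_on_subset)
  then have "isCont A r" using r r1 by (simp add: continuous_on_eq_continuous_at)
  then have "(A \<longlongrightarrow> A r) (at r)" by (simp add: isCont_def)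
  then have "tlog \<epsilon> (g s) \<le> A r"
    by (rule tendsto_lowerbound[OF _ ev]) simp
  then show ?thesis by (simp add: A_def)
qed

section \<open>Functions with bounded means on vertical lines\<close>

lemma Complex_measurable [measurable]: "Complex \<sigma> \<in> borel_measurable borel"
  by (intro borel_measurable_continuous_onI) (simp add: Complex_eq continuous_intros)

lemma open_half_plane [simp]: "open (half_plane \<kappa>)"
  unfolding half_plane_def by (rule open_halfspace_Re_gt)

lemma convex_half_plane [simp]: "convex (half_plane \<kappa>)"
  unfolding half_plane_def by (rule convex_halfspace_Re_gt)

lemma cball_subset_half_plane: "r < Re s \<Longrightarrow> cball s r \<subseteq> half_plane 0"
proof
  fix z assume "r < Re s" "z \<in> cball s r"
  then show "z \<in> half_plane 0" using abs_Re_le_cmod[of "s - z"] by (auto simp: half_plane_def dist_norm)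
qed

text \<open>
  The constant \<open>C\<close> serves all vertical lines at once, with first-power means as the only measure of
  size. Nonnegative integrals avoid integrability side conditions, and Borel measurability on the
  whole plane makes the integrands jointly measurable for Fubini's theorem.
\<close>

definition line_bounded :: "(complex \<Rightarrow> complex) \<Rightarrow> real \<Rightarrow> bool" where
  "line_bounded g C \<longleftrightarrow> 0 \<le> C \<and> g \<in> borel_measurable borel \<and> g holomorphic_on half_plane 0 \<and>
     (\<forall>\<sigma>>0. \<forall>T\<ge>1. (\<integral>\<^sup>+t. ennreal (norm (g (Complex \<sigma> t))) * indicator {-T..T} t \<partial>lborel) \<le> ennreal (2 * T * C))"

lemma line_boundedD:
  assumes "line_bounded g C"
  shows "0 \<le> C" "g \<in> borel_measurable borel" "g holomorphic_on half_plane 0"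
    "\<And>\<sigma> T. 0 < \<sigma> \<Longrightarrow> 1 \<le> T \<Longrightarrow> (\<integral>\<^sup>+t. ennreal (norm (g (Complex \<sigma> t))) * indicator {-T..T} t \<partial>lborel) \<le> ennreal (2 * T * C)"
  using assms by (auto simp: line_bounded_def)

lemma line_bounded_shift:
  assumes g: "line_bounded g C" and "0 < \<sigma>" "1 \<le> T"
  shows "(\<integral>\<^sup>+t. ennreal (norm (g (Complex \<sigma> (t + c)))) * indicator {-T..T} t \<partial>lborel) \<le> ennreal (2 * (T + \<bar>c\<bar>) * C)"
proof -
  note [measurable] = line_boundedD(2)[OF g]
  have "(\<integral>\<^sup>+t. ennreal (norm (g (Complex \<sigma> (t + c)))) * indicator {-T..T} t \<partial>lborel)
     = (\<integral>\<^sup>+t. ennreal (norm (g (Complex \<sigma> t))) * indicator {-T..T} (t - c) \<partial>lborel)"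
    using nn_integral_real_affine[of "\<lambda>t. ennreal (norm (g (Complex \<sigma> t))) * indicator {-T..T} (t - c)" 1 c]
    by (simp add: add.commute)
  also have "\<dots> \<le> (\<integral>\<^sup>+t. ennreal (norm (g (Complex \<sigma> t))) * indicator {-(T+\<bar>c\<bar>)..T+\<bar>c\<bar>} t \<partial>lborel)"
    by (intro nn_integral_mono mult_left_mono) (auto simp: indicator_def)
  also have "\<dots> \<le> ennreal (2 * (T + \<bar>c\<bar>) * C)"
    using assms by (intro line_boundedD(4)[OF g]) auto
  finally show ?thesis .
qed

lemma circle_norm_integrable:
  assumes g: "g holomorphic_on half_plane 0" and r: "0 < r" "r < \<sigma>"
  shows "(\<lambda>x. norm (g (Complex \<sigma> t + circ r x))) integrable_on {0..1}"
proof (rule circle_mean_integrable)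
  have "cball (Complex \<sigma> t) r \<subseteq> half_plane 0" using r by (intro cball_subset_half_plane) auto
  then show "continuous_on (sphere (Complex \<sigma> t) r) (\<lambda>z. norm (g z))"
    using g by (intro continuous_intros holomorphic_on_imp_continuous_on) (auto elim!: holomorphic_on_subset)
qed (rule r)

lemma circle_mean_nn:
  assumes g: "line_bounded g C" and r: "0 < r" "r < \<sigma>"
  shows "ennreal (integral {0..1} (\<lambda>x. norm (g (Complex \<sigma> t + circ r x))))
    = (\<integral>\<^sup>+x. ennreal (norm (g (Complex \<sigma> t + circ r x))) * indicator {0..1} x \<partial>lborel)"
proof -
  have "(\<lambda>x. norm (g (Complex \<sigma> t + circ r x))) integrable_on {0..1}"
    by (rule circle_norm_integrable[OF line_boundedD(3)[OF g] r])
  then have "((\<lambda>x. norm (g (Complex \<sigma> t + circ r x))) has_integral integral {0..1} (\<lambda>x. norm (g (Complex \<sigma> t + circ r x)))) {0..1}"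
    by (rule integrable_integral)
  then have "(\<integral>\<^sup>+x. indicator {0..1} x * norm (g (Complex \<sigma> t + circ r x)) \<partial>lborel) =
    ennreal (integral {0..1} (\<lambda>x. norm (g (Complex \<sigma> t + circ r x))))"
    by (intro nn_integral_has_integral_lebesgue) auto
  then show ?thesis by (simp add: ennreal_mult' ennreal_indicator mult.commute)
qed

lemma circle_mean_measurable:
  assumes g: "line_bounded g C" and r: "0 < r" "r < \<sigma>"
  shows "(\<lambda>t. ennreal (integral {0..1} (\<lambda>x. norm (g (Complex \<sigma> t + circ r x))))) \<in> borel_measurable borel"
proof -
  note [measurable] = line_boundedD(2)[OF g]
  show ?thesis unfolding circle_mean_nn[OF g r] by measurable
qed

text \<open>
  Each point of the circle moves the line to another vertical line in the half-plane and shifts it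
  vertically by at most \<open>r\<close>, so Fubini's theorem reduces the claim to shifted line means.
\<close>

lemma line_bounded_circle_mean:
  assumes g: "line_bounded g C" and r: "0 < r" "r < \<sigma>" and T: "1 \<le> T"
  shows "(\<integral>\<^sup>+t. ennreal (integral {0..1} (\<lambda>x. norm (g (Complex \<sigma> t + circ r x)))) * indicator {-T..T} t \<partial>lborel)
     \<le> ennreal (2 * (T + r) * C)"
proof -
  note [measurable] = line_boundedD(2)[OF g]
  have eq: "Complex \<sigma> t + circ r x = Complex (\<sigma> + Re (circ r x)) (t + Im (circ r x))" for t x
    by (simp add: complex_eq_iff)
  have [measurable]: "(\<lambda>x. Complex (\<sigma> + Re (circ r x)) (t + Im (circ r x))) \<in> borel_measurable borel" for t
    unfolding eq[symmetric] by measurable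
  have "(\<integral>\<^sup>+t. ennreal (integral {0..1} (\<lambda>x. norm (g (Complex \<sigma> t + circ r x)))) * indicator {-T..T} t \<partial>lborel)
     = (\<integral>\<^sup>+t. \<integral>\<^sup>+x. ennreal (norm (g (Complex \<sigma> t + circ r x))) * indicator {0..1} x * indicator {-T..T} t \<partial>lborel \<partial>lborel)"
    unfolding circle_mean_nn[OF g r] by (intro nn_integral_cong nn_integral_multc[symmetric]) measurable
  also have "\<dots> = (\<integral>\<^sup>+x. \<integral>\<^sup>+t. ennreal (norm (g (Complex \<sigma> t + circ r x))) * indicator {0..1} x * indicator {-T..T} t \<partial>lborel \<partial>lborel)"
    by (rule lborel_pair.Fubini') measurable
  also have "\<dots> = (\<integral>\<^sup>+x. (\<integral>\<^sup>+t. ennreal (norm (g (Complex (\<sigma> + Re (circ r x)) (t + Im (circ r x))))) * indicator {-T..T} t \<partial>lborel) * indicator {0..1} x \<partial>lborel)"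
    unfolding eq by (intro nn_integral_cong) (subst nn_integral_multc[symmetric], measurable, simp add: mult_ac)
  also have "\<dots> \<le> (\<integral>\<^sup>+(x::real). ennreal (2 * (T + r) * C) * indicator {0..1} x \<partial>lborel)"
  proof (intro nn_integral_mono mult_right_mono)
    fix x
    have "\<bar>Re (circ r x)\<bar> \<le> r" "\<bar>Im (circ r x)\<bar> \<le> r"
      using abs_Re_le_cmod[of "circ r x"] abs_Im_le_cmod[of "circ r x"] r by auto
    then have "(\<integral>\<^sup>+t. ennreal (norm (g (Complex (\<sigma> + Re (circ r x)) (t + Im (circ r x))))) * indicator {-T..T} t \<partial>lborel)
      \<le> ennreal (2 * (T + \<bar>Im (circ r x)\<bar>) * C)"
      using r T by (intro line_bounded_shift[OF g]) auto
    also have "\<dots> \<le> ennreal (2 * (T + r) * C)"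
      using \<open>\<bar>Im (circ r x)\<bar> \<le> r\<close> line_boundedD(1)[OF g] by (intro ennreal_leI mult_right_mono) auto
    finally show "(\<integral>\<^sup>+t. ennreal (norm (g (Complex (\<sigma> + Re (circ r x)) (t + Im (circ r x))))) * indicator {-T..T} t \<partial>lborel)
      \<le> ennreal (2 * (T + r) * C)" .
  qed auto
  also have "\<dots> = ennreal (2 * (T + r) * C)" by (simp add: nn_integral_cmult_indicator)
  finally show ?thesis .
qed

lemma fsigma_half_plane: "fsigma (half_plane 0)"
proof -
  have "half_plane 0 = (\<Union>n::nat. {s. Re s \<ge> inverse (real (Suc n))})"
  proof (intro set_eqI iffI)
    fix s assume "s \<in> half_plane 0"
    then show "s \<in> (\<Union>n::nat. {s. Re s \<ge> inverse (real (Suc n))})"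
      using reals_Archimedean[of "Re s"] by (auto simp: half_plane_def intro: less_imp_le)
  next
    fix s assume "s \<in> (\<Union>n::nat. {s. Re s \<ge> inverse (real (Suc n))})"
    then obtain n :: nat where "inverse (real (Suc n)) \<le> Re s" by auto
    moreover have "0 < inverse (real (Suc n))" by simp
    ultimately show "s \<in> half_plane 0" by (simp only: half_plane_def mem_Collect_eq)
  qed
  then show ?thesis
    by (simp only:) (intro fsigma.intros closed_halfspace_Re_ge)
qed

text \<open>
  A holomorphic function that is not identically zero has only countably many zeros. Hence the
  convention \<open>ln 0 = 0\<close> does not affect integrals of \<open>log |g|\<close> along vertical lines.
\<close>

lemma line_zeros_null:
  assumes g: "g holomorphic_on half_plane 0" and nz: "s \<in> half_plane 0" "g s \<noteq> 0" and \<sigma>: "0 < \<sigma>"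
  shows "AE t in lborel. g (Complex \<sigma> t) \<noteq> 0"
proof -
  have "countable {z \<in> half_plane 0. g z = 0}"
  proof (cases "g constant_on half_plane 0")
    case True
    then have "{z \<in> half_plane 0. g z = 0} = {}" using nz by (auto simp: constant_on_def)
    then show ?thesis by (metis countable_empty)
  next
    case False
    then show ?thesis using g by (intro holomorphic_countable_zeros) (auto intro: convex_connected fsigma_half_plane)
  qed
  then have "countable (Complex \<sigma> -` {z \<in> half_plane 0. g z = 0})"
    by (intro countable_image_inj_on[of "Complex \<sigma>"]) (auto simp: inj_on_def elim!: countable_subset[rotated])
  then have "Complex \<sigma> -` {z \<in> half_plane 0. g z = 0} \<in> null_sets lborel"
    by (rule countable_imp_null_set_lborel)
  then have "AE t in lborel. t \<notin> Complex \<sigma> -` {z \<in> half_plane 0. g z = 0}"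
    by (rule AE_not_in)
  then show ?thesis
    by eventually_elim (use \<sigma> in \<open>auto simp: half_plane_def\<close>)
qed

section \<open>Mean squares of the logarithm on vertical lines\<close>

text \<open>
  The local estimate is transported to the disc of radius \<open>\<sigma>0 - \<alpha>/2\<close> about \<open>\<sigma>0 + it\<close>. The function is
  divided by a bound \<open>M\<close> for it on that disc, which is at most 1 plus a multiple of the mean over the
  circle of radius \<open>\<sigma>0 - \<alpha>/4\<close>. The lower bound \<open>\<delta>\<close> at the centre shows that the logarithm
  there is at least \<open>- log (1/\<delta>) - log M\<close> after the division, and \<open>(log M)^2 = O(M)\<close>
  brings the result back to the first power of the circle mean. The constants do not depend on the function.
\<close>

lemma log_square_block:
  assumes \<alpha>: "0 < \<alpha>" "\<alpha> \<le> \<sigma>0" and \<delta>: "0 < \<delta>" "\<delta> \<le> 1"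
  obtains A B :: real where "0 \<le> A" "0 \<le> B"
    "\<And>g C \<sigma> t. line_bounded g C \<Longrightarrow> (\<And>t. \<delta> \<le> norm (g (Complex \<sigma>0 t))) \<Longrightarrow> \<alpha> \<le> \<sigma> \<Longrightarrow> \<sigma> \<le> \<sigma>0 \<Longrightarrow>
      (\<integral>\<^sup>+\<tau>. ennreal ((ln (norm (g (Complex \<sigma> \<tau>))))\<^sup>2) * indicator {t - \<alpha>/4..t + \<alpha>/4} \<tau> \<partial>lborel)
      \<le> ennreal (A + B * integral {0..1} (\<lambda>x. norm (g (Complex \<sigma>0 t + circ (\<sigma>0 - \<alpha>/4) x))))"
proof -
  \<comment> \<open>Points with abscissa between \<open>\<alpha>\<close> and \<open>\<sigma>0\<close> and height within \<open>\<alpha>/4\<close> of \<open>t\<close> have distance at most \<open>\<sigma>0 - 3 \<alpha>/4\<close> from the centre; \<open>rr\<close> is this distance relative to \<open>R\<close>.\<close>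
  define R1 R l rr where "R1 = \<sigma>0 - \<alpha>/4" and "R = \<sigma>0 - \<alpha>/2" and "l = \<alpha>/4" and "rr = (\<sigma>0 - 3*\<alpha>/4) / R"
  have R: "0 < R" "R < R1" "0 < R1" "R1 < \<sigma>0" "0 < rr" "rr < 1" "0 < l" "l \<le> R" "R < \<sigma>0"
    using \<alpha> by (auto simp: R1_def R_def l_def rr_def divide_simps)
  obtain C0 :: real where C0: "0 < C0"
    "\<And>g R0 x. g holomorphic_on ball 0 R0 \<Longrightarrow> 1 < R0 \<Longrightarrow> (\<And>z. norm z = 1 \<Longrightarrow> norm (g z) \<le> 1) \<Longrightarrow> g 0 \<noteq> 0 \<Longrightarrow>
       (\<integral>\<^sup>+y. ennreal ((ln (norm (g (Complex x y))))\<^sup>2) * indicator {y. norm (Complex x y) \<le> rr} y \<partial>lborel)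
         \<le> ennreal (C0 * (1 + ln (1 / norm (g 0)))\<^sup>2)"
    using local_log_square[OF R(5,6)] by blast
  define d where "d = ln (1 / \<delta>)"
  have d: "0 \<le> d" using \<delta> by (simp add: d_def)
  define c where "c = R1 / (R1 - R)"
  have c: "0 < c" using R by (simp add: c_def)
  define P where "P = R * (4 * C0 + 4)"
  define A where "A = R * (4 * C0 * (1 + d)\<^sup>2) + 4 * P"
  define B where "B = 4 * P * c"
  have P: "0 \<le> P" using R C0 by (simp add: P_def)
  have A: "0 \<le> A" "0 \<le> B" using R C0 P c by (auto simp: A_def B_def)
  have main: "(\<integral>\<^sup>+\<tau>. ennreal ((ln (norm (g (Complex \<sigma> \<tau>))))\<^sup>2) * indicator {t - \<alpha>/4..t + \<alpha>/4} \<tau> \<partial>lborel)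
      \<le> ennreal (A + B * integral {0..1} (\<lambda>x. norm (g (Complex \<sigma>0 t + circ (\<sigma>0 - \<alpha>/4) x))))"
    if g: "line_bounded g C" and low: "\<And>t. \<delta> \<le> norm (g (Complex \<sigma>0 t))" and \<sigma>: "\<alpha> \<le> \<sigma>" "\<sigma> \<le> \<sigma>0" for g C \<sigma> t
  proof -
    note [measurable] = line_boundedD(2)[OF g]
    define s where "s = Complex \<sigma>0 t"
    define S where "S = integral {0..1} (\<lambda>x. norm (g (s + circ R1 x)))"
    define M where "M = max 1 (c * S)"
    have M: "1 \<le> M" by (simp add: M_def)
    have sub: "ball s \<sigma>0 \<subseteq> half_plane 0"
    proof
      fix z assume "z \<in> ball s \<sigma>0"
      then show "z \<in> half_plane 0" using abs_Re_le_cmod[of "s - z"]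
        by (auto simp: half_plane_def dist_norm s_def)
    qed
    have gh: "g holomorphic_on ball s \<sigma>0" using line_boundedD(3)[OF g] sub by (rule holomorphic_on_subset)
    have gM: "norm (g w) \<le> M" if "dist s w \<le> R" for w
    proof -
      have "norm (g w) \<le> c * S"
        unfolding c_def S_def using gh R that by (intro circle_bound) (auto elim!: holomorphic_on_subset)
      then show ?thesis by (simp add: M_def)
    qed
    have S0: "0 \<le> S" unfolding S_def s_def using R
      by (intro integral_nonneg circle_norm_integrable[OF line_boundedD(3)[OF g]]) auto
    define G where "G z = g (s + of_real R * z) / of_real M" for z
    have G: "G holomorphic_on ball 0 (\<sigma>0 / R)"
      unfolding G_def using R M
      by (intro holomorphic_intros holomorphic_on_compose_gen[OF _ gh, unfolded o_def])
        (auto simp: dist_norm norm_mult field_simps)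
    have G1: "norm (G z) \<le> 1" if "norm z = 1" for z
      using gM[of "s + of_real R * z"] that R M by (simp add: G_def norm_divide dist_norm norm_mult)
    have low': "\<delta> \<le> norm (g s)" using low[of t] by (simp add: s_def)
    have gs0: "g s \<noteq> 0" using low' \<delta> by auto
    then have G0: "G 0 \<noteq> 0" using M by (auto simp: G_def)
    have H: "ln (1 / norm (G 0)) \<le> ln M + d"
    proof -
      have "ln \<delta> \<le> ln (norm (g s))" using low' \<delta> by (subst ln_le_cancel_iff) auto
      moreover have "ln (1 / norm (G 0)) = ln M - ln (norm (g s))"
        using gs0 M by (simp add: G_def norm_divide ln_div)
      ultimately show ?thesis using \<delta> by (simp add: d_def ln_div)
    qed
    have H0: "0 \<le> ln (1 / norm (G 0))"
    proof -
      have "norm (G 0) \<le> 1" using gM[of s] R M by (simp add: G_def norm_divide)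
      then show ?thesis using G0 by simp
    qed
    define x where "x = (\<sigma> - \<sigma>0) / R"
    have pt: "s + of_real R * Complex x y = Complex \<sigma> (t + R * y)" for y
      using R by (simp add: complex_eq_iff s_def x_def)
    define I where "I y = ennreal ((ln (norm (G (Complex x y))))\<^sup>2) * indicator {y. norm (Complex x y) \<le> rr} y" for y
    define J where "J y = ennreal (2 * (ln M)\<^sup>2) * indicator {-1..1} y" for y :: real
    have Gm [measurable]: "G \<in> borel_measurable borel" unfolding G_def by measurable
    have Im [measurable]: "I \<in> borel_measurable borel" unfolding I_def by measurable
    have "(\<integral>\<^sup>+\<tau>. ennreal ((ln (norm (g (Complex \<sigma> \<tau>))))\<^sup>2) * indicator {t - \<alpha>/4..t + \<alpha>/4} \<tau> \<partial>lborel)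
       = ennreal R * (\<integral>\<^sup>+y. ennreal ((ln (norm (g (Complex \<sigma> (t + R * y)))))\<^sup>2) * indicator {t - \<alpha>/4..t + \<alpha>/4} (t + R * y) \<partial>lborel)"
      using R nn_integral_real_affine[of "\<lambda>\<tau>. ennreal ((ln (norm (g (Complex \<sigma> \<tau>))))\<^sup>2) * indicator {t - \<alpha>/4..t + \<alpha>/4} \<tau>" R t] by simp
    also have "\<dots> \<le> ennreal R * (\<integral>\<^sup>+y. 2 * I y + J y \<partial>lborel)"
    proof (intro mult_left_mono nn_integral_mono)
      fix y
      show "ennreal ((ln (norm (g (Complex \<sigma> (t + R * y)))))\<^sup>2) * indicator {t - \<alpha>/4..t + \<alpha>/4} (t + R * y) \<le> 2 * I y + J y"
      proof (cases "t + R * y \<in> {t - \<alpha>/4..t + \<alpha>/4} \<and> g (Complex \<sigma> (t + R * y)) \<noteq> 0")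
        case True
        then have y: "R * \<bar>y\<bar> \<le> l" using R by (auto simp: l_def abs_mult[symmetric] abs_le_iff abs_if split: if_splits)
        have y1: "\<bar>y\<bar> \<le> 1" using y R mult_left_le_imp_le[of R "\<bar>y\<bar>" 1] by linarith
        have "norm (Complex x y) \<le> \<bar>x\<bar> + \<bar>y\<bar>" using cmod_le[of "Complex x y"] by simp
        also have "\<dots> \<le> (\<sigma>0 - \<alpha>) / R + l / R"
          using y \<sigma> R by (intro add_mono) (auto simp: x_def divide_simps mult.commute abs_if)
        also have "\<sigma>0 - \<alpha> + l = \<sigma>0 - 3*\<alpha>/4" by (simp add: l_def)
        then have "(\<sigma>0 - \<alpha>) / R + l / R = rr" by (simp only: rr_def add_divide_distrib[symmetric])
        finally have nr: "norm (Complex x y) \<le> rr" .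
        have "ln (norm (g (Complex \<sigma> (t + R * y)))) = ln (norm (G (Complex x y))) + ln M"
          using True M by (simp add: G_def pt norm_divide ln_div)
        then have "(ln (norm (g (Complex \<sigma> (t + R * y)))))\<^sup>2 \<le> 2 * (ln (norm (G (Complex x y))))\<^sup>2 + 2 * (ln M)\<^sup>2"
          using sum_squares_bound[of "ln (norm (G (Complex x y)))" "ln M"] by (simp add: power2_sum)
        then have "ennreal ((ln (norm (g (Complex \<sigma> (t + R * y)))))\<^sup>2) \<le> ennreal (2 * (ln (norm (G (Complex x y))))\<^sup>2) + ennreal (2 * (ln M)\<^sup>2)"
          by (simp add: ennreal_leI flip: ennreal_plus)
        moreover have "y \<in> {-1..1}" using y1 by (auto simp: abs_le_iff)
        ultimately show ?thesis using True nr by (simp add: I_def J_def ennreal_mult)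
      next
        case False
        then show ?thesis by (auto simp: indicator_def)
      qed
    qed auto
    also have "(\<integral>\<^sup>+y. 2 * I y + J y \<partial>lborel) = 2 * (\<integral>\<^sup>+y. I y \<partial>lborel) + (\<integral>\<^sup>+y. J y \<partial>lborel)"
      unfolding J_def by (subst nn_integral_add) (auto simp: nn_integral_cmult)
    also have "\<dots> \<le> ennreal (2 * (C0 * (1 + (ln M + d))\<^sup>2)) + ennreal (4 * (ln M)\<^sup>2)"
    proof (rule add_mono)
      have "(\<integral>\<^sup>+y. I y \<partial>lborel) \<le> ennreal (C0 * (1 + ln (1 / norm (G 0)))\<^sup>2)"
        unfolding I_def using R by (intro C0(2)[OF G _ G1 G0]) auto
      also have "\<dots> \<le> ennreal (C0 * (1 + (ln M + d))\<^sup>2)"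
        using H H0 C0 by (intro ennreal_leI mult_left_mono power_mono) auto
      finally have "2 * (\<integral>\<^sup>+y. I y \<partial>lborel) \<le> 2 * ennreal (C0 * (1 + (ln M + d))\<^sup>2)" by (intro mult_left_mono) auto
      then show "2 * (\<integral>\<^sup>+y. I y \<partial>lborel) \<le> ennreal (2 * (C0 * (1 + (ln M + d))\<^sup>2))"
        using C0 by (simp add: ennreal_mult)
      have "(\<integral>\<^sup>+y. J y \<partial>lborel) = ennreal (2 * (ln M)\<^sup>2) * ennreal 2"
        unfolding J_def by (subst nn_integral_cmult_indicator) auto
      also have "\<dots> = ennreal (4 * (ln M)\<^sup>2)" by (simp add: ennreal_mult[symmetric] mult_ac del: ennreal_numeral)
      finally show "(\<integral>\<^sup>+y. J y \<partial>lborel) \<le> ennreal (4 * (ln M)\<^sup>2)" by simp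
    qed
    also have "ennreal R * (ennreal (2 * (C0 * (1 + (ln M + d))\<^sup>2)) + ennreal (4 * (ln M)\<^sup>2))
       = ennreal (R * (2 * (C0 * (1 + (ln M + d))\<^sup>2) + 4 * (ln M)\<^sup>2))"
    proof -
      have nn: "0 \<le> 2 * (C0 * (1 + (ln M + d))\<^sup>2)" "0 \<le> 4 * (ln M)\<^sup>2" "0 \<le> R" using R C0(1) by auto
      show ?thesis
        unfolding ennreal_plus[OF nn(1,2), symmetric] by (rule ennreal_mult[symmetric]) (use nn in auto)
    qed
    also have "\<dots> \<le> ennreal (A + B * S)"
    proof (rule ennreal_leI)
      have "(1 + (ln M + d))\<^sup>2 \<le> 2 * (1 + d)\<^sup>2 + 2 * (ln M)\<^sup>2"
        using sum_squares_bound[of "1 + d" "ln M"] by (simp add: power2_eq_square algebra_simps)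
      then have "C0 * (1 + (ln M + d))\<^sup>2 \<le> C0 * (2 * (1 + d)\<^sup>2 + 2 * (ln M)\<^sup>2)" using C0 by (intro mult_left_mono) auto
      then have "2 * (C0 * (1 + (ln M + d))\<^sup>2) + 4 * (ln M)\<^sup>2 \<le> 4 * C0 * (1 + d)\<^sup>2 + (4 * C0 + 4) * (ln M)\<^sup>2"
        by (simp add: algebra_simps)
      then have "R * (2 * (C0 * (1 + (ln M + d))\<^sup>2) + 4 * (ln M)\<^sup>2) \<le> R * (4 * C0 * (1 + d)\<^sup>2 + (4 * C0 + 4) * (ln M)\<^sup>2)"
        using R by (intro mult_left_mono) auto
      also have "\<dots> = R * (4 * C0 * (1 + d)\<^sup>2) + P * (ln M)\<^sup>2" by (simp add: P_def algebra_simps)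
      also have "P * (ln M)\<^sup>2 \<le> P * (4 * (1 + c * S))"
      proof (rule mult_left_mono[OF _ P])
        have "(ln M)\<^sup>2 \<le> 4 * M" by (rule ln_squared_le[OF M])
        also have "M \<le> 1 + c * S" using c S0 by (simp add: M_def)
        finally show "(ln M)\<^sup>2 \<le> 4 * (1 + c * S)" by simp
      qed
      finally show "R * (2 * (C0 * (1 + (ln M + d))\<^sup>2) + 4 * (ln M)\<^sup>2) \<le> A + B * S"
        by (simp add: A_def B_def algebra_simps)
    qed
    finally show ?thesis by (simp add: S_def s_def R1_def mult_left_mono)
  qed
  show thesis by (rule that[OF A main])
qed

text \<open>
  Average the block estimate over the height \<open>t\<close> of the centre: every \<open>\<tau>\<close> lies in the blocks of a set
  of centres of length \<open>\<alpha>/2\<close>, and circle means average to line means.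
\<close>

lemma log_square_mean:
  assumes \<alpha>: "0 < \<alpha>" "\<alpha> \<le> \<sigma>0" and \<delta>: "0 < \<delta>" "\<delta> \<le> 1" and C: "0 \<le> C"
  obtains K :: real where "0 \<le> K"
    "\<And>g \<sigma> T. line_bounded g C \<Longrightarrow> (\<And>t. \<delta> \<le> norm (g (Complex \<sigma>0 t))) \<Longrightarrow> \<alpha> \<le> \<sigma> \<Longrightarrow> \<sigma> \<le> \<sigma>0 \<Longrightarrow> 1 \<le> T \<Longrightarrow>
      (\<integral>\<^sup>+t. ennreal ((ln (norm (g (Complex \<sigma> t))))\<^sup>2) * indicator {-T..T} t \<partial>lborel) \<le> ennreal (K * T)"
proof -
  obtain A B :: real where A: "0 \<le> A" "0 \<le> B" and block:
    "\<And>g C \<sigma> t. line_bounded g C \<Longrightarrow> (\<And>t. \<delta> \<le> norm (g (Complex \<sigma>0 t))) \<Longrightarrow> \<alpha> \<le> \<sigma> \<Longrightarrow> \<sigma> \<le> \<sigma>0 \<Longrightarrow>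
      (\<integral>\<^sup>+\<tau>. ennreal ((ln (norm (g (Complex \<sigma> \<tau>))))\<^sup>2) * indicator {t - \<alpha>/4..t + \<alpha>/4} \<tau> \<partial>lborel)
      \<le> ennreal (A + B * integral {0..1} (\<lambda>x. norm (g (Complex \<sigma>0 t + circ (\<sigma>0 - \<alpha>/4) x))))"
    using log_square_block[OF \<alpha> \<delta>] by blast
  define K where "K = (A * (2 * (1 + \<alpha>/4)) + B * (2 * (1 + \<sigma>0) * C)) * (2 / \<alpha>)"
  have K: "0 \<le> K" using A C \<alpha> by (simp add: K_def)
  have main: "(\<integral>\<^sup>+t. ennreal ((ln (norm (g (Complex \<sigma> t))))\<^sup>2) * indicator {-T..T} t \<partial>lborel) \<le> ennreal (K * T)"
    if g: "line_bounded g C" and low: "\<And>t. \<delta> \<le> norm (g (Complex \<sigma>0 t))" and \<sigma>: "\<alpha> \<le> \<sigma>" "\<sigma> \<le> \<sigma>0" and T: "1 \<le> T" for g \<sigma> T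
  proof -
    note [measurable] = line_boundedD(2)[OF g]
    define \<phi> where "\<phi> \<tau> = ennreal ((ln (norm (g (Complex \<sigma> \<tau>))))\<^sup>2)" for \<tau>
    have [measurable]: "\<phi> \<in> borel_measurable borel" unfolding \<phi>_def by measurable
    define S where "S t = integral {0..1} (\<lambda>x. norm (g (Complex \<sigma>0 t + circ (\<sigma>0 - \<alpha>/4) x)))" for t
    have R1: "0 < \<sigma>0 - \<alpha>/4" "\<sigma>0 - \<alpha>/4 < \<sigma>0" using \<alpha> by auto
    have Sm [measurable]: "(\<lambda>t. ennreal (S t)) \<in> borel_measurable borel"
      unfolding S_def by (rule circle_mean_measurable[OF g R1])
    define l where "l = \<alpha> / 4"
    have l: "0 < l" using \<alpha> by (simp add: l_def)
    have "ennreal (2 * l) * (\<integral>\<^sup>+\<tau>. \<phi> \<tau> * indicator {-T..T} \<tau> \<partial>lborel) = (\<integral>\<^sup>+\<tau>. \<phi> \<tau> * indicator {-T..T} \<tau> * ennreal (2 * l) \<partial>lborel)"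
      by (subst nn_integral_multc) (auto simp: mult.commute)
    also have "\<dots> = (\<integral>\<^sup>+\<tau>. \<integral>\<^sup>+t. \<phi> \<tau> * indicator {-T..T} \<tau> * indicator {\<tau> - l..\<tau> + l} t \<partial>lborel \<partial>lborel)"
      using l by (intro nn_integral_cong, subst nn_integral_cmult_indicator) auto
    also have "\<dots> \<le> (\<integral>\<^sup>+\<tau>. \<integral>\<^sup>+t. \<phi> \<tau> * indicator {t - l..t + l} \<tau> * indicator {-(T+l)..T+l} t \<partial>lborel \<partial>lborel)"
      by (intro nn_integral_mono) (auto simp: indicator_def)
    also have "\<dots> = (\<integral>\<^sup>+t. \<integral>\<^sup>+\<tau>. \<phi> \<tau> * indicator {t - l..t + l} \<tau> * indicator {-(T+l)..T+l} t \<partial>lborel \<partial>lborel)"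
    proof (rule lborel_pair.Fubini')
      have "(\<lambda>(t, \<tau>). \<phi> \<tau> * indicator {x. t - l \<le> x \<and> x \<le> t + l} \<tau> * indicator {-(T+l)..T+l} t) \<in> borel_measurable (lborel \<Otimes>\<^sub>M lborel)"
        unfolding indicator_def by measurable
      moreover have "{x. t - l \<le> x \<and> x \<le> t + l} = {t - l..t + l}" for t by auto
      ultimately show "(\<lambda>(t, \<tau>). \<phi> \<tau> * indicator {t - l..t + l} \<tau> * indicator {-(T+l)..T+l} t) \<in> borel_measurable (lborel \<Otimes>\<^sub>M lborel)"
        by simp
    qed
    also have "\<dots> = (\<integral>\<^sup>+t. (\<integral>\<^sup>+\<tau>. \<phi> \<tau> * indicator {t - l..t + l} \<tau> \<partial>lborel) * indicator {-(T+l)..T+l} t \<partial>lborel)"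
      by (intro nn_integral_cong nn_integral_multc) measurable
    also have "\<dots> \<le> (\<integral>\<^sup>+t. (ennreal A + ennreal B * ennreal (S t)) * indicator {-(T+l)..T+l} t \<partial>lborel)"
    proof (intro nn_integral_mono mult_right_mono)
      fix t
      have "0 \<le> S t"
        unfolding S_def by (intro integral_nonneg circle_norm_integrable[OF line_boundedD(3)[OF g] R1]) auto
      then show "(\<integral>\<^sup>+\<tau>. \<phi> \<tau> * indicator {t - l..t + l} \<tau> \<partial>lborel) \<le> ennreal A + ennreal B * ennreal (S t)"
        using block[OF g low \<sigma>, of t] A by (simp add: \<phi>_def l_def S_def ennreal_mult)
    qed auto
    also have "\<dots> = ennreal A * (\<integral>\<^sup>+(t::real). indicator {-(T+l)..T+l} t \<partial>lborel) + ennreal B * (\<integral>\<^sup>+t. ennreal (S t) * indicator {-(T+l)..T+l} t \<partial>lborel)"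
      by (simp add: distrib_right nn_integral_add nn_integral_cmult mult.assoc)
    also have "\<dots> \<le> ennreal A * ennreal (2 * (T + l)) + ennreal B * ennreal (2 * (T + l + (\<sigma>0 - \<alpha>/4)) * C)"
    proof (intro add_mono mult_left_mono)
      show "(\<integral>\<^sup>+(t::real). indicator {-(T+l)..T+l} t \<partial>lborel) \<le> ennreal (2 * (T + l))" using l T by simp
      show "(\<integral>\<^sup>+t. ennreal (S t) * indicator {-(T+l)..T+l} t \<partial>lborel) \<le> ennreal (2 * (T + l + (\<sigma>0 - \<alpha>/4)) * C)"
        unfolding S_def using l T by (intro line_bounded_circle_mean[OF g R1]) auto
    qed auto
    also have "\<dots> = ennreal (A * (2 * (T + l)) + B * (2 * (T + \<sigma>0) * C))"
      using A l T C \<alpha> by (simp add: l_def flip: ennreal_mult ennreal_plus)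
    also have "\<dots> \<le> ennreal (2 * l * (K * T))"
    proof (rule ennreal_leI)
      have "A * (2 * (T + l)) \<le> A * (2 * (1 + l)) * T"
        using A T l mult_left_mono[of 1 T "2 * A * l"] by (simp add: algebra_simps)
      moreover have "B * (2 * (T + \<sigma>0) * C) \<le> B * (2 * (1 + \<sigma>0) * C) * T"
        using A T C \<alpha> mult_left_mono[of 1 T "2 * B * C * \<sigma>0"] by (simp add: algebra_simps)
      moreover have "2 * l * (K * T) = A * (2 * (1 + l)) * T + B * (2 * (1 + \<sigma>0) * C) * T"
        using \<alpha> by (simp add: K_def l_def field_simps)
      ultimately show "A * (2 * (T + l)) + B * (2 * (T + \<sigma>0) * C) \<le> 2 * l * (K * T)" by linarith
    qed
    also have "\<dots> = ennreal (2 * l) * ennreal (K * T)" using l K T by (simp add: ennreal_mult)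
    finally show ?thesis using l by (subst (asm) ennreal_mult_le_mult_iff) (auto simp: \<phi>_def)
  qed
  show thesis by (rule that[OF K main])
qed

section \<open>Truncated logarithmic means\<close>

lemma line_continuous:
  assumes "g holomorphic_on half_plane 0" "0 < \<sigma>"
  shows "continuous_on A (\<lambda>t. g (Complex \<sigma> t))"
proof (rule continuous_on_compose2[OF holomorphic_on_imp_continuous_on[OF assms(1)]])
  show "continuous_on A (Complex \<sigma>)" by (simp add: Complex_eq continuous_intros)
qed (use assms in \<open>auto simp: half_plane_def\<close>)

lemma tlog_lipschitz:
  assumes "0 < \<epsilon>" shows "\<bar>tlog \<epsilon> z - tlog \<epsilon> w\<bar> \<le> norm (z - w) / \<epsilon>"
proof -
  have *: "ln x - ln y \<le> \<bar>x - y\<bar> / \<epsilon>" if "\<epsilon> \<le> x" "\<epsilon> \<le> y" for x y :: real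
  proof -
    have "ln x - ln y \<le> (x - y) / y" using ln_diff_le[of x y] that assms by simp
    also have "\<dots> \<le> \<bar>x - y\<bar> / \<epsilon>" using that assms by (intro frac_le) auto
    finally show ?thesis .
  qed
  have "\<bar>max (norm z) \<epsilon> - max (norm w) \<epsilon>\<bar> \<le> norm (z - w)"
    using norm_triangle_ineq3[of z w] by (auto simp: max_def)
  then have "\<bar>max (norm z) \<epsilon> - max (norm w) \<epsilon>\<bar> / \<epsilon> \<le> norm (z - w) / \<epsilon>"
    using assms by (intro divide_right_mono) auto
  then show ?thesis
    using *[of "max (norm z) \<epsilon>" "max (norm w) \<epsilon>"] *[of "max (norm w) \<epsilon>" "max (norm z) \<epsilon>"]
    unfolding tlog_def abs_le_iff by (auto simp: abs_minus_commute)
qed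

text \<open>
  The two sides differ only where \<open>|z| < \<epsilon>\<close>, and there \<open>|log |z|| > log (1/\<epsilon>)\<close>, so one power of the
  logarithm can be traded for the factor \<open>1 / log (1/\<epsilon>)\<close>.
\<close>

lemma tlog_diff_ln:
  assumes "0 < \<epsilon>" "\<epsilon> < 1" "z \<noteq> 0"
  shows "\<bar>ln (norm z) - tlog \<epsilon> z\<bar> \<le> (ln (norm z))\<^sup>2 / ln (1 / \<epsilon>)"
proof (cases "norm z < \<epsilon>")
  case True
  define u where "u = - ln (norm z)"
  have E: "0 < ln (1 / \<epsilon>)" using assms by simp
  have u: "ln (1 / \<epsilon>) < u" using True assms by (simp add: u_def ln_div)
  have "\<bar>ln (norm z) - tlog \<epsilon> z\<bar> = u - ln (1 / \<epsilon>)"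
    using True assms u by (simp add: tlog_def max_def u_def ln_div)
  also have "\<dots> \<le> u" using E by simp
  also have "u \<le> u\<^sup>2 / ln (1 / \<epsilon>)"
    using E u mult_left_mono[of "ln (1/\<epsilon>)" u u] by (simp add: pos_le_divide_eq power2_eq_square)
  finally show ?thesis by (simp add: u_def)
next
  case False
  then have "tlog \<epsilon> z = ln (norm z)" by (simp add: tlog_def max_def)
  then show ?thesis using assms by simp
qed

lemma set_integral_norm_le_nn:
  fixes F :: "real \<Rightarrow> real"
  assumes F: "F \<in> borel_measurable borel" "\<And>t. 0 \<le> F t" and Q: "0 \<le> Q"
    and b: "(\<integral>\<^sup>+t. ennreal (F t) * indicator A t \<partial>lborel) \<le> ennreal Q" and A: "A \<in> sets borel"
  shows "set_integrable lborel A F" "(LBINT t:A. F t) \<le> Q"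
proof -
  note [measurable] = F(1) A
  have eq: "(\<integral>\<^sup>+t. ennreal (F t) * indicator A t \<partial>lborel) = (\<integral>\<^sup>+t. ennreal (norm (indicator A t *\<^sub>R F t)) \<partial>lborel)"
    using F(2) by (intro nn_integral_cong) (auto simp: indicator_def)
  show "set_integrable lborel A F"
    unfolding set_integrable_def
  proof (rule integrableI_bounded)
    show "(\<lambda>x. indicat_real A x *\<^sub>R F x) \<in> borel_measurable lborel" by measurable
    show "(\<integral>\<^sup>+t. ennreal (norm (indicator A t *\<^sub>R F t)) \<partial>lborel) < \<infinity>"
      using b unfolding eq by (rule le_less_trans) simp
  qed
  have "(LBINT t:A. F t) = enn2real (\<integral>\<^sup>+t. ennreal (indicator A t *\<^sub>R F t) \<partial>lborel)"
    unfolding set_lebesgue_integral_def using F(2) by (intro integral_eq_nn_integral) auto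
  also have "(\<integral>\<^sup>+t. ennreal (indicator A t *\<^sub>R F t) \<partial>lborel) = (\<integral>\<^sup>+t. ennreal (F t) * indicator A t \<partial>lborel)"
    by (intro nn_integral_cong) (auto simp: indicator_def)
  also have "enn2real \<dots> \<le> enn2real (ennreal Q)" using b by (intro enn2real_mono) auto
  finally show "(LBINT t:A. F t) \<le> Q" using Q by simp
qed

definition tlog_mean :: "real \<Rightarrow> (complex \<Rightarrow> complex) \<Rightarrow> real \<Rightarrow> real \<Rightarrow> real" where
  "tlog_mean \<epsilon> g \<sigma> T = 1 / (2 * T) * (LBINT t:{-T..T}. tlog \<epsilon> (g (Complex \<sigma> t)))"

text \<open>
  Mean-square control of \<open>log |g|\<close> on a single line. Almost everywhere nonvanishing is part of it because
  the convention \<open>ln 0 = 0\<close> would hide zeros from the integral.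
\<close>

definition log_controlled :: "(complex \<Rightarrow> complex) \<Rightarrow> real \<Rightarrow> real \<Rightarrow> bool" where
  "log_controlled g K \<sigma> \<longleftrightarrow> 0 \<le> K \<and> (AE t in lborel. g (Complex \<sigma> t) \<noteq> 0) \<and>
     (\<forall>T\<ge>1. (\<integral>\<^sup>+t. ennreal ((ln (norm (g (Complex \<sigma> t))))\<^sup>2) * indicator {-T..T} t \<partial>lborel) \<le> ennreal (K * T))"

lemma tlog_integrable:
  assumes "g holomorphic_on half_plane 0" "0 < \<sigma>" "0 < \<epsilon>"
  shows "set_integrable lborel {a..b} (\<lambda>t. tlog \<epsilon> (g (Complex \<sigma> t)))"
  by (intro borel_integrable_atLeastAtMost' continuous_intros line_continuous assms)

lemma ln_norm_integrable:
  assumes g: "g holomorphic_on half_plane 0" and \<sigma>: "0 < \<sigma>" and c: "log_controlled g K \<sigma>"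
  shows "set_integrable lborel {-T..T} (\<lambda>t. ln (norm (g (Complex \<sigma> t))))"
    "1 \<le> T \<Longrightarrow> set_integrable lborel {-T..T} (\<lambda>t. (ln (norm (g (Complex \<sigma> t))))\<^sup>2)"
    "1 \<le> T \<Longrightarrow> (LBINT t:{-T..T}. (ln (norm (g (Complex \<sigma> t))))\<^sup>2) \<le> K * T"
proof -
  have [measurable]: "(\<lambda>t. g (Complex \<sigma> t)) \<in> borel_measurable borel"
    by (intro borel_measurable_continuous_onI line_continuous g \<sigma>)
  have 2: "set_integrable lborel {-T..T} (\<lambda>t. (ln (norm (g (Complex \<sigma> t))))\<^sup>2)" 
       "(LBINT t:{-T..T}. (ln (norm (g (Complex \<sigma> t))))\<^sup>2) \<le> K * T" if "1 \<le> T" for T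
    using set_integral_norm_le_nn[of "\<lambda>t. (ln (norm (g (Complex \<sigma> t))))\<^sup>2" "K * T" "{-T..T}"] c that
    by (auto simp: log_controlled_def)
  show "1 \<le> T \<Longrightarrow> set_integrable lborel {-T..T} (\<lambda>t. (ln (norm (g (Complex \<sigma> t))))\<^sup>2)"
    "1 \<le> T \<Longrightarrow> (LBINT t:{-T..T}. (ln (norm (g (Complex \<sigma> t))))\<^sup>2) \<le> K * T" using 2 by auto
  define T1 where "T1 = max 1 T"
  have "set_integrable lborel {-T1..T1} (\<lambda>t. 1 + (ln (norm (g (Complex \<sigma> t))))\<^sup>2)"
    using 2(1)[of T1] by (intro set_integral_add(1) borel_integrable_atLeastAtMost'[of _ _ "\<lambda>_. 1"]) (auto simp: T1_def)
  then have "set_integrable lborel {-T1..T1} (\<lambda>t. ln (norm (g (Complex \<sigma> t))))"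
  proof (rule set_integrable_bound)
    have "\<bar>x\<bar> \<le> 1 + x\<^sup>2" for x :: real
      using sum_squares_bound[of 1 "\<bar>x\<bar>"] by (simp add: power2_eq_square)
    then show "AE x in lborel. x \<in> {-T1..T1} \<longrightarrow> norm (ln (norm (g (Complex \<sigma> x)))) \<le> norm (1 + (ln (norm (g (Complex \<sigma> x))))\<^sup>2)"
      by (auto simp: abs_of_nonneg)
  qed (simp add: set_borel_measurable_def)
  then show "set_integrable lborel {-T..T} (\<lambda>t. ln (norm (g (Complex \<sigma> t))))"
    by (rule set_integrable_subset) (auto simp: T1_def)
qed

lemma jessen_tlog_mean:
  assumes g: "g holomorphic_on half_plane 0" and \<sigma>: "0 < \<sigma>" and c: "log_controlled g K \<sigma>"
    and \<epsilon>: "0 < \<epsilon>" "\<epsilon> < 1" and T: "1 \<le> T"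
  shows "\<bar>jessen_mean g \<sigma> T - tlog_mean \<epsilon> g \<sigma> T\<bar> \<le> K / ln (1 / \<epsilon>)"
proof -
  note I = ln_norm_integrable(1)[OF g \<sigma> c, of T] ln_norm_integrable(2,3)[OF g \<sigma> c T] tlog_integrable[OF g \<sigma> \<epsilon>(1), of "-T" T]
  have E: "0 < ln (1 / \<epsilon>)" using \<epsilon> by simp
  have "\<bar>(LBINT t:{-T..T}. ln (norm (g (Complex \<sigma> t)))) - (LBINT t:{-T..T}. tlog \<epsilon> (g (Complex \<sigma> t)))\<bar>
    = norm (LBINT t:{-T..T}. ln (norm (g (Complex \<sigma> t))) - tlog \<epsilon> (g (Complex \<sigma> t)))"
    using I by (simp add: set_integral_diff)
  also have "\<dots> \<le> (LBINT t:{-T..T}. norm (ln (norm (g (Complex \<sigma> t))) - tlog \<epsilon> (g (Complex \<sigma> t))))"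
    using I by (intro set_integral_norm_bound set_integral_diff)
  also have "\<dots> \<le> (LBINT t:{-T..T}. (ln (norm (g (Complex \<sigma> t))))\<^sup>2 / ln (1 / \<epsilon>))"
  proof (rule set_integral_mono_AE)
    have "AE t in lborel. g (Complex \<sigma> t) \<noteq> 0" using c by (simp add: log_controlled_def)
    then show "AE x\<in>{-T..T} in lborel. norm (ln (norm (g (Complex \<sigma> x))) - tlog \<epsilon> (g (Complex \<sigma> x))) \<le> (ln (norm (g (Complex \<sigma> x))))\<^sup>2 / ln (1 / \<epsilon>)"
      by eventually_elim (use tlog_diff_ln[OF \<epsilon>] in auto)
  qed (use I in \<open>auto intro!: set_integrable_abs set_integral_diff\<close>)
  also have "\<dots> = (LBINT t:{-T..T}. (ln (norm (g (Complex \<sigma> t))))\<^sup>2) / ln (1 / \<epsilon>)" by simp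
  also have "\<dots> \<le> K * T / ln (1 / \<epsilon>)" using I E by (intro divide_right_mono) auto
  finally have *: "\<bar>(LBINT t:{-T..T}. ln (norm (g (Complex \<sigma> t)))) - (LBINT t:{-T..T}. tlog \<epsilon> (g (Complex \<sigma> t)))\<bar> \<le> K * T / ln (1 / \<epsilon>)" .
  have "\<bar>jessen_mean g \<sigma> T - tlog_mean \<epsilon> g \<sigma> T\<bar> =
    1 / (2 * T) * \<bar>(LBINT t:{-T..T}. ln (norm (g (Complex \<sigma> t)))) - (LBINT t:{-T..T}. tlog \<epsilon> (g (Complex \<sigma> t)))\<bar>"
    using T by (simp add: jessen_mean_def tlog_mean_def abs_mult right_diff_distrib[symmetric] del: times_divide_eq_left)
  also have "\<dots> \<le> 1 / (2 * T) * (K * T / ln (1 / \<epsilon>))" using * T by (intro mult_left_mono) auto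
  also have "\<dots> = K / ln (1 / \<epsilon>) / 2" using T by simp
  also have "\<dots> \<le> K / ln (1 / \<epsilon>)"
  proof -
    have "0 \<le> K / ln (1 / \<epsilon>)" using E c by (intro divide_nonneg_pos) (auto simp: log_controlled_def)
    moreover have "x / 2 \<le> x" if "0 \<le> x" for x :: real using that by simp
    ultimately show ?thesis by blast
  qed
  finally show ?thesis .
qed

lemma tlog_mean_diff:
  assumes g: "g holomorphic_on half_plane 0" and h: "h holomorphic_on half_plane 0"
    and \<sigma>: "0 < \<sigma>" "0 < \<sigma>'" and \<epsilon>: "0 < \<epsilon>" and T: "0 < T" and \<eta>: "0 \<le> \<eta>"
    and b: "(\<integral>\<^sup>+t. ennreal (norm (g (Complex \<sigma> t) - h (Complex \<sigma>' t))) * indicator {-T..T} t \<partial>lborel) \<le> ennreal (2 * T * \<eta>)"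
  shows "\<bar>tlog_mean \<epsilon> g \<sigma> T - tlog_mean \<epsilon> h \<sigma>' T\<bar> \<le> \<eta> / \<epsilon>"
proof -
  note I = tlog_integrable[OF g \<sigma>(1) \<epsilon>, of "-T" T] tlog_integrable[OF h \<sigma>(2) \<epsilon>, of "-T" T]
  have [measurable]: "(\<lambda>t. g (Complex \<sigma> t)) \<in> borel_measurable borel" "(\<lambda>t. h (Complex \<sigma>' t)) \<in> borel_measurable borel"
    by (intro borel_measurable_continuous_onI line_continuous g h \<sigma>)+
  have J: "set_integrable lborel {-T..T} (\<lambda>t. norm (g (Complex \<sigma> t) - h (Complex \<sigma>' t)))"
    "(LBINT t:{-T..T}. norm (g (Complex \<sigma> t) - h (Complex \<sigma>' t))) \<le> 2 * T * \<eta>"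
    using set_integral_norm_le_nn[OF _ _ _ b] T \<eta> by auto
  have "\<bar>(LBINT t:{-T..T}. tlog \<epsilon> (g (Complex \<sigma> t))) - (LBINT t:{-T..T}. tlog \<epsilon> (h (Complex \<sigma>' t)))\<bar>
    = norm (LBINT t:{-T..T}. tlog \<epsilon> (g (Complex \<sigma> t)) - tlog \<epsilon> (h (Complex \<sigma>' t)))"
    using I by (simp add: set_integral_diff)
  also have "\<dots> \<le> (LBINT t:{-T..T}. norm (tlog \<epsilon> (g (Complex \<sigma> t)) - tlog \<epsilon> (h (Complex \<sigma>' t))))"
    using I by (intro set_integral_norm_bound set_integral_diff)
  also have "\<dots> \<le> (LBINT t:{-T..T}. norm (g (Complex \<sigma> t) - h (Complex \<sigma>' t)) / \<epsilon>)"
    using I J \<epsilon> by (intro set_integral_mono) (auto intro!: set_integrable_abs set_integral_diff tlog_lipschitz)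
  also have "\<dots> \<le> 2 * T * \<eta> / \<epsilon>" using J \<epsilon> by (simp add: divide_right_mono)
  finally have *: "\<bar>(LBINT t:{-T..T}. tlog \<epsilon> (g (Complex \<sigma> t))) - (LBINT t:{-T..T}. tlog \<epsilon> (h (Complex \<sigma>' t)))\<bar> \<le> 2 * T * \<eta> / \<epsilon>" .
  have "\<bar>tlog_mean \<epsilon> g \<sigma> T - tlog_mean \<epsilon> h \<sigma>' T\<bar> =
    1 / (2 * T) * \<bar>(LBINT t:{-T..T}. tlog \<epsilon> (g (Complex \<sigma> t))) - (LBINT t:{-T..T}. tlog \<epsilon> (h (Complex \<sigma>' t)))\<bar>"
    using T by (simp add: tlog_mean_def abs_mult right_diff_distrib[symmetric] del: times_divide_eq_left)
  also have "\<dots> \<le> 1 / (2 * T) * (2 * T * \<eta> / \<epsilon>)" using * T by (intro mult_left_mono) auto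
  finally show ?thesis using T by simp
qed

section \<open>Uniform Cauchy families\<close>

text \<open>
  Uniform Cauchy condition as \<open>T\<close> tends to infinity. It can be passed through approximations before
  any limit function is named.
\<close>

definition ucauchy :: "real set \<Rightarrow> (real \<Rightarrow> real \<Rightarrow> real) \<Rightarrow> bool" where
  "ucauchy A F \<longleftrightarrow> (\<forall>e>0. \<exists>T0. \<forall>T\<ge>T0. \<forall>T'\<ge>T0. \<forall>x\<in>A. \<bar>F T x - F T' x\<bar> \<le> e)"

lemma ucauchy_limit:
  assumes "ucauchy A F"
  shows "\<And>x. x \<in> A \<Longrightarrow> ((\<lambda>T. F T x) \<longlongrightarrow> Lim at_top (\<lambda>T. F T x)) at_top"
    "uniform_limit A F (\<lambda>x. Lim at_top (\<lambda>T. F T x)) at_top"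
proof -
  show lim: "((\<lambda>T. F T x) \<longlongrightarrow> Lim at_top (\<lambda>T. F T x)) at_top" if x: "x \<in> A" for x
  proof -
    have "Cauchy (\<lambda>n. F (real n) x)"
    proof (rule metric_CauchyI)
      fix e :: real assume "0 < e"
      then obtain T0 where T0: "\<And>T T'. T \<ge> T0 \<Longrightarrow> T' \<ge> T0 \<Longrightarrow> \<bar>F T x - F T' x\<bar> \<le> e / 2"
        using assms x unfolding ucauchy_def by (meson half_gt_zero)
      have "dist (F (real m) x) (F (real n) x) < e" if "m \<ge> nat \<lceil>T0\<rceil>" "n \<ge> nat \<lceil>T0\<rceil>" for m n
      proof -
        have "T0 \<le> real m" "T0 \<le> real n" using that by linarith+
        from T0[OF this] show ?thesis using \<open>0 < e\<close> by (simp add: dist_real_def)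
      qed
      then show "\<exists>M. \<forall>m\<ge>M. \<forall>n\<ge>M. dist (F (real m) x) (F (real n) x) < e" by blast
    qed
    then obtain l where l: "(\<lambda>n. F (real n) x) \<longlonglongrightarrow> l" using Cauchy_convergent convergent_def by blast
    have "((\<lambda>T. F T x) \<longlongrightarrow> l) at_top"
    proof (rule tendstoI)
      fix e :: real assume "0 < e"
      then obtain T0 where T0: "\<And>T T'. T \<ge> T0 \<Longrightarrow> T' \<ge> T0 \<Longrightarrow> \<bar>F T x - F T' x\<bar> \<le> e / 2"
        using assms x unfolding ucauchy_def by (meson half_gt_zero)
      have "dist (F T x) l < e" if T: "T \<ge> T0" for T
      proof -
        have "\<bar>F T x - l\<bar> \<le> e / 2"
        proof (rule tendsto_upperbound)
          show "(\<lambda>n. \<bar>F T x - F (real n) x\<bar>) \<longlonglongrightarrow> \<bar>F T x - l\<bar>" using l by (intro tendsto_intros)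
          show "\<forall>\<^sub>F n in sequentially. \<bar>F T x - F (real n) x\<bar> \<le> e / 2"
            using eventually_ge_at_top[of "nat \<lceil>T0\<rceil>"]
          proof eventually_elim
            case (elim n)
            then have "T0 \<le> real n" by linarith
            then show ?case by (rule T0[OF T])
          qed
        qed simp
        then show ?thesis using \<open>0 < e\<close> by (simp add: dist_real_def)
      qed
      then show "\<forall>\<^sub>F T in at_top. dist (F T x) l < e" using eventually_at_top_linorder by blast
    qed
    then show ?thesis using tendsto_Lim[OF trivial_limit_at_top_linorder] by metis
  qed
  show "uniform_limit A F (\<lambda>x. Lim at_top (\<lambda>T. F T x)) at_top"
  proof (rule uniform_limitI)
    fix e :: real assume "0 < e"
    then obtain T0 where T0: "\<And>T T' x. T \<ge> T0 \<Longrightarrow> T' \<ge> T0 \<Longrightarrow> x \<in> A \<Longrightarrow> \<bar>F T x - F T' x\<bar> \<le> e / 2"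
      using assms unfolding ucauchy_def by (meson half_gt_zero)
    have "\<forall>x\<in>A. dist (F T x) (Lim at_top (\<lambda>T. F T x)) < e" if T: "T \<ge> T0" for T
    proof
      fix x assume x: "x \<in> A"
      have "\<bar>F T x - Lim at_top (\<lambda>T. F T x)\<bar> \<le> e / 2"
      proof (rule tendsto_upperbound)
        show "((\<lambda>T'. \<bar>F T x - F T' x\<bar>) \<longlongrightarrow> \<bar>F T x - Lim at_top (\<lambda>T. F T x)\<bar>) at_top"
          using lim[OF x] by (intro tendsto_intros)
        show "\<forall>\<^sub>F T' in at_top. \<bar>F T x - F T' x\<bar> \<le> e / 2"
          using eventually_ge_at_top[of T0] by eventually_elim (rule T0[OF T _ x])
      qed simp
      then show "dist (F T x) (Lim at_top (\<lambda>T. F T x)) < e" using \<open>0 < e\<close> by (simp add: dist_real_def)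
    qed
    then show "\<forall>\<^sub>F T in at_top. \<forall>x\<in>A. dist (F T x) (Lim at_top (\<lambda>T. F T x)) < e"
      using eventually_at_top_linorder by blast
  qed
qed

lemma ucauchy_approx:
  assumes "\<And>e. 0 < e \<Longrightarrow> \<exists>G T0. ucauchy A G \<and> (\<forall>T\<ge>T0. \<forall>x\<in>A. \<bar>F T x - G T x\<bar> \<le> e)"
  shows "ucauchy A F"
  unfolding ucauchy_def
proof (intro allI impI)
  fix e :: real assume e: "0 < e"
  obtain G T0 where G: "ucauchy A G" and FG: "\<And>T x. T \<ge> T0 \<Longrightarrow> x \<in> A \<Longrightarrow> \<bar>F T x - G T x\<bar> \<le> e / 3"
    using assms[of "e/3"] e by auto
  obtain T1 where T1: "\<And>T T' x. T \<ge> T1 \<Longrightarrow> T' \<ge> T1 \<Longrightarrow> x \<in> A \<Longrightarrow> \<bar>G T x - G T' x\<bar> \<le> e / 3"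
    using G e unfolding ucauchy_def by (meson divide_pos_pos zero_less_numeral)
  have "\<bar>F T x - F T' x\<bar> \<le> e" if "T \<ge> max T0 T1" "T' \<ge> max T0 T1" "x \<in> A" for T T' x
  proof -
    have "\<bar>F T x - G T x\<bar> \<le> e / 3" "\<bar>F T' x - G T' x\<bar> \<le> e / 3" "\<bar>G T x - G T' x\<bar> \<le> e / 3"
      using that FG[of T x] FG[of T' x] T1[of T T' x] by auto
    then show ?thesis by linarith
  qed
  then show "\<exists>T0. \<forall>T\<ge>T0. \<forall>T'\<ge>T0. \<forall>x\<in>A. \<bar>F T x - F T' x\<bar> \<le> e" by blast
qed

lemma uniform_limit_ucauchy:
  assumes "uniform_limit A F l at_top" shows "ucauchy A F"
  unfolding ucauchy_def
proof (intro allI impI)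
  fix e :: real assume e: "0 < e"
  then have "\<forall>\<^sub>F T in at_top. \<forall>x\<in>A. dist (F T x) (l x) < e / 2"
    using assms by (intro uniform_limitD) auto
  then obtain T0 where T0: "\<And>T x. T \<ge> T0 \<Longrightarrow> x \<in> A \<Longrightarrow> \<bar>F T x - l x\<bar> < e / 2"
    by (auto simp: eventually_at_top_linorder dist_real_def)
  have "\<bar>F T x - F T' x\<bar> \<le> e" if "T \<ge> T0" "T' \<ge> T0" "x \<in> A" for T T' x
    using T0[of T x] T0[of T' x] that by linarith
  then show "\<exists>T0. \<forall>T\<ge>T0. \<forall>T'\<ge>T0. \<forall>x\<in>A. \<bar>F T x - F T' x\<bar> \<le> e" by blast
qed

section \<open>Means of trigonometric polynomials\<close>

text \<open>
  Trigonometric polynomials in \<open>t\<close> whose coefficients depend on \<open>\<sigma>\<close>. The frequencies do not depend on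
  \<open>\<sigma>\<close> and the coefficients are bounded over all \<open>\<sigma> > 0\<close>, so that convergence of means is uniform in \<open>\<sigma>\<close>.
\<close>

inductive trig_poly :: "(real \<Rightarrow> real \<Rightarrow> complex) \<Rightarrow> bool" where
  mono: "(\<And>\<sigma>. 0 < \<sigma> \<Longrightarrow> norm (c \<sigma>) \<le> B) \<Longrightarrow> trig_poly (\<lambda>\<sigma> t. c \<sigma> * cis (l * t))"
| add: "trig_poly F \<Longrightarrow> trig_poly G \<Longrightarrow> trig_poly (\<lambda>\<sigma> t. F \<sigma> t + G \<sigma> t)"

lemma trig_poly_const: "trig_poly (\<lambda>\<sigma> t. c)"
  using trig_poly.mono[of "\<lambda>_. c" "norm c" 0] by simp

lemma trig_poly_mult_mono:
  assumes "trig_poly F" "\<And>\<sigma>. 0 < \<sigma> \<Longrightarrow> norm (c \<sigma>) \<le> B"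
  shows "trig_poly (\<lambda>\<sigma> t. c \<sigma> * cis (l * t) * F \<sigma> t)"
  using assms(1)
proof induction
  case (mono d D m)
  have "trig_poly (\<lambda>\<sigma> t. (c \<sigma> * d \<sigma>) * cis ((l + m) * t))"
  proof (rule trig_poly.mono)
    fix \<sigma> :: real assume "0 < \<sigma>"
    then have "norm (c \<sigma>) * norm (d \<sigma>) \<le> B * D"
      by (intro mult_mono assms mono) (auto intro: order_trans[OF norm_ge_zero assms(2)])
    then show "norm (c \<sigma> * d \<sigma>) \<le> B * D" by (simp add: norm_mult)
  qed
  also have "(\<lambda>\<sigma> t. (c \<sigma> * d \<sigma>) * cis ((l + m) * t)) = (\<lambda>\<sigma> t. c \<sigma> * cis (l * t) * (d \<sigma> * cis (m * t)))"
  proof (intro ext)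
    fix \<sigma> t :: real
    have "cis ((l + m) * t) = cis (l * t) * cis (m * t)" by (simp add: cis_mult distrib_right)
    then show "(c \<sigma> * d \<sigma>) * cis ((l + m) * t) = c \<sigma> * cis (l * t) * (d \<sigma> * cis (m * t))" by simp
  qed
  finally show ?case .
next
  case (add F G)
  from trig_poly.add[OF add.IH] show ?case by (simp add: distrib_left)
qed

lemma trig_poly_mult:
  assumes "trig_poly F" "trig_poly G" shows "trig_poly (\<lambda>\<sigma> t. F \<sigma> t * G \<sigma> t)"
  using assms(1)
proof induction
  case (mono c B l)
  then show ?case by (intro trig_poly_mult_mono[OF assms(2)]) auto
next
  case (add F1 F2)
  from trig_poly.add[OF add.IH] show ?case by (simp add: distrib_right)
qed

lemma trig_poly_cnj:
  assumes "trig_poly F" shows "trig_poly (\<lambda>\<sigma> t. cnj (F \<sigma> t))"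
  using assms
proof induction
  case (mono c B l)
  have "trig_poly (\<lambda>\<sigma> t. cnj (c \<sigma>) * cis ((- l) * t))" using mono by (intro trig_poly.mono) auto
  then show ?case by (simp add: cis_cnj)
next
  case (add F1 F2)
  from trig_poly.add[OF add.IH] show ?case by simp
qed

lemma trig_poly_sum:
  assumes "finite I" "\<And>i. i \<in> I \<Longrightarrow> trig_poly (F i)" shows "trig_poly (\<lambda>\<sigma> t. \<Sum>i\<in>I. F i \<sigma> t)"
  using assms by (induction I rule: finite_induct) (auto intro: trig_poly_const trig_poly.add)

lemma cis_mean_le:
  assumes l: "l \<noteq> 0" and T: "0 < T"
  shows "norm (LBINT t:{-T..T}. cis (l * t)) \<le> 2 / \<bar>l\<bar>"
proof -
  have "((\<lambda>t. cis (l * t)) has_integral (cis (l * T) / (\<i> * l) - cis (l * (-T)) / (\<i> * l))) {-T..T}"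
  proof (rule fundamental_theorem_of_calculus)
    show "((\<lambda>t. cis (l * t) / (\<i> * of_real l)) has_vector_derivative cis (l * x)) (at x within {-T..T})" for x
    proof -
      have "((\<lambda>t. exp (\<i> * of_real l * t) / (\<i> * of_real l)) has_field_derivative exp (\<i> * of_real l * of_real x)) (at (of_real x))"
        using l by (auto intro!: derivative_eq_intros)
      from has_vector_derivative_real_field[OF this] show ?thesis by (simp add: cis_conv_exp mult.assoc has_vector_derivative_at_within)
    qed
  qed (use T in auto)
  moreover have "set_integrable lborel {-T..T} (\<lambda>t. cis (l * t))"
    by (intro borel_integrable_atLeastAtMost' continuous_intros)
  ultimately have "(LBINT t:{-T..T}. cis (l * t)) = cis (l * T) / (\<i> * l) - cis (l * (-T)) / (\<i> * l)"
    by (metis set_borel_integral_eq_integral(2) integral_unique)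
  also have "norm \<dots> \<le> norm (cis (l * T) / (\<i> * l)) + norm (cis (l * (-T)) / (\<i> * l))" by (rule norm_triangle_ineq4)
  also have "\<dots> = 2 / \<bar>l\<bar>" by (simp add: norm_divide norm_mult)
  finally show ?thesis .
qed

text \<open>
  Only the frequency 0 survives in the mean; every other frequency contributes \<open>O(1/T)\<close>.
\<close>

lemma trig_poly_mean:
  assumes "trig_poly F"
  shows "(\<forall>\<sigma>>0. continuous_on UNIV (F \<sigma>)) \<and>
    (\<exists>L. uniform_limit {0<..} (\<lambda>T \<sigma>. (LBINT t:{-T..T}. F \<sigma> t) / of_real (2 * T)) L at_top)"
  using assms
proof induction
  case (mono c B l)
  have "uniform_limit {0<..} (\<lambda>T \<sigma>. (LBINT t:{-T..T}. c \<sigma> * cis (l * t)) / of_real (2 * T)) (if l = 0 then c else (\<lambda>_. 0)) at_top"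
  proof (cases "l = 0")
    case True
    show ?thesis
    proof (rule uniform_limitI)
      fix e :: real assume e: "0 < e"
      show "\<forall>\<^sub>F T in at_top. \<forall>\<sigma>\<in>{0<..}. dist ((LBINT t:{-T..T}. c \<sigma> * cis (l * t)) / of_real (2 * T)) ((if l = 0 then c else (\<lambda>_. 0)) \<sigma>) < e"
        using eventually_gt_at_top[of 0]
        by eventually_elim (use True e in \<open>auto simp: set_lebesgue_integral_def scaleR_conv_of_real\<close>)
    qed
  next
    case False
    have B: "0 \<le> B" using mono[of 1] by (auto intro: order_trans[OF norm_ge_zero])
    have bd: "norm ((LBINT t:{-T..T}. c \<sigma> * cis (l * t)) / of_real (2 * T)) \<le> B / \<bar>l\<bar> / T" if "0 < T" "0 < \<sigma>" for T \<sigma>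
    proof -
      have "norm (LBINT t:{-T..T}. c \<sigma> * cis (l * t)) = norm (c \<sigma>) * norm (LBINT t:{-T..T}. cis (l * t))"
        by (simp add: norm_mult)
      also have "\<dots> \<le> B * (2 / \<bar>l\<bar>)"
        using that mono False B by (intro mult_mono cis_mean_le) auto
      finally have "norm (LBINT t:{-T..T}. c \<sigma> * cis (l * t)) / (2 * T) \<le> B * (2 / \<bar>l\<bar>) / (2 * T)"
        using that by (intro divide_right_mono) auto
      also have "\<dots> = B / \<bar>l\<bar> / T" by simp
      finally show ?thesis using that by (simp only: norm_divide norm_of_real abs_of_pos mult_pos_pos zero_less_numeral)
    qed
    have "((\<lambda>T. B / \<bar>l\<bar> / T) \<longlongrightarrow> 0) at_top" 
      by (intro tendsto_divide_0[OF tendsto_const] filterlim_at_top_imp_at_infinity filterlim_ident)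
    then have "uniform_limit {0<..} (\<lambda>T \<sigma>. (LBINT t:{-T..T}. c \<sigma> * cis (l * t)) / of_real (2 * T)) (\<lambda>_. 0) at_top"
    proof (intro uniform_limitI)
      fix e :: real assume e: "0 < e" and lim: "((\<lambda>T. B / \<bar>l\<bar> / T) \<longlongrightarrow> 0) at_top"
      from lim e have "\<forall>\<^sub>F T in at_top. B / \<bar>l\<bar> / T < e" by (rule order_tendstoD(2))
      then show "\<forall>\<^sub>F T in at_top. \<forall>\<sigma>\<in>{0<..}. dist ((LBINT t:{-T..T}. c \<sigma> * cis (l * t)) / of_real (2 * T)) 0 < e"
        using eventually_gt_at_top[of 0]
      proof eventually_elim
        case (elim T)
        then show ?case using bd by (auto intro: le_less_trans)
      qed
    qed
    then show ?thesis using False by simp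
  qed
  then show ?case by (auto intro!: continuous_intros)
next
  case (add F G)
  then obtain L M where LM:
    "uniform_limit {0<..} (\<lambda>T \<sigma>. (LBINT t:{-T..T}. F \<sigma> t) / of_real (2 * T)) L at_top"
    "uniform_limit {0<..} (\<lambda>T \<sigma>. (LBINT t:{-T..T}. G \<sigma> t) / of_real (2 * T)) M at_top" by auto
  have "uniform_limit {0<..} (\<lambda>T \<sigma>. (LBINT t:{-T..T}. F \<sigma> t + G \<sigma> t) / of_real (2 * T)) (\<lambda>\<sigma>. L \<sigma> + M \<sigma>) at_top"
  proof (rule uniform_limit_cong[THEN iffD1, OF _ _ uniform_limit_add[OF LM]])
    have "(LBINT t:{-T..T}. F \<sigma> t + G \<sigma> t) = (LBINT t:{-T..T}. F \<sigma> t) + (LBINT t:{-T..T}. G \<sigma> t)" if "0 < \<sigma>" for \<sigma> T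
      using add.IH that
      by (intro set_integral_add borel_integrable_atLeastAtMost') (meson continuous_on_subset subset_UNIV)+
    then show "\<forall>\<^sub>F T in at_top. \<forall>\<sigma>\<in>{0<..}. (LBINT t:{-T..T}. F \<sigma> t) / of_real (2 * T) + (LBINT t:{-T..T}. G \<sigma> t) / of_real (2 * T)
      = (LBINT t:{-T..T}. F \<sigma> t + G \<sigma> t) / of_real (2 * T)"
      by (simp add: add_divide_distrib)
  qed simp
  moreover have "\<forall>\<sigma>>0. continuous_on UNIV (\<lambda>t. F \<sigma> t + G \<sigma> t)" using add by (auto intro!: continuous_intros)
  ultimately show ?case by blast
qed

section \<open>The leading term of a Dirichlet series\<close>

lemma norm_of_nat_powr: "norm (of_nat n powr (- s) :: complex) = real n powr (- Re s)"
  using norm_powr_real_powr[of "of_nat n" "-s"] by simp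

text \<open>
  The coefficients \<open>c\<close> are only dominated by \<open>a\<close>, with the bound expressed through \<open>a\<close>, so that one
  estimate serves a Dirichlet series and all its Riesz means.
\<close>

lemma dirichlet_tail:
  fixes a c :: "nat \<Rightarrow> complex"
  assumes S: "summable (\<lambda>n. norm (a (Suc n)) * real (Suc n) powr (- \<sigma>1))"
    and le: "\<And>n. norm (c n) \<le> norm (a n)" and zero: "\<And>n. 1 \<le> n \<Longrightarrow> n < m \<Longrightarrow> c n = 0"
    and m: "1 \<le> m" and \<sigma>: "\<sigma>1 \<le> Re s" and F: "dirichlet_term c s sums F"
  shows "norm (F - c m * of_nat m powr (- s)) \<le>
    real (m + 1) powr (\<sigma>1 - Re s) * (\<Sum>n. norm (a (Suc n)) * real (Suc n) powr (- \<sigma>1))"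
proof -
  define G where "G n = (if n = m - 1 then 0 else dirichlet_term c s n)" for n
  have "(\<lambda>n. dirichlet_term c s n - (if n = m - 1 then dirichlet_term c s n else 0)) sums (F - dirichlet_term c s (m - 1))"
    by (intro sums_diff F sums_single)
  also have "(\<lambda>n. dirichlet_term c s n - (if n = m - 1 then dirichlet_term c s n else 0)) = G"
    by (auto simp: G_def)
  also have "dirichlet_term c s (m - 1) = c m * of_nat m powr (- s)" using m by (simp add: dirichlet_term_def)
  finally have G: "G sums (F - c m * of_nat m powr (- s))" .
  have bd: "norm (G n) \<le> real (m + 1) powr (\<sigma>1 - Re s) * (norm (a (Suc n)) * real (Suc n) powr (- \<sigma>1))" for n
  proof (cases "Suc n \<le> m")
    case True
    then have "G n = 0" using zero[of "Suc n"] by (auto simp: G_def dirichlet_term_def)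
    then show ?thesis by simp
  next
    case False
    have "norm (G n) \<le> norm (c (Suc n)) * real (Suc n) powr (- Re s)"
      by (simp add: G_def dirichlet_term_def norm_mult norm_of_nat_powr del: of_nat_Suc)
    also have "\<dots> \<le> norm (a (Suc n)) * (real (Suc n) powr (- \<sigma>1) * real (Suc n) powr (\<sigma>1 - Re s))"
      using le[of "Suc n"] by (intro mult_mono) (auto simp: powr_add[symmetric] simp del: of_nat_Suc)
    also have "\<dots> \<le> norm (a (Suc n)) * (real (Suc n) powr (- \<sigma>1) * real (m + 1) powr (\<sigma>1 - Re s))"
      using False \<sigma> by (intro mult_left_mono powr_mono2') auto
    finally show ?thesis by (simp only: mult_ac)
  qed
  have "norm (suminf G) \<le> (\<Sum>n. real (m + 1) powr (\<sigma>1 - Re s) * (norm (a (Suc n)) * real (Suc n) powr (- \<sigma>1)))"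
    by (intro norm_suminf_le bd summable_mult S)
  also have "\<dots> = real (m + 1) powr (\<sigma>1 - Re s) * (\<Sum>n. norm (a (Suc n)) * real (Suc n) powr (- \<sigma>1))"
    by (rule suminf_mult[OF S])
  finally show ?thesis using sums_unique[OF G] by simp
qed

text \<open>
  The tail beyond the leading index \<open>m\<close> decays like \<open>(m + 1)^(-\<sigma>)\<close>, faster than the leading term.
  Allowing the leading coefficient to lose half its modulus covers Riesz means of large order, whose
  weight at \<open>m\<close> tends to 1.
\<close>

lemma leading_term_lower_bound:
  fixes a :: "nat \<Rightarrow> complex"
  assumes S: "summable (\<lambda>n. norm (a (Suc n)) * real (Suc n) powr (- \<sigma>1))"
    and m: "1 \<le> m" "a m \<noteq> 0" 
  obtains \<sigma>2 where "\<sigma>1 \<le> \<sigma>2"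
    "\<And>c s F. (\<And>n. norm (c n) \<le> norm (a n)) \<Longrightarrow> (\<And>n. 1 \<le> n \<Longrightarrow> n < m \<Longrightarrow> c n = 0) \<Longrightarrow>
      norm (a m) / 2 \<le> norm (c m) \<Longrightarrow> \<sigma>2 \<le> Re s \<Longrightarrow> dirichlet_term c s sums F \<Longrightarrow>
      norm (a m) / 4 * real m powr (- Re s) \<le> norm F"
proof -
  define S1 where "S1 = (\<Sum>n. norm (a (Suc n)) * real (Suc n) powr (- \<sigma>1))"
  have S1: "0 \<le> S1" unfolding S1_def by (intro suminf_nonneg S) auto
  define d where "d = ln (real (m + 1) / real m)"
  have d: "0 < d" using m by (simp add: d_def)
  define W where "W = S1 * real (m + 1) powr \<sigma>1"
  have W: "0 \<le> W" using S1 by (simp add: W_def)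
  define w where "w = norm (a m) / 4"
  have w: "0 < w" using m by (simp add: w_def)
  define \<sigma>2 where "\<sigma>2 = max \<sigma>1 (ln (W / w + 1) / d)"
  have key: "W * real (m + 1) powr (- \<sigma>) \<le> w * real m powr (- \<sigma>)" if "\<sigma>2 \<le> \<sigma>" for \<sigma>
  proof -
    have "ln (W / w + 1) / d \<le> \<sigma>" using that by (simp add: \<sigma>2_def)
    then have "ln (W / w + 1) \<le> \<sigma> * d" using d by (simp add: pos_divide_le_eq)
    then have "exp (ln (W / w + 1)) \<le> exp (\<sigma> * d)" by simp
    moreover have "0 < W / w + 1" using W w by (simp add: add_nonneg_pos)
    ultimately have "W / w + 1 \<le> exp (\<sigma> * d)" by simp
    then have "W / w \<le> exp (\<sigma> * d)" by simp
    then have "W \<le> w * exp (\<sigma> * d)" using w by (simp add: pos_divide_le_eq mult.commute)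
    then have "W * real (m + 1) powr (- \<sigma>) \<le> w * exp (\<sigma> * d) * real (m + 1) powr (- \<sigma>)" by (intro mult_right_mono) auto
    also have "exp (\<sigma> * d) = real (m + 1) powr \<sigma> * real m powr (- \<sigma>)"
      using m by (simp add: d_def ln_div powr_def exp_add[symmetric] algebra_simps)
    finally show ?thesis using m by (simp add: mult.assoc powr_minus field_simps)
  qed
  show thesis
  proof (rule that[of \<sigma>2])
    show "\<sigma>1 \<le> \<sigma>2" by (simp add: \<sigma>2_def)
    fix c :: "nat \<Rightarrow> complex" and s F
    assume le: "\<And>n. norm (c n) \<le> norm (a n)" and zero: "\<And>n. 1 \<le> n \<Longrightarrow> n < m \<Longrightarrow> c n = 0"
      and cm: "norm (a m) / 2 \<le> norm (c m)" and s: "\<sigma>2 \<le> Re s" and F: "dirichlet_term c s sums F"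
    have "norm (F - c m * of_nat m powr (- s)) \<le> real (m + 1) powr (\<sigma>1 - Re s) * S1"
      unfolding S1_def using s by (intro dirichlet_tail[OF S le zero m(1) _ F]) (auto simp: \<sigma>2_def)
    also have "\<dots> = W * real (m + 1) powr (- Re s)" by (simp add: W_def powr_diff powr_minus divide_inverse mult_ac)
    also have "\<dots> \<le> w * real m powr (- Re s)" by (rule key[OF s])
    finally have 1: "norm (F - c m * of_nat m powr (- s)) \<le> w * real m powr (- Re s)" .
    have "2 * w \<le> norm (c m)" using cm by (simp add: w_def)
    then have "2 * w * real m powr (- Re s) \<le> norm (c m * of_nat m powr (- s))"
      unfolding norm_mult norm_of_nat_powr by (intro mult_right_mono) auto
    also have "\<dots> \<le> norm F + norm (F - c m * of_nat m powr (- s))"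
      by (metis norm_minus_commute norm_triangle_sub)
    finally show "norm (a m) / 4 * real m powr (- Re s) \<le> norm F" using 1 unfolding w_def by linarith
  qed
qed

section \<open>Dirichlet polynomials\<close>

definition dpoly :: "(nat \<Rightarrow> complex) \<Rightarrow> nat \<Rightarrow> complex \<Rightarrow> complex" where
  "dpoly c N s = (\<Sum>n=1..N. c n * of_nat n powr (- s))"

lemma dpoly_sums:
  "dirichlet_term (\<lambda>n. if n \<le> N then c n else 0) s sums dpoly c N s"
proof -
  have "dirichlet_term (\<lambda>n. if n \<le> N then c n else 0) s sums (\<Sum>n<N. dirichlet_term (\<lambda>n. if n \<le> N then c n else 0) s n)"
    by (rule sums_finite) (auto simp: dirichlet_term_def)
  also have "(\<Sum>n<N. dirichlet_term (\<lambda>n. if n \<le> N then c n else 0) s n) = dpoly c N s"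
    unfolding dpoly_def dirichlet_term_def
    by (rule sum.reindex_bij_witness[of _ "\<lambda>n. n - 1" Suc]) auto
  finally show ?thesis .
qed

lemma dpoly_holomorphic: "dpoly c N holomorphic_on A"
  unfolding dpoly_def by (intro holomorphic_intros) auto

lemma powr_Complex:
  assumes "1 \<le> n"
  shows "of_nat n powr (- Complex \<sigma> t) = of_real (real n powr (- \<sigma>)) * cis (- ln (real n) * t)"
proof -
  have "Ln (of_nat n) = of_real (ln (real n))" using assms Ln_of_real[of "real n"] by simp
  then have "of_nat n powr (- Complex \<sigma> t) = exp (- Complex \<sigma> t * of_real (ln (real n)))" using assms by (simp add: powr_def)
  also have "- Complex \<sigma> t * of_real (ln (real n)) = of_real (- \<sigma> * ln (real n)) + \<i> * of_real (- ln (real n) * t)"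
    by (simp add: complex_eq_iff)
  also have "exp \<dots> = of_real (real n powr (- \<sigma>)) * cis (- ln (real n) * t)"
    unfolding exp_add cis_conv_exp exp_of_real using assms by (simp add: powr_def)
  finally show ?thesis .
qed

lemma dpoly_bound:
  assumes "0 \<le> Re s" shows "norm (dpoly c N s) \<le> (\<Sum>n=1..N. norm (c n))"
  unfolding dpoly_def
proof (rule order_trans[OF norm_sum], rule sum_mono)
  fix n assume "n \<in> {1..N}"
  then have "real n powr (- Re s) \<le> 1" using assms powr_mono[of "- Re s" 0 "real n"] by auto
  then show "norm (c n * of_nat n powr (- s)) \<le> norm (c n)"
    by (simp add: norm_mult norm_of_nat_powr mult_left_le)
qed

lemma dpoly_line_bounded: "line_bounded (dpoly c N) (\<Sum>n=1..N. norm (c n))"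
  unfolding line_bounded_def
proof (intro conjI allI impI)
  show "dpoly c N \<in> borel_measurable borel"
    by (intro borel_measurable_continuous_onI holomorphic_on_imp_continuous_on dpoly_holomorphic)
  fix \<sigma> T :: real assume *: "0 < \<sigma>" "1 \<le> T"
  have "(\<integral>\<^sup>+t. ennreal (norm (dpoly c N (Complex \<sigma> t))) * indicator {-T..T} t \<partial>lborel)
    \<le> (\<integral>\<^sup>+(t::real). ennreal (\<Sum>n=1..N. norm (c n)) * indicator {-T..T} t \<partial>lborel)"
    using * by (intro nn_integral_mono mult_right_mono ennreal_leI dpoly_bound) auto
  also have "\<dots> = ennreal (\<Sum>n=1..N. norm (c n)) * ennreal (2 * T)"
    using * by (subst nn_integral_cmult_indicator) auto
  also have "\<dots> = ennreal (2 * T * (\<Sum>n=1..N. norm (c n)))"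
    using * by (subst ennreal_mult[symmetric]) (auto simp: mult_ac sum_nonneg)
  finally show "(\<integral>\<^sup>+t. ennreal (norm (dpoly c N (Complex \<sigma> t))) * indicator {-T..T} t \<partial>lborel)
    \<le> ennreal (2 * T * (\<Sum>n=1..N. norm (c n)))" .
qed (auto intro: sum_nonneg dpoly_holomorphic)

lemma dpoly_trig_poly: "trig_poly (\<lambda>\<sigma> t. dpoly c N (Complex \<sigma> t))"
  unfolding dpoly_def
proof (rule trig_poly_sum)
  fix n assume n: "n \<in> {1..N}"
  have "trig_poly (\<lambda>\<sigma> t. (c n * of_real (real n powr (- \<sigma>))) * cis (- ln (real n) * t))"
  proof (rule trig_poly.mono)
    fix \<sigma> :: real assume "0 < \<sigma>"
    then have "real n powr (- \<sigma>) \<le> 1" using n powr_mono[of "- \<sigma>" 0 "real n"] by auto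
    then show "norm (c n * of_real (real n powr (- \<sigma>))) \<le> norm (c n)" by (simp add: norm_mult mult_left_le)
  qed
  then show "trig_poly (\<lambda>\<sigma> t. c n * of_nat n powr (- Complex \<sigma> t))"
    using n by (simp add: powr_Complex mult.assoc)
qed simp

lemma dpoly_eventually_large:
  assumes nz: "\<exists>n\<in>{1..N}. c n \<noteq> 0"
  obtains \<sigma>2 where "\<And>\<sigma>. \<sigma>2 \<le> \<sigma> \<Longrightarrow> \<exists>\<delta>. 0 < \<delta> \<and> \<delta> \<le> 1 \<and> (\<forall>t. \<delta> \<le> norm (dpoly c N (Complex \<sigma> t)))"
proof -
  define a where "a n = (if n \<le> N then c n else 0)" for n
  define m where "m = (LEAST n. 1 \<le> n \<and> a n \<noteq> 0)"
  have ex: "\<exists>n. 1 \<le> n \<and> a n \<noteq> 0" using nz by (auto simp: a_def)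
  have m: "1 \<le> m" "a m \<noteq> 0" using LeastI_ex[OF ex] by (auto simp: m_def)
  have zero: "a n = 0" if "1 \<le> n" "n < m" for n using not_less_Least[of n] that unfolding m_def by blast
  have S: "summable (\<lambda>n. norm (a (Suc n)) * real (Suc n) powr (- 0))"
    by (rule summable_finite[of "{..N}"]) (auto simp: a_def)
  obtain \<sigma>2 where \<sigma>2: 
    "\<And>c s F. (\<And>n. norm (c n) \<le> norm (a n)) \<Longrightarrow> (\<And>n. 1 \<le> n \<Longrightarrow> n < m \<Longrightarrow> c n = 0) \<Longrightarrow>
      norm (a m) / 2 \<le> norm (c m) \<Longrightarrow> \<sigma>2 \<le> Re s \<Longrightarrow> dirichlet_term c s sums F \<Longrightarrow>
      norm (a m) / 4 * real m powr (- Re s) \<le> norm F"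
    using leading_term_lower_bound[OF S m] by metis
  show thesis
  proof (rule that[of \<sigma>2])
    fix \<sigma> assume \<sigma>: "\<sigma>2 \<le> \<sigma>"
    have "norm (a m) / 4 * real m powr (- \<sigma>) \<le> norm (dpoly c N (Complex \<sigma> t))" for t
      using \<sigma>2[of a "Complex \<sigma> t" "dpoly c N (Complex \<sigma> t)"] zero \<sigma> dpoly_sums[of N c "Complex \<sigma> t"]
      by (simp add: a_def[abs_def])
    moreover have "0 < norm (a m) / 4 * real m powr (- \<sigma>)" using m by simp
    ultimately show "\<exists>\<delta>. 0 < \<delta> \<and> \<delta> \<le> 1 \<and> (\<forall>t. \<delta> \<le> norm (dpoly c N (Complex \<sigma> t)))"
      by (intro exI[of _ "min 1 (norm (a m) / 4 * real m powr (- \<sigma>))"]) (auto intro: min.coboundedI2)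
  qed
qed

text \<open>
  All functions that share a mean bound \<open>C\<close> and a lower bound \<open>\<delta>\<close> on the line \<open>\<sigma>0\<close> share one constant \<open>K\<close>.
\<close>

lemma log_controlled_family:
  assumes \<alpha>: "0 < \<alpha>" "\<alpha> \<le> \<sigma>0" and \<delta>: "0 < \<delta>" "\<delta> \<le> 1" and C: "0 \<le> C"
  obtains K where "0 \<le> K"
    "\<And>g \<sigma>. line_bounded g C \<Longrightarrow> (\<And>t. \<delta> \<le> norm (g (Complex \<sigma>0 t))) \<Longrightarrow> \<alpha> \<le> \<sigma> \<Longrightarrow> \<sigma> \<le> \<sigma>0 \<Longrightarrow> log_controlled g K \<sigma>"
proof -
  obtain K where K: "0 \<le> K"
    "\<And>g \<sigma> T. line_bounded g C \<Longrightarrow> (\<And>t. \<delta> \<le> norm (g (Complex \<sigma>0 t))) \<Longrightarrow> \<alpha> \<le> \<sigma> \<Longrightarrow> \<sigma> \<le> \<sigma>0 \<Longrightarrow> 1 \<le> T \<Longrightarrow>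
      (\<integral>\<^sup>+t. ennreal ((ln (norm (g (Complex \<sigma> t))))\<^sup>2) * indicator {-T..T} t \<partial>lborel) \<le> ennreal (K * T)"
    using log_square_mean[OF assms] by blast
  show thesis
  proof (rule that[OF K(1)])
    fix g \<sigma> assume g: "line_bounded g C" and low: "\<And>t. \<delta> \<le> norm (g (Complex \<sigma>0 t))" and \<sigma>: "\<alpha> \<le> \<sigma>" "\<sigma> \<le> \<sigma>0"
    have "g (Complex \<sigma>0 0) \<noteq> 0" using low[of 0] \<delta> by auto
    then have "AE t in lborel. g (Complex \<sigma> t) \<noteq> 0"
      using \<alpha> \<sigma> by (intro line_zeros_null[OF line_boundedD(3)[OF g], of "Complex \<sigma>0 0"]) (auto simp: half_plane_def)
    then show "log_controlled g K \<sigma>" using K(1) K(2)[OF g low \<sigma>] by (simp add: log_controlled_def)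
  qed
qed

lemma dpoly_log_controlled:
  assumes nz: "\<exists>n\<in>{1..N}. c n \<noteq> 0" and \<alpha>: "0 < \<alpha>"
  obtains K where "0 \<le> K" "\<And>\<sigma>. \<alpha> \<le> \<sigma> \<Longrightarrow> \<sigma> \<le> \<beta> \<Longrightarrow> log_controlled (dpoly c N) K \<sigma>"
proof -
  obtain \<sigma>2 where \<sigma>2: "\<And>\<sigma>. \<sigma>2 \<le> \<sigma> \<Longrightarrow> \<exists>\<delta>. 0 < \<delta> \<and> \<delta> \<le> 1 \<and> (\<forall>t. \<delta> \<le> norm (dpoly c N (Complex \<sigma> t)))"
    using dpoly_eventually_large[where N = N and c = c] nz by blast
  define \<sigma>0 where "\<sigma>0 = max \<alpha> (max \<beta> \<sigma>2)"
  obtain \<delta> where \<delta>: "0 < \<delta>" "\<delta> \<le> 1" "\<And>t. \<delta> \<le> norm (dpoly c N (Complex \<sigma>0 t))"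
  proof -
    have "\<sigma>2 \<le> \<sigma>0" by (simp add: \<sigma>0_def)
    from \<sigma>2[OF this] show thesis using that by blast
  qed
  have C0: "0 \<le> (\<Sum>n=1..N. norm (c n))" by (simp add: sum_nonneg)
  have \<alpha>0: "\<alpha> \<le> \<sigma>0" by (simp add: \<sigma>0_def)
  obtain K where "0 \<le> K" "\<And>\<sigma>. \<alpha> \<le> \<sigma> \<Longrightarrow> \<sigma> \<le> \<sigma>0 \<Longrightarrow> log_controlled (dpoly c N) K \<sigma>"
    using log_controlled_family[OF \<alpha> \<alpha>0 \<delta>(1,2) C0] dpoly_line_bounded[of c N] \<delta>(3) by metis
  then show thesis by (intro that[of K]) (auto simp: \<sigma>0_def)
qed

lemma tlog_eq_of_square:
  assumes "0 < \<epsilon>" shows "tlog \<epsilon> z = ln (max (sqrt ((norm z)\<^sup>2)) \<epsilon>)"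
  by (simp add: tlog_def)

text \<open>
  On the range of the bounded function \<open>|P|^2\<close> the truncated logarithm is a continuous function of
  \<open>|P|^2\<close>, hence by Weierstrass a uniform limit of polynomials in \<open>|P|^2 = P * cnj P\<close>. These are
  trigonometric polynomials with coefficients bounded in \<open>\<sigma>\<close>.
\<close>

lemma dpoly_tlog_ucauchy:
  assumes \<epsilon>: "0 < \<epsilon>"
  shows "ucauchy {0<..} (\<lambda>T \<sigma>. tlog_mean \<epsilon> (dpoly c N) \<sigma> T)"
proof (rule ucauchy_approx)
  fix e :: real assume e: "0 < e"
  define M where "M = (\<Sum>n=1..N. norm (c n))"
  define \<phi> where "\<phi> x = ln (max (sqrt x) \<epsilon>)" for x :: real
  have "continuous_on {0..M\<^sup>2} \<phi>"
    unfolding \<phi>_def using \<epsilon> by (intro continuous_intros) (auto simp: max_def)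
  then obtain q where q: "real_polynomial_function q" "\<And>x. x \<in> {0..M\<^sup>2} \<Longrightarrow> \<bar>\<phi> x - q x\<bar> < e"
    using Stone_Weierstrass_real_polynomial_function[of "{0..M\<^sup>2}" \<phi> e] e by auto
  define P where "P \<sigma> t = dpoly c N (Complex \<sigma> t)" for \<sigma> t
  define Q where "Q \<sigma> t = q ((norm (P \<sigma> t))\<^sup>2)" for \<sigma> t
  have sq: "trig_poly (\<lambda>\<sigma> t. of_real ((norm (P \<sigma> t))\<^sup>2))"
    unfolding complex_norm_square P_def by (intro trig_poly_mult trig_poly_cnj dpoly_trig_poly)
  have tQ: "trig_poly (\<lambda>\<sigma> t. of_real (Q \<sigma> t))"
    unfolding Q_def using q(1)
  proof (induction q)
    case (linear f)
    then have "f x = x * f 1" for x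
      using linear_scale[OF bounded_linear.linear[OF linear], of x 1] by simp
    then have "(\<lambda>\<sigma> t. complex_of_real (f ((norm (P \<sigma> t))\<^sup>2))) = (\<lambda>\<sigma> t. of_real ((norm (P \<sigma> t))\<^sup>2) * of_real (f 1))"
      by (intro ext) (metis of_real_mult)
    then show ?case using trig_poly_mult[OF sq trig_poly_const[of "of_real (f 1)"]] by simp
  next
    case (const k)
    then show ?case by (simp add: trig_poly_const)
  next
    case (add f g)
    from trig_poly.add[OF add.IH] show ?case by simp
  next
    case (mult f g)
    from trig_poly_mult[OF mult.IH] show ?case by simp
  qed
  obtain L where cont: "\<forall>\<sigma>>0. continuous_on UNIV (\<lambda>t. complex_of_real (Q \<sigma> t))"
    and L: "uniform_limit {0<..} (\<lambda>T \<sigma>. (LBINT t:{-T..T}. complex_of_real (Q \<sigma> t)) / of_real (2 * T)) L at_top"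
    using trig_poly_mean[OF tQ] by blast
  have contQ: "continuous_on A (Q \<sigma>)" if "0 < \<sigma>" for \<sigma> A
  proof -
    have "continuous_on UNIV (\<lambda>t. Re (complex_of_real (Q \<sigma> t)))" using cont that by (intro continuous_intros) auto
    then show ?thesis by (auto elim: continuous_on_subset)
  qed
  define G where "G T \<sigma> = 1 / (2 * T) * (LBINT t:{-T..T}. Q \<sigma> t)" for T \<sigma>
  have "uniform_limit {0<..} G (\<lambda>\<sigma>. Re (L \<sigma>)) at_top"
  proof (rule uniform_limitI)
    fix e' :: real assume "0 < e'"
    then have "\<forall>\<^sub>F T in at_top. \<forall>\<sigma>\<in>{0<..}. dist ((LBINT t:{-T..T}. complex_of_real (Q \<sigma> t)) / of_real (2 * T)) (L \<sigma>) < e'"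
      using L by (rule uniform_limitD[rotated])
    then show "\<forall>\<^sub>F T in at_top. \<forall>\<sigma>\<in>{0<..}. dist (G T \<sigma>) (Re (L \<sigma>)) < e'"
    proof eventually_elim
      case (elim T)
      have "dist (G T \<sigma>) (Re (L \<sigma>)) \<le> dist ((LBINT t:{-T..T}. complex_of_real (Q \<sigma> t)) / of_real (2 * T)) (L \<sigma>)" for \<sigma>
      proof -
        have "(LBINT t:{-T..T}. complex_of_real (Q \<sigma> t)) / of_real (2 * T) = complex_of_real (G T \<sigma>)"
          unfolding G_def set_integral_complex_of_real by simp
        then show ?thesis using abs_Re_le_cmod[of "complex_of_real (G T \<sigma>) - L \<sigma>"]
          by (simp add: dist_norm)
      qed
      then show ?case using elim by (meson le_less_trans)
    qed
  qed
  then have "ucauchy {0<..} G" by (rule uniform_limit_ucauchy)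
  moreover have "\<bar>tlog_mean \<epsilon> (dpoly c N) \<sigma> T - G T \<sigma>\<bar> \<le> e" if T: "1 \<le> T" and \<sigma>: "\<sigma> \<in> {0<..}" for T \<sigma>
  proof -
    have "set_integrable lborel {-T..T} (\<lambda>t. tlog \<epsilon> (P \<sigma> t))"
      unfolding P_def using \<sigma> \<epsilon> by (intro tlog_integrable dpoly_holomorphic) auto
    moreover have "set_integrable lborel {-T..T} (Q \<sigma>)"
      using \<sigma> by (intro borel_integrable_atLeastAtMost' contQ) auto
    ultimately have I: "set_integrable lborel {-T..T} (\<lambda>t. tlog \<epsilon> (P \<sigma> t))" "set_integrable lborel {-T..T} (Q \<sigma>)" .
    have "\<bar>(LBINT t:{-T..T}. tlog \<epsilon> (P \<sigma> t)) - (LBINT t:{-T..T}. Q \<sigma> t)\<bar> = norm (LBINT t:{-T..T}. tlog \<epsilon> (P \<sigma> t) - Q \<sigma> t)"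
      using I by (simp add: set_integral_diff)
    also have "\<dots> \<le> (LBINT t:{-T..T}. norm (tlog \<epsilon> (P \<sigma> t) - Q \<sigma> t))"
      using I by (intro set_integral_norm_bound set_integral_diff)
    also have "\<dots> \<le> (LBINT t:{-T..T}. e)"
    proof (rule set_integral_mono)
      fix t
      have "norm (P \<sigma> t) \<le> M" unfolding P_def M_def using \<sigma> by (intro dpoly_bound) auto
      then have "(norm (P \<sigma> t))\<^sup>2 \<in> {0..M\<^sup>2}" by (auto intro: power_mono)
      from q(2)[OF this] show "norm (tlog \<epsilon> (P \<sigma> t) - Q \<sigma> t) \<le> e"
        by (simp add: tlog_eq_of_square[OF \<epsilon>] \<phi>_def Q_def)
    next
      show "set_integrable lborel {-T..T} (\<lambda>t. norm (tlog \<epsilon> (P \<sigma> t) - Q \<sigma> t))"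
        using set_integrable_abs[OF set_integral_diff(1)[OF I]] by simp
    qed (rule borel_integrable_atLeastAtMost'[OF continuous_on_const])
    also have "\<dots> = 2 * T * e" using T by (simp add: set_lebesgue_integral_def)
    finally have "\<bar>(LBINT t:{-T..T}. tlog \<epsilon> (P \<sigma> t)) - (LBINT t:{-T..T}. Q \<sigma> t)\<bar> \<le> 2 * T * e" .
    then have "1 / (2 * T) * \<bar>(LBINT t:{-T..T}. tlog \<epsilon> (P \<sigma> t)) - (LBINT t:{-T..T}. Q \<sigma> t)\<bar> \<le> 1 / (2 * T) * (2 * T * e)"
      using T by (intro mult_left_mono) auto
    also have "1 / (2 * T) * (2 * T * e) = e" using T by simp
    also have "1 / (2 * T) * \<bar>(LBINT t:{-T..T}. tlog \<epsilon> (P \<sigma> t)) - (LBINT t:{-T..T}. Q \<sigma> t)\<bar> = \<bar>tlog_mean \<epsilon> (dpoly c N) \<sigma> T - G T \<sigma>\<bar>"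
      using T by (simp add: tlog_mean_def G_def P_def abs_mult right_diff_distrib[symmetric] del: times_divide_eq_left)
    finally show ?thesis .
  qed
  ultimately show "\<exists>G T0. ucauchy {0<..} G \<and> (\<forall>T\<ge>T0. \<forall>x\<in>{0<..}. \<bar>tlog_mean \<epsilon> (dpoly c N) x T - G T x\<bar> \<le> e)"
    by blast
qed

lemma ucauchy_subset: "ucauchy B F \<Longrightarrow> A \<subseteq> B \<Longrightarrow> ucauchy A F"
  unfolding ucauchy_def by (meson subsetD)

lemma ex_small_log:
  fixes K e :: real assumes "0 < e"
  obtains \<epsilon> where "0 < \<epsilon>" "\<epsilon> < 1" "K / ln (1 / \<epsilon>) \<le> e"
proof (rule that[of "exp (- (\<bar>K\<bar> / e + 1))"])
  have p: "0 < \<bar>K\<bar> / e + 1" using assms by (simp add: add_nonneg_pos)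
  show "exp (- (\<bar>K\<bar> / e + 1)) < 1" using p by simp
  have "ln (1 / exp (- (\<bar>K\<bar> / e + 1))) = \<bar>K\<bar> / e + 1" by (simp add: ln_div)
  moreover have "K \<le> e * (\<bar>K\<bar> / e + 1)" using assms by (simp add: distrib_left)
  ultimately show "K / ln (1 / exp (- (\<bar>K\<bar> / e + 1))) \<le> e" using p by (simp add: pos_divide_le_eq del: ln_div)
qed simp

text \<open>
  With mean-square control of the logarithm the truncation error tends to 0 with \<open>\<epsilon>\<close>, uniformly in \<open>T\<close>
  and \<open>\<sigma>\<close>.
\<close>

lemma jessen_ucauchy_of_tlog:
  assumes g: "g holomorphic_on half_plane 0" and A: "A \<subseteq> {0<..}"
    and K: "\<And>\<sigma>. \<sigma> \<in> A \<Longrightarrow> log_controlled g K \<sigma>"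
    and uc: "\<And>\<epsilon>. 0 < \<epsilon> \<Longrightarrow> ucauchy A (\<lambda>T \<sigma>. tlog_mean \<epsilon> g \<sigma> T)"
  shows "ucauchy A (\<lambda>T \<sigma>. jessen_mean g \<sigma> T)"
proof (rule ucauchy_approx)
  fix e :: real assume "0 < e"
  then obtain \<epsilon> where \<epsilon>: "0 < \<epsilon>" "\<epsilon> < 1" "K / ln (1 / \<epsilon>) \<le> e" using ex_small_log by blast
  have "\<forall>T\<ge>1. \<forall>\<sigma>\<in>A. \<bar>jessen_mean g \<sigma> T - tlog_mean \<epsilon> g \<sigma> T\<bar> \<le> e"
    using jessen_tlog_mean[OF g _ K \<epsilon>(1,2)] A \<epsilon>(3) by (meson greaterThan_iff order_trans subsetD)
  then show "\<exists>G T0. ucauchy A G \<and> (\<forall>T\<ge>T0. \<forall>x\<in>A. \<bar>jessen_mean g x T - G T x\<bar> \<le> e)"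
    using uc[OF \<epsilon>(1)] by blast
qed

section \<open>Convexity of the Jessen function of a Dirichlet polynomial\<close>

lemma integral_Re_circ:
  assumes "0 < r" shows "((\<lambda>x. Re (circ r x)) has_integral 0) {0..1}"
proof -
  have "((\<lambda>x. (\<lambda>z. z) (0 + circ r x)) has_integral 0) {0..1}"
    using assms by (intro circle_mean_value) (auto intro: holomorphic_intros)
  then have "((\<lambda>x. circ r x) has_integral 0) {0..1}" by simp
  then have "((\<lambda>x. Re (circ r x)) has_integral Re 0) {0..1}" by (rule has_integral_Re)
  then show ?thesis by simp
qed

lemma abs_Re_circ_le: "0 < r \<Longrightarrow> \<bar>Re (circ r x)\<bar> \<le> r"
  and abs_Im_circ_le: "0 < r \<Longrightarrow> \<bar>Im (circ r x)\<bar> \<le> r"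
  using abs_Re_le_cmod[of "circ r x"] abs_Im_le_cmod[of "circ r x"] by auto

text \<open>
  If \<open>J\<close> exceeded a chord, \<open>J\<close> minus the chord would have a positive maximum over the interval. Affine
  functions have the mean value property, so the difference still satisfies the submean inequality.
  At the leftmost maximum point this forces the maximal value on the whole circle, in
  particular at the point \<open>z0 - r\<close> further left.
\<close>

lemma submean_imp_convex:
  fixes J :: "real \<Rightarrow> real"
  assumes cont: "continuous_on {0<..} J"
    and sub: "\<And>\<sigma> r. 0 < r \<Longrightarrow> r < \<sigma> \<Longrightarrow> J \<sigma> \<le> integral {0..1} (\<lambda>x. J (\<sigma> + Re (circ r x)))"
  shows "convex_on {0<..} J"
proof (rule convex_on_linorderI)
  fix t x y :: real assume t: "0 < t" "t < 1" and xy: "x \<in> {0<..}" "y \<in> {0<..}" "x < y"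
  define k where "k = (J y - J x) / (y - x)"
  define g where "g z = J z - (J x + (z - x) * k)" for z
  have gx: "g x = 0" and gy: "g y = 0" using xy by (auto simp: g_def k_def)
  define c where "c = (1 - t) * x + t * y"
  have c: "x < c" "c < y" using t xy mult_strict_left_mono[of x y t] mult_strict_left_mono[of x y "1 - t"]
    by (auto simp: c_def algebra_simps)
  have gc: "g c = J c - ((1 - t) * J x + t * J y)"
  proof -
    have "c - x = t * (y - x)" by (simp add: c_def algebra_simps)
    then have "(c - x) * k = t * (J y - J x)" using xy by (simp add: k_def)
    then show ?thesis by (simp add: g_def algebra_simps)
  qed
  have contg: "continuous_on {x..y} g"
    unfolding g_def using xy by (intro continuous_intros continuous_on_subset[OF cont]) auto
  have "g c \<le> 0"
  proof (rule ccontr)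
    assume "\<not> g c \<le> 0"
    obtain z1 where z1: "z1 \<in> {x..y}" "\<And>z. z \<in> {x..y} \<Longrightarrow> g z \<le> g z1"
      using continuous_attains_sup[of "{x..y}" g] contg xy by auto
    have M: "g z1 > 0" using z1(2)[of c] c \<open>\<not> g c \<le> 0\<close> by auto
    define S where "S = {z \<in> {x..y}. g z = g z1}"
    have "compact S"
      unfolding S_def using continuous_closed_preimage_constant[OF contg, of "g z1"]
      by (intro compact_eq_bounded_closed[THEN iffD2] conjI bounded_subset[OF bounded_closed_interval[of x y]]) auto
    moreover have "S \<noteq> {}" using z1 by (auto simp: S_def)
    ultimately have "\<exists>z0\<in>S. \<forall>z\<in>S. z0 \<le> z" by (rule compact_attains_inf)
    then obtain z0 where z0: "z0 \<in> S" "\<And>z. z \<in> S \<Longrightarrow> z0 \<le> z" by blast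
    have z0': "x < z0" "z0 < y" "g z0 = g z1"
      using z0(1) M gx gy by (auto simp: S_def less_le)
    define r where "r = min (z0 - x) (y - z0)"
    have r: "0 < r" "r \<le> z0 - x" "r \<le> y - z0" "r < z0" using z0' xy by (auto simp: r_def)
    have inI: "z0 + Re (circ r u) \<in> {x..y}" for u
      using abs_Re_circ_le[OF r(1), of u] r by auto
    have contu: "continuous_on {0..1} (\<lambda>u. g (z0 + Re (circ r u)))"
      by (rule continuous_on_compose2[OF contg]) (use inI in \<open>auto intro!: continuous_intros\<close>)
    have contJ: "continuous_on {0..1} (\<lambda>u. J (z0 + Re (circ r u)))"
    proof (rule continuous_on_compose2[OF cont])
      have "0 < z0 + Re (circ r u)" for u using inI[of u] xy by auto
      then show "(\<lambda>u. z0 + Re (circ r u)) ` {0..1} \<subseteq> {0<..}" by auto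
    qed (intro continuous_intros)
    have "((\<lambda>u. J (z0 + Re (circ r u)) - ((J x + (z0 - x) * k) + Re (circ r u) * k)) has_integral
       (integral {0..1} (\<lambda>u. J (z0 + Re (circ r u))) - ((J x + (z0 - x) * k) + 0 * k))) {0..1}"
    proof (rule has_integral_diff)
      have "((\<lambda>u. J x + (z0 - x) * k) has_integral (J x + (z0 - x) * k)) {0..1::real}"
        using has_integral_const_real[of "J x + (z0 - x) * k" 0 1] by simp
      then show "((\<lambda>u. J x + (z0 - x) * k + Re (circ r u) * k) has_integral (J x + (z0 - x) * k + 0 * k)) {0..1}"
        by (rule has_integral_add) (rule has_integral_mult_left[OF integral_Re_circ[OF r(1)]])
    qed (rule integrable_integral[OF integrable_continuous_real[OF contJ]])
    then have "((\<lambda>u. g (z0 + Re (circ r u))) has_integral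
       (integral {0..1} (\<lambda>u. J (z0 + Re (circ r u))) - (J x + (z0 - x) * k))) {0..1}"
      by (simp add: g_def algebra_simps)
    then have 1: "integral {0..1} (\<lambda>u. g (z0 + Re (circ r u))) \<ge> g z0"
      using sub[OF r(1,4)] by (simp add: integral_unique g_def)
    have "integral {0..1} (\<lambda>u. g z1 - g (z0 + Re (circ r u))) = g z1 - integral {0..1} (\<lambda>u. g (z0 + Re (circ r u)))"
      by (subst integral_diff) (auto intro: integrable_continuous_real contu)
    then have le0: "integral {0..1} (\<lambda>u. g z1 - g (z0 + Re (circ r u))) \<le> 0" using 1 z0' by simp
    have nn: "0 \<le> g z1 - g (z0 + Re (circ r u))" for u using z1(2)[OF inI[of u]] by simp
    have "integral {0..1} (\<lambda>u. g z1 - g (z0 + Re (circ r u))) = 0"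
      using le0 nn by (intro antisym integral_nonneg integrable_continuous_real continuous_intros contu) auto
    then have "\<forall>u\<in>{0..1}. g z1 - g (z0 + Re (circ r u)) = 0"
      using nn by (subst (asm) integral_eq_0_iff) (auto intro!: continuous_intros contu)
    then have "g z1 - g (z0 + Re (circ r (1/2))) = 0" by (rule bspec) simp
    then have "g (z0 + Re (circ r (1/2))) = g z1" by simp
    moreover have "Re (circ r (1/2)) = - r" by (simp add: Re_circ)
    ultimately have "z0 - r \<in> S" using r z0' by (auto simp: S_def)
    then show False using z0(2)[of "z0 - r"] r by simp
  qed
  then show "J ((1 - t) *\<^sub>R x + t *\<^sub>R y) \<le> (1 - t) * J x + t * J y"
    using gc by (simp add: c_def)
qed simp

lemma indicator_diff_bound:
  fixes v b :: real
  assumes "A - B \<subseteq> E1 \<union> E2" "B - A \<subseteq> E1 \<union> E2" "\<bar>v\<bar> \<le> b"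
  shows "\<bar>indicator A t * v - indicator B t * v\<bar> \<le> indicator E1 t * b + indicator E2 t * b"
proof -
  have "0 \<le> b" using assms(3) by linarith
  then show ?thesis
    using assms by (cases "t \<in> A"; cases "t \<in> B"; cases "t \<in> E1"; cases "t \<in> E2") auto
qed

lemma shifted_interval_diff:
  fixes c k T :: real
  assumes "c \<le> k" "- c \<le> k"
  shows "{-T + c..T + c} - {-T..T} \<subseteq> {-T - k..-T + k} \<union> {T - k..T + k}"
    "{-T..T} - {-T + c..T + c} \<subseteq> {-T - k..-T + k} \<union> {T - k..T + k}"
proof -
  have k: "0 \<le> k" using assms by linarith
  show "{-T + c..T + c} - {-T..T} \<subseteq> {-T - k..-T + k} \<union> {T - k..T + k}"
  proof
    fix x assume "x \<in> {-T + c..T + c} - {-T..T}"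
    then have x: "-T + c \<le> x" "x \<le> T + c" "x < -T \<or> T < x" by auto
    from x(3) show "x \<in> {-T - k..-T + k} \<union> {T - k..T + k}"
    proof
      assume "x < -T"
      then have "-T - k \<le> x" "x \<le> -T + k" using x assms k by linarith+
      then show ?thesis by (simp only: Un_iff atLeastAtMost_iff simp_thms)
    next
      assume "T < x"
      then have "T - k \<le> x" "x \<le> T + k" using x assms k by linarith+
      then show ?thesis by (simp only: Un_iff atLeastAtMost_iff simp_thms)
    qed
  qed
  show "{-T..T} - {-T + c..T + c} \<subseteq> {-T - k..-T + k} \<union> {T - k..T + k}"
  proof
    fix x assume "x \<in> {-T..T} - {-T + c..T + c}"
    then have x: "-T \<le> x" "x \<le> T" "x < -T + c \<or> T + c < x" by auto
    from x(3) show "x \<in> {-T - k..-T + k} \<union> {T - k..T + k}"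
    proof
      assume "x < -T + c"
      then have "-T - k \<le> x" "x \<le> -T + k" using x assms k by linarith+
      then show ?thesis by (simp only: Un_iff atLeastAtMost_iff simp_thms)
    next
      assume "T + c < x"
      then have "T - k \<le> x" "x \<le> T + k" using x assms k by linarith+
      then show ?thesis by (simp only: Un_iff atLeastAtMost_iff simp_thms)
    qed
  qed
qed

text \<open>
  Shifting the window changes it only near its two ends, within two intervals of length \<open>2 |c|\<close>.
\<close>

lemma shift_integral_bound:
  fixes v :: "real \<Rightarrow> real"
  assumes v: "v \<in> borel_measurable borel" "\<And>t. \<bar>v t\<bar> \<le> B" and T: "0 \<le> T"
  shows "\<bar>(LBINT t:{-T..T}. v (t + c)) - (LBINT t:{-T..T}. v t)\<bar> \<le> 4 * \<bar>c\<bar> * B"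
proof -
  note [measurable] = v(1)
  have B: "0 \<le> B" using v(2)[of 0] by linarith
  define E1 E2 where "E1 = {-T - \<bar>c\<bar>..-T + \<bar>c\<bar>}" and "E2 = {T - \<bar>c\<bar>..T + \<bar>c\<bar>}"
  have IB: "integrable lborel (\<lambda>t. indicator {p..q} t * B)" for p q :: real
    using borel_integrable_atLeastAtMost'[OF continuous_on_const, of p q B] by (simp add: set_integrable_def)
  have I: "integrable lborel (\<lambda>t. indicator {p..q} t * v t)" for p q
  proof (rule Bochner_Integration.integrable_bound[of _ "\<lambda>t. indicator {p..q} t * B"])
    show "AE x in lborel. norm (indicat_real {p..q} x * v x) \<le> norm (indicat_real {p..q} x * B)"
      using v(2) B by (auto simp: indicator_def)
  qed (use IB in auto)
  have "(LBINT t:{-T..T}. v (t + c)) = (\<integral>t. indicator {-T..T} (t - c) * v t \<partial>lborel)"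
    unfolding set_lebesgue_integral_def
    using lborel_integral_real_affine[of 1 "\<lambda>t. indicator {-T..T} (t - c) * v t" c]
    by (simp add: add.commute)
  also have "(\<lambda>t. indicator {-T..T} (t - c) * v t) = (\<lambda>t. indicator {-T + c..T + c} t * v t)"
  proof
    fix t
    have "t - c \<in> {-T..T} \<longleftrightarrow> t \<in> {-T + c..T + c}" by auto
    then show "indicator {-T..T} (t - c) * v t = indicator {-T + c..T + c} t * v t" by (simp only: indicator_def)
  qed
  finally have eq: "(LBINT t:{-T..T}. v (t + c)) - (LBINT t:{-T..T}. v t)
     = (\<integral>t. indicator {-T + c..T + c} t * v t - indicator {-T..T} t * v t \<partial>lborel)"
    unfolding set_lebesgue_integral_def by (subst Bochner_Integration.integral_diff) (auto intro: I)
  have "\<bar>(LBINT t:{-T..T}. v (t + c)) - (LBINT t:{-T..T}. v t)\<bar>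
     \<le> (\<integral>t. norm (indicator {-T + c..T + c} t * v t - indicator {-T..T} t * v t) \<partial>lborel)"
    unfolding eq using integral_norm_bound[of lborel "\<lambda>t. indicator {-T + c..T + c} t * v t - indicator {-T..T} t * v t"] by simp
  also have "\<dots> \<le> (\<integral>t. indicator E1 t * B + indicator E2 t * B \<partial>lborel)"
  proof (rule integral_mono)
    fix t
    show "norm (indicator {-T + c..T + c} t * v t - indicator {-T..T} t * v t) \<le> indicator E1 t * B + indicator E2 t * B"
      unfolding real_norm_def
    proof (rule indicator_diff_bound[OF _ _ v(2)])
      have c: "c \<le> \<bar>c\<bar>" "- c \<le> \<bar>c\<bar>" by auto
      show "{-T + c..T + c} - {-T..T} \<subseteq> E1 \<union> E2" "{-T..T} - {-T + c..T + c} \<subseteq> E1 \<union> E2"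
        unfolding E1_def E2_def by (fact shifted_interval_diff[OF c])+
    qed
  next
    show "integrable lborel (\<lambda>t. norm (indicator {-T + c..T + c} t * v t - indicator {-T..T} t * v t))"
      by (intro integrable_norm Bochner_Integration.integrable_diff I)
  next
    show "integrable lborel (\<lambda>t. indicator E1 t * B + indicator E2 t * B)"
      unfolding E1_def E2_def by (rule Bochner_Integration.integrable_add[OF IB IB])
  qed
  also have "\<dots> = (\<integral>t. indicator E1 t * B \<partial>lborel) + (\<integral>t. indicator E2 t * B \<partial>lborel)"
    unfolding E1_def E2_def by (rule Bochner_Integration.integral_add[OF IB IB])
  also have "\<dots> = 4 * \<bar>c\<bar> * B"
  proof -
    have "(\<integral>t. indicator {p..q} t * B \<partial>lborel) = (q - p) * B" if "p \<le> q" for p q :: real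
      using that by simp
    moreover have "-T - \<bar>c\<bar> \<le> -T + \<bar>c\<bar>" "T - \<bar>c\<bar> \<le> T + \<bar>c\<bar>" using abs_ge_zero[of c] by linarith+
    ultimately show ?thesis unfolding E1_def E2_def by (simp only:) (simp add: algebra_simps)
  qed
  finally show ?thesis .
qed

lemma tlog_dpoly_bound:
  assumes "0 < \<epsilon>" "0 \<le> Re s"
  shows "\<bar>tlog \<epsilon> (dpoly c N s)\<bar> \<le> \<bar>ln \<epsilon>\<bar> + \<bar>ln (max (\<Sum>n=1..N. norm (c n)) \<epsilon>)\<bar>"
proof -
  have "ln \<epsilon> \<le> tlog \<epsilon> (dpoly c N s)" using assms by (simp add: tlog_def)
  moreover have "tlog \<epsilon> (dpoly c N s) \<le> ln (max (\<Sum>n=1..N. norm (c n)) \<epsilon>)"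
    unfolding tlog_def using assms dpoly_bound[OF assms(2), of c N]
    by (subst ln_le_cancel_iff) (auto simp: max_def)
  ultimately show ?thesis by linarith
qed

lemma dpoly_tlog_continuous:
  assumes "0 < \<epsilon>" "continuous_on A s" shows "continuous_on A (\<lambda>x. tlog \<epsilon> (dpoly c N (s x)))"
  by (intro continuous_on_tlog assms continuous_on_compose2[OF holomorphic_on_imp_continuous_on[OF dpoly_holomorphic[of c N UNIV]]]) auto

lemma continuous_on_Complex: "continuous_on A f \<Longrightarrow> continuous_on A g \<Longrightarrow> continuous_on A (\<lambda>x. Complex (f x) (g x))"
  unfolding Complex_eq by (intro continuous_intros)

lemma dpoly_tlog_mean_eq:
  assumes "0 < \<epsilon>"
  shows "tlog_mean \<epsilon> (dpoly c N) \<sigma> T = 1 / (2 * T) * integral {-T..T} (\<lambda>t. tlog \<epsilon> (dpoly c N (Complex \<sigma> t)))"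
proof -
  have "set_integrable lborel {-T..T} (\<lambda>t. tlog \<epsilon> (dpoly c N (Complex \<sigma> t)))"
    by (intro borel_integrable_atLeastAtMost' dpoly_tlog_continuous assms continuous_on_Complex continuous_intros)
  then show ?thesis by (simp add: tlog_mean_def set_borel_integral_eq_integral(2))
qed

lemma dpoly_tlog_mean_continuous:
  assumes "0 < \<epsilon>"
  shows "continuous_on A (\<lambda>\<sigma>. tlog_mean \<epsilon> (dpoly c N) \<sigma> T)"
proof -
  have "continuous_on A (\<lambda>\<sigma>. integral (cbox (-T) T) (\<lambda>t. tlog \<epsilon> (dpoly c N (Complex \<sigma> t))))"
  proof (rule integral_continuous_on_param)
    show "continuous_on (A \<times> cbox (-T) T) (\<lambda>(\<sigma>, t). tlog \<epsilon> (dpoly c N (Complex \<sigma> t)))"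
      unfolding split_def by (intro dpoly_tlog_continuous assms continuous_on_Complex continuous_intros)
  qed
  then show ?thesis unfolding dpoly_tlog_mean_eq[OF assms] by (intro continuous_on_mult continuous_on_const) simp
qed

text \<open>
  Jensen's inequality at each point of the line, integrated in \<open>t\<close>: the real part of the circle moves
  the line, and the imaginary part shifts the window of integration, at a cost of \<open>O(1/T)\<close>.
\<close>

lemma dpoly_tlog_mean_submean:
  fixes c :: "nat \<Rightarrow> complex" and N :: nat
  assumes \<epsilon>: "0 < \<epsilon>" and r: "0 < r" "r < \<sigma>" and T: "0 < T"
  defines "B \<equiv> \<bar>ln \<epsilon>\<bar> + \<bar>ln (max (\<Sum>n=1..N. norm (c n)) \<epsilon>)\<bar>"
  shows "tlog_mean \<epsilon> (dpoly c N) \<sigma> T \<le>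
    integral {0..1} (\<lambda>x. tlog_mean \<epsilon> (dpoly c N) (\<sigma> + Re (circ r x)) T) + 2 * r * B / T"
proof -
  define V where "V s = tlog \<epsilon> (dpoly c N s)" for s
  have B: "0 \<le> B" by (simp add: B_def)
  have contV: "continuous_on A (\<lambda>x. V (s x))" if "continuous_on A s" for A and s :: "'a::topological_space \<Rightarrow> complex"
    unfolding V_def by (intro dpoly_tlog_continuous \<epsilon> that)
  have eqc: "Complex \<sigma> t + circ r x = Complex (\<sigma> + Re (circ r x)) (t + Im (circ r x))" for t x
    by (simp add: complex_eq_iff)
  have c2: "continuous_on A (\<lambda>z. circ r (snd z))" for A :: "(real \<times> real) set"
    unfolding circ_def by (intro continuous_intros)
  have c3: "continuous_on A (\<lambda>z. circ r (fst z))" for A :: "(real \<times> real) set"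
    unfolding circ_def by (intro continuous_intros)
  have cont2: "continuous_on (cbox (-T, 0) (T, 1)) (\<lambda>(t, x). V (Complex \<sigma> t + circ r x))"
    unfolding split_def by (intro contV continuous_on_add continuous_on_Complex c2 continuous_intros)
  have "integral {-T..T} (\<lambda>t. V (Complex \<sigma> t)) \<le> integral {-T..T} (\<lambda>t. integral {0..1} (\<lambda>x. V (Complex \<sigma> t + circ r x)))"
  proof (rule integral_le)
    show "(\<lambda>t. V (Complex \<sigma> t)) integrable_on {-T..T}"
      by (intro integrable_continuous_real contV continuous_on_Complex continuous_intros)
    have "continuous_on (cbox (-T) T) (\<lambda>t. integral (cbox 0 1) (\<lambda>x. V (Complex \<sigma> t + circ r x)))"
      by (rule integral_continuous_on_param, unfold split_def) (intro contV continuous_on_add continuous_on_Complex c2 continuous_intros)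
    then show "(\<lambda>t. integral {0..1} (\<lambda>x. V (Complex \<sigma> t + circ r x))) integrable_on {-T..T}"
      by (intro integrable_continuous_real) auto
    show "V (Complex \<sigma> t) \<le> integral {0..1} (\<lambda>x. V (Complex \<sigma> t + circ r x))" for t
      unfolding V_def using r by (intro jensen_truncated[where R = "r + 1"] dpoly_holomorphic \<epsilon>) auto
  qed
  also have "\<dots> = integral {0..1} (\<lambda>x. integral {-T..T} (\<lambda>t. V (Complex \<sigma> t + circ r x)))"
    using integral_swap_continuous[OF cont2] by simp
  also have "\<dots> \<le> integral {0..1} (\<lambda>x. integral {-T..T} (\<lambda>t. V (Complex (\<sigma> + Re (circ r x)) t)) + 4 * r * B)"
  proof (rule integral_le)
    have "continuous_on (cbox 0 1) (\<lambda>x. integral (cbox (-T) T) (\<lambda>t. V (Complex \<sigma> t + circ r x)))"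
      by (rule integral_continuous_on_param, unfold split_def) (intro contV continuous_on_add continuous_on_Complex c3 continuous_intros)
    then show "(\<lambda>x. integral {-T..T} (\<lambda>t. V (Complex \<sigma> t + circ r x))) integrable_on {0..1}"
      by (intro integrable_continuous_real) auto
    have "continuous_on (cbox 0 1) (\<lambda>x. integral (cbox (-T) T) (\<lambda>t. V (Complex (\<sigma> + Re (circ r x)) t)))"
      by (rule integral_continuous_on_param, unfold split_def) (intro contV continuous_on_add continuous_on_Complex continuous_on_Re c3 continuous_intros)
    then show "(\<lambda>x. integral {-T..T} (\<lambda>t. V (Complex (\<sigma> + Re (circ r x)) t)) + 4 * r * B) integrable_on {0..1}"
      by (intro integrable_add integrable_continuous_real) auto
    fix x :: real
    have pos: "0 \<le> \<sigma> + Re (circ r x)" using abs_Re_circ_le[OF r(1), of x] r by linarith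
    have toL: "integral {-T..T} (\<lambda>t. V (Complex s (t + u))) = (LBINT t:{-T..T}. V (Complex s (t + u)))" for s u
      by (rule set_borel_integral_eq_integral(2)[symmetric])
         (intro borel_integrable_atLeastAtMost' contV continuous_on_Complex continuous_intros)
    have "\<bar>(LBINT t:{-T..T}. V (Complex (\<sigma> + Re (circ r x)) (t + Im (circ r x)))) - (LBINT t:{-T..T}. V (Complex (\<sigma> + Re (circ r x)) t))\<bar>
      \<le> 4 * \<bar>Im (circ r x)\<bar> * B"
    proof (rule shift_integral_bound)
      show "(\<lambda>t. V (Complex (\<sigma> + Re (circ r x)) t)) \<in> borel_measurable borel"
        by (intro borel_measurable_continuous_onI contV continuous_on_Complex continuous_intros)
      show "\<bar>V (Complex (\<sigma> + Re (circ r x)) t)\<bar> \<le> B" for t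
        unfolding V_def B_def using pos by (intro tlog_dpoly_bound \<epsilon>) auto
    qed (use T in auto)
    also have "\<dots> \<le> 4 * r * B" using abs_Im_circ_le[OF r(1), of x] B by (intro mult_right_mono) auto
    finally show "integral {-T..T} (\<lambda>t. V (Complex \<sigma> t + circ r x)) \<le> integral {-T..T} (\<lambda>t. V (Complex (\<sigma> + Re (circ r x)) t)) + 4 * r * B"
      using toL[of "\<sigma> + Re (circ r x)" 0] toL[of "\<sigma> + Re (circ r x)" "Im (circ r x)"] unfolding eqc by simp
  qed
  also have "\<dots> = integral {0..1} (\<lambda>x. 2 * T * tlog_mean \<epsilon> (dpoly c N) (\<sigma> + Re (circ r x)) T + 4 * r * B)"
    unfolding dpoly_tlog_mean_eq[OF \<epsilon>] V_def using T by simp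
  also have "\<dots> = 2 * T * integral {0..1} (\<lambda>x. tlog_mean \<epsilon> (dpoly c N) (\<sigma> + Re (circ r x)) T) + 4 * r * B"
  proof -
    have "continuous_on {0..1} (\<lambda>x. tlog_mean \<epsilon> (dpoly c N) (\<sigma> + Re (circ r x)) T)"
      by (rule continuous_on_compose2[OF dpoly_tlog_mean_continuous[OF \<epsilon>, of UNIV]]) (auto intro!: continuous_intros)
    then have "(\<lambda>x. tlog_mean \<epsilon> (dpoly c N) (\<sigma> + Re (circ r x)) T) integrable_on {0..1}"
      by (rule integrable_continuous_real)
    then show ?thesis by (subst integral_add) (auto intro: integrable_on_mult_right)
  qed
  finally have *: "integral {-T..T} (\<lambda>t. V (Complex \<sigma> t)) \<le>
    2 * T * integral {0..1} (\<lambda>x. tlog_mean \<epsilon> (dpoly c N) (\<sigma> + Re (circ r x)) T) + 4 * r * B" .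
  have "tlog_mean \<epsilon> (dpoly c N) \<sigma> T = 1 / (2 * T) * integral {-T..T} (\<lambda>t. V (Complex \<sigma> t))"
    by (simp add: dpoly_tlog_mean_eq[OF \<epsilon>] V_def)
  also have "\<dots> \<le> 1 / (2 * T) * (2 * T * integral {0..1} (\<lambda>x. tlog_mean \<epsilon> (dpoly c N) (\<sigma> + Re (circ r x)) T) + 4 * r * B)"
    using * T by (intro mult_left_mono) auto
  also have "\<dots> = integral {0..1} (\<lambda>x. tlog_mean \<epsilon> (dpoly c N) (\<sigma> + Re (circ r x)) T) + 2 * r * B / T"
    using T by (simp add: distrib_left)
  finally show ?thesis .
qed

lemma dpoly_tlog_limit_convex:
  assumes \<epsilon>: "0 < \<epsilon>"
  shows "convex_on {0<..} (\<lambda>\<sigma>. Lim at_top (\<lambda>T. tlog_mean \<epsilon> (dpoly c N) \<sigma> T))"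
proof (rule submean_imp_convex)
  define J where "J \<sigma> = Lim at_top (\<lambda>T. tlog_mean \<epsilon> (dpoly c N) \<sigma> T)" for \<sigma>
  note uc = dpoly_tlog_ucauchy[OF \<epsilon>, of c N]
  have ul: "uniform_limit {0<..} (\<lambda>T \<sigma>. tlog_mean \<epsilon> (dpoly c N) \<sigma> T) J at_top"
    using ucauchy_limit(2)[OF uc] by (simp add: J_def[abs_def])
  show cont: "continuous_on {0<..} J"
    by (rule uniform_limit_theorem[OF _ ul]) (auto intro!: always_eventually dpoly_tlog_mean_continuous \<epsilon>)
  fix \<sigma> r :: real assume r: "0 < r" "r < \<sigma>"
  have pos: "0 < \<sigma> + Re (circ r x)" for x using abs_Re_circ_le[OF r(1), of x] r by linarith
  have contJ: "continuous_on {0..1} (\<lambda>x. J (\<sigma> + Re (circ r x)))"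
    by (rule continuous_on_compose2[OF cont]) (use pos in \<open>auto intro!: continuous_intros\<close>)
  define B where "B = \<bar>ln \<epsilon>\<bar> + \<bar>ln (max (\<Sum>n=1..N. norm (c n)) \<epsilon>)\<bar>"
  have lim: "((\<lambda>T. tlog_mean \<epsilon> (dpoly c N) \<sigma> T) \<longlongrightarrow> J \<sigma>) at_top"
    using ucauchy_limit(1)[OF uc, of \<sigma>] r by (simp add: J_def)
  have "J \<sigma> \<le> integral {0..1} (\<lambda>x. J (\<sigma> + Re (circ r x))) + e" if e: "0 < e" for e
  proof (rule tendsto_le[OF trivial_limit_at_top_linorder _ lim])
    have "((\<lambda>T. 2 * r * B / T) \<longlongrightarrow> 0) at_top"
      by (intro tendsto_divide_0[OF tendsto_const] filterlim_at_top_imp_at_infinity filterlim_ident)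
    then show "((\<lambda>T. integral {0..1} (\<lambda>x. J (\<sigma> + Re (circ r x))) + e + 2 * r * B / T) \<longlongrightarrow>
      integral {0..1} (\<lambda>x. J (\<sigma> + Re (circ r x))) + e) at_top"
      using tendsto_add[OF tendsto_const[of "integral {0..1} (\<lambda>x. J (\<sigma> + Re (circ r x))) + e"]] by fastforce
    have "\<forall>\<^sub>F T in at_top. \<forall>\<sigma>\<in>{0<..}. dist (tlog_mean \<epsilon> (dpoly c N) \<sigma> T) (J \<sigma>) < e"
      by (rule uniform_limitD[OF ul e])
    then show "\<forall>\<^sub>F T in at_top. tlog_mean \<epsilon> (dpoly c N) \<sigma> T \<le> integral {0..1} (\<lambda>x. J (\<sigma> + Re (circ r x))) + e + 2 * r * B / T"
      using eventually_gt_at_top[of 0]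
    proof eventually_elim
      case (elim T)
      have "tlog_mean \<epsilon> (dpoly c N) \<sigma> T \<le>
        integral {0..1} (\<lambda>x. tlog_mean \<epsilon> (dpoly c N) (\<sigma> + Re (circ r x)) T) + 2 * r * B / T"
        unfolding B_def by (rule dpoly_tlog_mean_submean[OF \<epsilon> r elim(2)])
      also have "integral {0..1} (\<lambda>x. tlog_mean \<epsilon> (dpoly c N) (\<sigma> + Re (circ r x)) T) \<le> integral {0..1} (\<lambda>x. J (\<sigma> + Re (circ r x)) + e)"
      proof (rule integral_le)
        have "continuous_on {0..1} (\<lambda>x. tlog_mean \<epsilon> (dpoly c N) (\<sigma> + Re (circ r x)) T)"
          by (rule continuous_on_compose2[OF dpoly_tlog_mean_continuous[OF \<epsilon>, of UNIV]]) (auto intro!: continuous_intros)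
        then show "(\<lambda>x. tlog_mean \<epsilon> (dpoly c N) (\<sigma> + Re (circ r x)) T) integrable_on {0..1}"
          by (rule integrable_continuous_real)
        show "(\<lambda>x. J (\<sigma> + Re (circ r x)) + e) integrable_on {0..1}"
          by (intro integrable_continuous_real continuous_intros contJ)
        fix x
        have "dist (tlog_mean \<epsilon> (dpoly c N) (\<sigma> + Re (circ r x)) T) (J (\<sigma> + Re (circ r x))) < e"
          using elim(1) pos by auto
        then show "tlog_mean \<epsilon> (dpoly c N) (\<sigma> + Re (circ r x)) T \<le> J (\<sigma> + Re (circ r x)) + e"
          by (simp add: dist_real_def)
      qed
      also have "\<dots> = integral {0..1} (\<lambda>x. J (\<sigma> + Re (circ r x))) + e"
        by (subst integral_add) (auto intro: integrable_continuous_real contJ)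
      finally show ?case by simp
    qed
  qed
  then show "J \<sigma> \<le> integral {0..1} (\<lambda>x. J (\<sigma> + Re (circ r x)))" by (rule field_le_epsilon)
qed

lemma convex_on_pointwise_limit:
  fixes F :: "nat \<Rightarrow> real \<Rightarrow> real"
  assumes "\<And>n. convex_on A (F n)" "\<And>x. x \<in> A \<Longrightarrow> (\<lambda>n. F n x) \<longlonglongrightarrow> f x"
  shows "convex_on A f"
  unfolding convex_on_def
proof (intro conjI ballI allI impI)
  show "convex A" using assms(1)[of 0] by (simp add: convex_on_def)
  fix x y u v :: real assume *: "x \<in> A" "y \<in> A" "0 \<le> u" "0 \<le> v" "u + v = 1"
  then have A: "u *\<^sub>R x + v *\<^sub>R y \<in> A" using \<open>convex A\<close> by (simp add: convex_def)
  show "f (u *\<^sub>R x + v *\<^sub>R y) \<le> u * f x + v * f y"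
  proof (rule LIMSEQ_le)
    show "(\<lambda>n. F n (u *\<^sub>R x + v *\<^sub>R y)) \<longlonglongrightarrow> f (u *\<^sub>R x + v *\<^sub>R y)" by (rule assms(2)[OF A])
    show "(\<lambda>n. u * F n x + v * F n y) \<longlonglongrightarrow> u * f x + v * f y" using * by (intro tendsto_intros assms(2))
    show "\<exists>N. \<forall>n\<ge>N. F n (u *\<^sub>R x + v *\<^sub>R y) \<le> u * F n x + v * F n y"
      using assms(1) * unfolding convex_on_def by blast
  qed
qed

lemma dpoly_jessen_ucauchy:
  assumes nz: "\<exists>n\<in>{1..N}. c n \<noteq> 0" and \<alpha>: "0 < \<alpha>"
  shows "ucauchy {\<alpha>..\<beta>} (\<lambda>T \<sigma>. jessen_mean (dpoly c N) \<sigma> T)"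
proof -
  obtain K where K: "\<And>\<sigma>. \<alpha> \<le> \<sigma> \<Longrightarrow> \<sigma> \<le> \<beta> \<Longrightarrow> log_controlled (dpoly c N) K \<sigma>"
    using dpoly_log_controlled[OF nz \<alpha>] by blast
  show ?thesis
  proof (rule jessen_ucauchy_of_tlog)
    show "ucauchy {\<alpha>..\<beta>} (\<lambda>T \<sigma>. tlog_mean \<epsilon> (dpoly c N) \<sigma> T)" if "0 < \<epsilon>" for \<epsilon>
      by (rule ucauchy_subset[OF dpoly_tlog_ucauchy[OF that]]) (use \<alpha> in auto)
  qed (use K \<alpha> dpoly_holomorphic in auto)
qed

lemma jessen_tendsto:
  assumes "ucauchy {\<alpha>..\<beta>} (\<lambda>T \<sigma>. jessen_mean g \<sigma> T)" "\<alpha> \<le> \<sigma>" "\<sigma> \<le> \<beta>"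
  shows "(jessen_mean g \<sigma> \<longlongrightarrow> jessen g \<sigma>) at_top"
  using ucauchy_limit(1)[OF assms(1), of \<sigma>] assms by (simp add: jessen_def)

text \<open>
  The limits of the truncated means are convex, and their distance to the Jessen function is at most
  \<open>K / log (1/\<epsilon>)\<close>.
\<close>

lemma dpoly_jessen_convex:
  assumes nz: "\<exists>n\<in>{1..N}. c n \<noteq> 0"
  shows "convex_on {0<..} (jessen (dpoly c N))"
proof (rule convex_on_pointwise_limit)
  define \<epsilon> where "\<epsilon> n = exp (- (real n + 1))" for n
  have \<epsilon>: "0 < \<epsilon> n" "\<epsilon> n < 1" "ln (1 / \<epsilon> n) = real n + 1" for n by (auto simp: \<epsilon>_def ln_div)
  define J where "J n \<sigma> = Lim at_top (\<lambda>T. tlog_mean (\<epsilon> n) (dpoly c N) \<sigma> T)" for n \<sigma>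
  show "convex_on {0<..} (J n)" for n
    unfolding J_def by (rule dpoly_tlog_limit_convex[OF \<epsilon>(1)])
  fix \<sigma> :: real assume "\<sigma> \<in> {0<..}"
  then have \<sigma>: "0 < \<sigma>" by simp
  obtain K where K: "log_controlled (dpoly c N) K \<sigma>"
    using dpoly_log_controlled[OF nz \<sigma>, of \<sigma>] by blast
  have le: "\<bar>J n \<sigma> - jessen (dpoly c N) \<sigma>\<bar> \<le> K / (real n + 1)" for n
  proof (rule tendsto_upperbound)
    show "((\<lambda>T. \<bar>tlog_mean (\<epsilon> n) (dpoly c N) \<sigma> T - jessen_mean (dpoly c N) \<sigma> T\<bar>) \<longlongrightarrow> \<bar>J n \<sigma> - jessen (dpoly c N) \<sigma>\<bar>) at_top"
      using ucauchy_limit(1)[OF dpoly_tlog_ucauchy[OF \<epsilon>(1)[of n], of c N], of \<sigma>] \<sigma>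
        jessen_tendsto[OF dpoly_jessen_ucauchy[OF nz \<sigma>, of \<sigma>], of \<sigma>]
      unfolding J_def by (intro tendsto_intros) auto
    show "\<forall>\<^sub>F T in at_top. \<bar>tlog_mean (\<epsilon> n) (dpoly c N) \<sigma> T - jessen_mean (dpoly c N) \<sigma> T\<bar> \<le> K / (real n + 1)"
      using eventually_ge_at_top[of 1]
    proof eventually_elim
      case (elim T)
      from jessen_tlog_mean[OF dpoly_holomorphic \<sigma> K \<epsilon>(1,2) elim, of n]
      show ?case by (simp add: \<epsilon>(3) abs_minus_commute)
    qed
  qed simp
  have "(\<lambda>n. K / (real n + 1)) \<longlonglongrightarrow> 0"
    using tendsto_mult[OF tendsto_const[of K] LIMSEQ_inverse_real_of_nat] by (simp add: divide_inverse add.commute)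
  then have "(\<lambda>n. J n \<sigma> - jessen (dpoly c N) \<sigma>) \<longlonglongrightarrow> 0"
    by (rule Lim_null_comparison[rotated]) (use le in auto)
  then show "(\<lambda>n. J n \<sigma>) \<longlonglongrightarrow> jessen (dpoly c N) \<sigma>" by (rule LIM_zero_cancel)
qed

section \<open>A Fourier kernel for the Riesz weight\<close>

lemma integrable_inverse_one_plus_square: "integrable lborel (\<lambda>x::real. inverse (1 + x\<^sup>2))"
proof (rule integrableI_bounded)
  have pos: "0 < 1 + x\<^sup>2" for x :: real by (simp add: add_pos_nonneg)
  have "(\<integral>\<^sup>+x. ennreal (inverse (1 + x\<^sup>2)) * indicator {0..} x \<partial>lborel) = ennreal (pi / 2 - arctan 0)"
    by (rule nn_integral_FTC_atLeast)
       (auto intro!: derivative_eq_intros tendsto_arctan_at_top simp: less_imp_le[OF pos])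
  then have half: "(\<integral>\<^sup>+x. ennreal (inverse (1 + x\<^sup>2)) * indicator {0..} x \<partial>lborel) < \<infinity>" by simp
  have "(\<integral>\<^sup>+x. ennreal (inverse (1 + x\<^sup>2)) * indicator {0..} (- x) \<partial>lborel)
    = (\<integral>\<^sup>+x. ennreal (inverse (1 + x\<^sup>2)) * indicator {0..} x \<partial>lborel)"
    using nn_integral_real_affine[of "\<lambda>x. ennreal (inverse (1 + x\<^sup>2)) * indicator {0..} x" "-1" 0] by simp
  with half have half': "(\<integral>\<^sup>+x. ennreal (inverse (1 + x\<^sup>2)) * indicator {0..} (- x) \<partial>lborel) < \<infinity>" by simp
  have "(\<integral>\<^sup>+x. ennreal (norm (inverse (1 + x\<^sup>2 :: real))) \<partial>lborel) \<le>
    (\<integral>\<^sup>+(x::real). ennreal (inverse (1 + x\<^sup>2)) * indicator {0..} x + ennreal (inverse (1 + x\<^sup>2)) * indicator {0..} (- x) \<partial>lborel)"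
    by (intro nn_integral_mono) (auto simp: indicator_def less_imp_le[OF pos] abs_of_pos[OF pos])
  also have "\<dots> = (\<integral>\<^sup>+x. ennreal (inverse (1 + x\<^sup>2)) * indicator {0..} x \<partial>lborel) +
     (\<integral>\<^sup>+x. ennreal (inverse (1 + x\<^sup>2)) * indicator {0..} (- x) \<partial>lborel)"
    by (intro nn_integral_add) auto
  also have "\<dots> < \<infinity>" using half half' by simp
  finally show "(\<integral>\<^sup>+x. ennreal (norm (inverse (1 + x\<^sup>2 :: real))) \<partial>lborel) < \<infinity>" .
qed simp

lemma integrable_of_decay:
  fixes F :: "real \<Rightarrow> 'b::{banach, second_countable_topology}"
  assumes m: "F \<in> borel_measurable borel" and b: "\<And>v. norm (F v) \<le> A" "\<And>v. norm (F v) * v\<^sup>2 \<le> A"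
  shows "integrable lborel F"
proof (rule Bochner_Integration.integrable_bound)
  show "integrable lborel (\<lambda>x::real. 2 * A * inverse (1 + x\<^sup>2))"
    by (intro integrable_mult_right integrable_inverse_one_plus_square)
  have "norm (F v) \<le> norm (2 * A * inverse (1 + v\<^sup>2))" for v
  proof -
    have p: "0 < 1 + v\<^sup>2" by (simp add: add_pos_nonneg)
    have A: "0 \<le> A" using b(1)[of v] norm_ge_zero[of "F v"] by linarith
    have "norm (F v) * (1 + v\<^sup>2) \<le> 2 * A" using b[of v] by (simp add: distrib_left)
    then have "norm (F v) \<le> 2 * A / (1 + v\<^sup>2)" using p by (simp add: pos_le_divide_eq)
    then show ?thesis using p A by (simp add: divide_inverse abs_mult)
  qed
  then show "AE x in lborel. norm (F x) \<le> norm (2 * A * inverse (1 + x\<^sup>2))" by simp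
qed (use m in simp)

text \<open>
  The integral of \<open>(a v - sin (a v)) / v^3\<close> over the line is homogeneous in \<open>a\<close> and equals \<open>a |a|\<close> times
  a constant. Third differences of \<open>a |a|\<close> are quadratic splines of bounded support.
\<close>

definition sine_kernel :: "real \<Rightarrow> real" where
  "sine_kernel v = (v - sin v) / v ^ 3"

lemma sine_kernel_bounds: "0 \<le> sine_kernel v" "sine_kernel v \<le> 1" "sine_kernel v * v\<^sup>2 \<le> 2"
proof -
  have "0 \<le> sine_kernel v \<and> sine_kernel v \<le> 1 \<and> sine_kernel v * v\<^sup>2 \<le> 2" if "0 < v" for v :: real
  proof -
    have s: "sin v \<le> v" using that sin_x_le_x by simp
    have s2: "v - sin v \<le> 2 * v"
      using abs_sin_x_le_abs_x[of v] that by linarith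
    have s3: "v - sin v \<le> v ^ 3"
    proof -
      have "sin 0 + 0 ^ 3 - 0 \<le> sin v + v ^ 3 - v"
      proof (rule DERIV_nonneg_imp_nondecreasing[where f = "\<lambda>v. sin v + v ^ 3 - v"])
        show "0 \<le> v" using that by simp
        fix x :: real assume x: "0 \<le> x" "x \<le> v"
        have "cos x = 1 - 2 * (sin (x/2))\<^sup>2" using cos_double_sin[of "x/2"] by simp
        moreover have "(sin (x/2))\<^sup>2 \<le> (x/2)\<^sup>2" using abs_le_square_iff[THEN iffD1, OF abs_sin_x_le_abs_x] .
        moreover have "(x/2)\<^sup>2 = x\<^sup>2 / 4" by (simp add: power_divide)
        moreover have "0 \<le> x\<^sup>2" by simp
        ultimately have "0 \<le> cos x + 3 * x\<^sup>2 - 1" by linarith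
        then show "\<exists>y. ((\<lambda>v. sin v + v ^ 3 - v) has_real_derivative y) (at x) \<and> 0 \<le> y"
          by (intro exI[of _ "cos x + 3 * x\<^sup>2 - 1"]) (auto intro!: derivative_eq_intros)
      qed
      then show ?thesis by simp
    qed
    have "sine_kernel v * v\<^sup>2 = (v - sin v) / v" using that by (simp add: sine_kernel_def power2_eq_square power3_eq_cube)
    then show ?thesis using that s s2 s3 by (simp add: sine_kernel_def pos_divide_le_eq)
  qed
  moreover have "sine_kernel (- v) = sine_kernel v"
  proof -
    have "sine_kernel (- v) = (- (v - sin v)) / (- (v ^ 3))" by (simp add: sine_kernel_def)
    then show ?thesis unfolding sine_kernel_def minus_divide_divide .
  qed
  moreover have "sine_kernel 0 = 0" by (simp add: sine_kernel_def)
  ultimately have "0 \<le> sine_kernel v \<and> sine_kernel v \<le> 1 \<and> sine_kernel v * v\<^sup>2 \<le> 2"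
    by (metis linorder_neqE_linordered_idom neg_0_less_iff_less order_refl power2_minus zero_le_one mult_zero_left zero_le_numeral)
  then show "0 \<le> sine_kernel v" "sine_kernel v \<le> 1" "sine_kernel v * v\<^sup>2 \<le> 2" by auto
qed

lemma sine_kernel_measurable [measurable]: "sine_kernel \<in> borel_measurable borel"
  unfolding sine_kernel_def by measurable

lemma sine_kernel_integrable: "integrable lborel sine_kernel"
proof (rule integrable_of_decay[where A = 2])
  show "norm (sine_kernel v) \<le> 2" "norm (sine_kernel v) * v\<^sup>2 \<le> 2" for v
    using sine_kernel_bounds[of v] by auto
qed simp

definition sine_const :: real where "sine_const = (\<integral>v. sine_kernel v \<partial>lborel)"

lemma sine_const_pos: "0 < sine_const"
proof -
  have "sine_const \<noteq> 0"
  proof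
    assume "sine_const = 0"
    then have "AE v in lborel. sine_kernel v = 0"
      unfolding sine_const_def using sine_kernel_bounds(1)
      by (subst (asm) integral_nonneg_eq_0_iff_AE[OF sine_kernel_integrable]) auto
    moreover have "AE v in lborel. v \<noteq> (0::real)" using AE_lborel_singleton[of 0] by simp
    ultimately have "AE v in lborel. v \<notin> {2<..<3::real}"
    proof eventually_elim
      case (elim v)
      then have "sin v = v" by (simp add: sine_kernel_def)
      then show ?case using sin_le_one[of v] by auto
    qed
    then have "emeasure lborel {2<..<3::real} = 0"
      by (subst (asm) AE_iff_measurable[of "{2<..<3}"]) auto
    then show False by simp
  qed
  moreover have "0 \<le> sine_const" unfolding sine_const_def by (intro integral_nonneg_AE) (simp add: sine_kernel_bounds)
  ultimately show ?thesis by simp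
qed

lemma sine_integral_scale:
  "has_bochner_integral lborel (\<lambda>v. (a * v - sin (a * v)) / v ^ 3) (a * \<bar>a\<bar> * sine_const)"
proof (cases "a = 0")
  case False
  have eq: "(a * v - sin (a * v)) / v ^ 3 = a ^ 3 * sine_kernel (a * v)" for v
    using False by (simp add: sine_kernel_def power_mult_distrib)
  have "integrable lborel (\<lambda>v. sine_kernel (0 + a * v))"
    using sine_kernel_integrable False by (intro lborel_integrable_real_affine)
  moreover have "sine_const = \<bar>a\<bar> * (\<integral>v. sine_kernel (a * v) \<partial>lborel)"
    unfolding sine_const_def using lborel_integral_real_affine[OF False, of sine_kernel 0] by simp
  then have "(\<integral>v. sine_kernel (a * v) \<partial>lborel) = sine_const / \<bar>a\<bar>"
    using False by (metis abs_eq_0 nonzero_mult_div_cancel_left)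
  ultimately have "has_bochner_integral lborel (\<lambda>v. a ^ 3 * sine_kernel (a * v)) (a ^ 3 * (sine_const / \<bar>a\<bar>))"
    using False by (intro has_bochner_integral_mult_right) (simp add: has_bochner_integral_iff)
  moreover have "a ^ 3 * (sine_const / \<bar>a\<bar>) = a * \<bar>a\<bar> * sine_const"
    using False by (simp add: abs_if power3_eq_cube)
  ultimately show ?thesis by (simp only: eq)
qed (simp add: has_bochner_integral_zero)

text \<open>
  A kernel whose Fourier transform is the quadratic spline supported on \<open>[-2, 1]\<close> that equals
  \<open>(1 - x)^2\<close> for \<open>0 \<le> x \<le> 1\<close>. Frequencies of Dirichlet series are nonnegative, so the
  transform is prescribed only for \<open>x \<ge> 0\<close>; continuing it as a spline on the negative side, instead of
  symmetrically, avoids a corner at 0 and yields the decay \<open>|v|^(-3)\<close>.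
\<close>

definition spline_kernel :: "real \<Rightarrow> complex" where
  "spline_kernel v = \<i> / (2 * of_real sine_const) * (cis v * (1 - cis (- v)) ^ 3) / of_real v ^ 3"

lemma norm_one_minus_cis: "norm (1 - cis (- v)) \<le> \<bar>v\<bar>" "norm (1 - cis (- v)) \<le> 2"
proof -
  have "(norm (1 - cis (- v)))\<^sup>2 = (1 - cos v)\<^sup>2 + (sin v)\<^sup>2" by (simp add: cmod_power2)
  also have "\<dots> = 2 - 2 * cos v" using sin_cos_squared_add[of v] by (simp add: power2_eq_square algebra_simps)
  also have "\<dots> = 4 * (sin (v / 2))\<^sup>2" using cos_double_sin[of "v / 2"] by simp
  also have "\<dots> \<le> 4 * (v / 2)\<^sup>2" using abs_le_square_iff[THEN iffD1, OF abs_sin_x_le_abs_x[of "v/2"]] by simp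
  also have "\<dots> = \<bar>v\<bar>\<^sup>2" by (simp add: power_divide)
  finally show "norm (1 - cis (- v)) \<le> \<bar>v\<bar>" by (rule power2_le_imp_le) simp
  show "norm (1 - cis (- v)) \<le> 2" using norm_triangle_ineq4[of 1 "cis (- v)"] by simp
qed

lemma spline_kernel_bounds:
  "norm (spline_kernel v) \<le> 1 / (2 * sine_const)" "norm (spline_kernel v) * \<bar>v\<bar> ^ 3 \<le> 8 / (2 * sine_const)"
proof -
  have n: "norm (spline_kernel v) = norm (1 - cis (- v)) ^ 3 / \<bar>v\<bar> ^ 3 / (2 * sine_const)"
    using sine_const_pos by (simp add: spline_kernel_def norm_mult norm_divide norm_power)
  have "norm (1 - cis (- v)) ^ 3 / \<bar>v\<bar> ^ 3 \<le> 1"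
  proof (cases "v = 0")
    case False
    then show ?thesis using power_mono[OF norm_one_minus_cis(1)[of v], of 3] by (simp add: divide_le_eq)
  qed simp
  then show "norm (spline_kernel v) \<le> 1 / (2 * sine_const)"
    unfolding n using sine_const_pos by (intro divide_right_mono) auto
  have "norm (1 - cis (- v)) ^ 3 / \<bar>v\<bar> ^ 3 * \<bar>v\<bar> ^ 3 \<le> 8"
  proof -
    have "norm (1 - cis (- v)) ^ 3 \<le> 8" using power_mono[OF norm_one_minus_cis(2)[of v], of 3] by simp
    then show ?thesis by simp
  qed
  then show "norm (spline_kernel v) * \<bar>v\<bar> ^ 3 \<le> 8 / (2 * sine_const)"
    unfolding n times_divide_eq_left using sine_const_pos by (intro divide_right_mono) auto
qed

lemma spline_kernel_measurable [measurable]: "spline_kernel \<in> borel_measurable borel"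
proof -
  have [measurable]: "cis \<in> borel_measurable borel"
    by (intro borel_measurable_continuous_onI continuous_intros)
  show ?thesis unfolding spline_kernel_def by measurable
qed

lemma spline_kernel_integrable:
  "integrable lborel spline_kernel" "integrable lborel (\<lambda>v. norm (spline_kernel v) * \<bar>v\<bar>)"
proof -
  define A where "A = 8 / (2 * sine_const)"
  have A: "1 / (2 * sine_const) \<le> A" "0 < A"
    unfolding A_def using sine_const_pos by (intro divide_right_mono, auto)
  have b: "norm (spline_kernel v) \<le> A" "norm (spline_kernel v) * \<bar>v\<bar> ^ 3 \<le> A" for v
    using spline_kernel_bounds[of v] A by (auto simp: A_def)
  have c: "norm (spline_kernel v) * \<bar>v\<bar> ^ j \<le> A" if "j \<le> 3" for v j
  proof (cases "\<bar>v\<bar> \<le> 1")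
    case True
    then have "norm (spline_kernel v) * \<bar>v\<bar> ^ j \<le> norm (spline_kernel v) * 1" by (intro mult_left_mono power_le_one) auto
    then show ?thesis using b(1)[of v] by simp
  next
    case False
    then have "norm (spline_kernel v) * \<bar>v\<bar> ^ j \<le> norm (spline_kernel v) * \<bar>v\<bar> ^ 3"
      using that by (intro mult_left_mono power_increasing) auto
    then show ?thesis using b(2)[of v] by simp
  qed
  show "integrable lborel spline_kernel"
    by (rule integrable_of_decay[where A = A]) (use c[of 0] c[of 2] in auto)
  show "integrable lborel (\<lambda>v. norm (spline_kernel v) * \<bar>v\<bar>)"
  proof (rule integrable_of_decay[where A = A])
    show "norm (norm (spline_kernel v) * \<bar>v\<bar>) \<le> A" for v using c[of 1 v] by (simp add: abs_mult)
    show "norm (norm (spline_kernel v) * \<bar>v\<bar>) * v\<^sup>2 \<le> A" for v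
      using c[of 3 v] by (simp add: abs_mult power2_eq_square power3_eq_cube mult.assoc)
  qed simp
qed

text \<open>
  Expanding the cube of \<open>1 - cis (- v)\<close> gives a third difference of exponentials. The linear terms
  added to turn each sine into \<open>a v - sin (a v)\<close> cancel in the third difference.
\<close>

lemma spline_kernel_fourier:
  assumes x: "0 \<le> x"
  shows "(\<integral>v. spline_kernel v * cis (- x * v) \<partial>lborel) = of_real ((max 0 (1 - x))\<^sup>2)"
proof -
  define F where "F v = spline_kernel v * cis (- x * v)" for v
  have [measurable]: "cis \<in> borel_measurable borel"
    by (intro borel_measurable_continuous_onI continuous_intros)
  have I: "integrable lborel F"
  proof (rule Bochner_Integration.integrable_bound[OF spline_kernel_integrable(1)])
    show "F \<in> borel_measurable lborel" unfolding F_def by measurable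
  qed (simp add: F_def norm_mult)
  have cF: "cnj (F v) = F (- v)" for v
  proof -
    have "cnj (spline_kernel v) = spline_kernel (- v)"
      by (simp add: spline_kernel_def cis_cnj power3_eq_cube) 
    then show ?thesis by (simp add: F_def cis_cnj)
  qed
  have "cnj (\<integral>v. F v \<partial>lborel) = (\<integral>v. F (- v) \<partial>lborel)"
    by (simp add: cF[symmetric])
  also have "\<dots> = (\<integral>v. F v \<partial>lborel)"
    using lborel_integral_real_affine[of "-1" F 0] by simp
  finally have real: "Im (\<integral>v. F v \<partial>lborel) = 0" by (simp add: complex_eq_iff)
  have ReF: "Re (F v) = 1 / (2 * sine_const) * (
      ((1 - x) * v - sin ((1 - x) * v)) / v ^ 3 - 3 * ((((0 - x) * v - sin ((0 - x) * v)) / v ^ 3))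
      + 3 * (((-1 - x) * v - sin ((-1 - x) * v)) / v ^ 3) - ((-2 - x) * v - sin ((-2 - x) * v)) / v ^ 3)" for v
  proof -
    have e: "cis v * (1 - cis (- v)) ^ 3 = cis v - 3 + 3 * cis (- v) - cis (- 2 * v)"
    proof -
      have "cis v * cis (- v) = 1" by (simp add: cis_mult)
      moreover have "cis (- 2 * v) = cis (- v) * cis (- v)" by (simp add: cis_mult)
      ultimately show ?thesis by algebra
    qed
    have "cis v * (1 - cis (- v)) ^ 3 * cis (- x * v) =
      cis ((1 - x) * v) - 3 * cis ((0 - x) * v) + 3 * cis ((-1 - x) * v) - cis ((-2 - x) * v)"
      unfolding e by (simp add: ring_distribs cis_mult mult.assoc)
    then have "F v = \<i> / (2 * of_real sine_const) * (cis ((1 - x) * v) - 3 * cis ((0 - x) * v) + 3 * cis ((-1 - x) * v) - cis ((-2 - x) * v)) / of_real v ^ 3"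
      by (simp add: F_def spline_kernel_def mult_ac)
    also have "\<dots> = of_real (1 / (2 * sine_const) / v ^ 3) * (\<i> * (cis ((1 - x) * v) - 3 * cis ((0 - x) * v) + 3 * cis ((-1 - x) * v) - cis ((-2 - x) * v)))"
      by simp
    finally have "F v = of_real (1 / (2 * sine_const) / v ^ 3) * (\<i> * (cis ((1 - x) * v) - 3 * cis ((0 - x) * v) + 3 * cis ((-1 - x) * v) - cis ((-2 - x) * v)))" .
    then have "Re (F v) = 1 / (2 * sine_const) / v ^ 3 * (- (sin ((1 - x) * v) - 3 * sin ((0 - x) * v) + 3 * sin ((-1 - x) * v) - sin ((-2 - x) * v)))"
      by (simp only: Re_complex_of_real Im_complex_of_real times_complex.sel) simp
    also have "- (sin ((1 - x) * v) - 3 * sin ((0 - x) * v) + 3 * sin ((-1 - x) * v) - sin ((-2 - x) * v))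
       = ((1 - x) * v - sin ((1 - x) * v)) - 3 * ((0 - x) * v - sin ((0 - x) * v)) + 3 * ((-1 - x) * v - sin ((-1 - x) * v)) - ((-2 - x) * v - sin ((-2 - x) * v))"
    proof -
      have "(1 - x) * v - 3 * ((0 - x) * v) + 3 * ((-1 - x) * v) - (-2 - x) * v = 0" by (simp add: algebra_simps)
      moreover have "- (s1 - 3 * s2 + 3 * s3 - s4) = (a1 - s1) - 3 * (a2 - s2) + 3 * (a3 - s3) - (a4 - s4)"
        if "a1 - 3 * a2 + 3 * a3 - a4 = (0::real)" for a1 a2 a3 a4 s1 s2 s3 s4
        using that by (simp add: algebra_simps)
      ultimately show ?thesis by blast
    qed
    also have "1 / (2 * sine_const) / v ^ 3 * (A - 3 * B + 3 * C - D) = 1 / (2 * sine_const) * (A / v ^ 3 - 3 * (B / v ^ 3) + 3 * (C / v ^ 3) - D / v ^ 3)" for A B C D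
    proof -
      have "A / v ^ 3 - 3 * (B / v ^ 3) + 3 * (C / v ^ 3) - D / v ^ 3 = (A - 3 * B + 3 * C - D) / v ^ 3"
        by (simp add: diff_divide_distrib add_divide_distrib)
      then show ?thesis by simp
    qed
    finally show ?thesis .
  qed
  have "has_bochner_integral lborel (\<lambda>v. Re (F v)) (1 / (2 * sine_const) * (
      (1 - x) * \<bar>1 - x\<bar> * sine_const - 3 * ((0 - x) * \<bar>0 - x\<bar> * sine_const)
      + 3 * ((-1 - x) * \<bar>-1 - x\<bar> * sine_const) - (-2 - x) * \<bar>-2 - x\<bar> * sine_const))"
    unfolding ReF by (intro has_bochner_integral_mult_right has_bochner_integral_diff has_bochner_integral_add sine_integral_scale)
  moreover have "1 / (2 * sine_const) * (
      (1 - x) * \<bar>1 - x\<bar> * sine_const - 3 * ((0 - x) * \<bar>0 - x\<bar> * sine_const)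
      + 3 * ((-1 - x) * \<bar>-1 - x\<bar> * sine_const) - (-2 - x) * \<bar>-2 - x\<bar> * sine_const) = (max 0 (1 - x))\<^sup>2"
  proof -
    have "1 / (2 * sine_const) * (
      (1 - x) * \<bar>1 - x\<bar> * sine_const - 3 * ((0 - x) * \<bar>0 - x\<bar> * sine_const)
      + 3 * ((-1 - x) * \<bar>-1 - x\<bar> * sine_const) - (-2 - x) * \<bar>-2 - x\<bar> * sine_const)
      = ((1 - x) * \<bar>1 - x\<bar> - 3 * ((0 - x) * \<bar>0 - x\<bar>) + 3 * ((-1 - x) * \<bar>-1 - x\<bar>) - (-2 - x) * \<bar>-2 - x\<bar>) / 2"
      using sine_const_pos by (simp add: field_simps)
    also have "\<dots> = ((1 - x) * \<bar>1 - x\<bar> - 3 * ((0 - x) * x) + 3 * ((-1 - x) * (1 + x)) - (-2 - x) * (2 + x)) / 2"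
      using x by (simp add: add.commute)
    also have "\<dots> = (max 0 (1 - x))\<^sup>2"
    proof (cases "x \<le> 1")
      case True
      moreover have "(1 - x) * (1 - x) - 3 * ((0 - x) * x) + 3 * ((-1 - x) * (1 + x)) - (-2 - x) * (2 + x) = 2 * (1 - x)\<^sup>2"
        by algebra
      ultimately show ?thesis by simp
    next
      case False
      moreover have "(1 - x) * (x - 1) - 3 * ((0 - x) * x) + 3 * ((-1 - x) * (1 + x)) - (-2 - x) * (2 + x) = 0"
        by algebra
      ultimately show ?thesis by simp
    qed
    finally show ?thesis .
  qed
  ultimately have "(\<integral>v. Re (F v) \<partial>lborel) = (max 0 (1 - x))\<^sup>2" by (simp add: has_bochner_integral_iff)
  then have "Re (\<integral>v. F v \<partial>lborel) = (max 0 (1 - x))\<^sup>2" using I by simp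
  then show ?thesis using real by (simp add: F_def complex_eq_iff)
qed

text \<open>
  The Riesz weight of order \<open>k\<close> is a mixture of dilated weights of order 2. After the substitution
  \<open>r = x + (1 - x) r'\<close> the integral is a Beta integral times \<open>(1 - x)^k\<close>; the constant \<open>c\<close> normalizes it.
\<close>

lemma beta_mixture:
  fixes k :: real
  assumes k: "3 < k"
  obtains c where "0 < c"
    "\<And>x. 0 \<le> x \<Longrightarrow> (\<integral>r. indicator {0<..<1} r * (c * r\<^sup>2 * (1 - r) powr (k - 3)) * (max 0 (1 - x / r))\<^sup>2 \<partial>lborel) = (max 0 (1 - x)) powr k"
proof -
  define b where "b r = indicator {0<..<1} r * (r\<^sup>2 * (1 - r) powr (k - 3))" for r :: real
  have bm: "b \<in> borel_measurable borel" unfolding b_def by measurable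
  have b01: "0 \<le> b r \<and> b r \<le> indicator {0<..<1} r" for r
  proof (cases "r \<in> {0<..<1}")
    case True
    then have "r\<^sup>2 * (1 - r) powr (k - 3) \<le> 1 * 1"
      using k powr_mono2[of "k - 3" "1 - r" 1] by (intro mult_mono power_le_one) auto
    then show ?thesis using True by (simp add: b_def)
  qed (simp add: b_def)
  have Ib: "integrable lborel b"
    by (rule Bochner_Integration.integrable_bound[of _ "indicator {0<..<1::real} :: real \<Rightarrow> real"])
       (use bm b01 in auto)
  define \<beta> where "\<beta> = (\<integral>r. b r \<partial>lborel)"
  have "\<beta> \<noteq> 0"
  proof
    assume "\<beta> = 0"
    then have "AE r in lborel. b r = 0"
      unfolding \<beta>_def using b01 by (subst (asm) integral_nonneg_eq_0_iff_AE[OF Ib]) auto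
    then have "AE r in lborel. r \<notin> {0<..<1::real}"
      by eventually_elim (auto simp: b_def)
    then have "emeasure lborel {0<..<1::real} = 0"
      by (subst (asm) AE_iff_measurable[of "{0<..<1}"]) auto
    then show False by simp
  qed
  moreover have "0 \<le> \<beta>" unfolding \<beta>_def by (intro integral_nonneg_AE) (use b01 in auto)
  ultimately have \<beta>: "0 < \<beta>" by simp
  show thesis
  proof (rule that[of "1 / \<beta>"])
    show "0 < 1 / \<beta>" using \<beta> by simp
    fix x :: real assume x: "0 \<le> x"
    define f where "f r = indicator {0<..<1} r * (1 / \<beta> * r\<^sup>2 * (1 - r) powr (k - 3)) * (max 0 (1 - x / r))\<^sup>2" for r
    show "(\<integral>r. indicator {0<..<1} r * (1 / \<beta> * r\<^sup>2 * (1 - r) powr (k - 3)) * (max 0 (1 - x / r))\<^sup>2 \<partial>lborel) = (max 0 (1 - x)) powr k"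
    proof (cases "x < 1")
      case True
      have feq: "f (x + (1 - x) * r) = 1 / \<beta> * (1 - x) powr (k - 1) * b r" if "r \<noteq> 0" for r
      proof (cases "r \<in> {0<..<1}")
        case r: True
        define y where "y = x + (1 - x) * r"
        have y1: "1 - y = (1 - x) * (1 - r)" by (simp add: y_def algebra_simps)
        have y2: "y - x = (1 - x) * r" by (simp add: y_def)
        have "0 < (1 - x) * (1 - r)" "0 < (1 - x) * r" using True r by auto
        then have "0 < 1 - y" "0 < y - x" by (simp_all only: y1 y2)
        then have y01: "0 < y" "y < 1" "x < y" using x by simp_all
        have "f y = 1 / \<beta> * (1 - y) powr (k - 3) * (y\<^sup>2 * (1 - x / y)\<^sup>2)"
          using y01 by (simp add: f_def max_def divide_le_eq)
        also have "y\<^sup>2 * (1 - x / y)\<^sup>2 = (y - x)\<^sup>2"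
          using y01 by (simp add: power_mult_distrib[symmetric] right_diff_distrib)
        also have "1 / \<beta> * (1 - y) powr (k - 3) * (y - x)\<^sup>2 = 1 / \<beta> * ((1 - x) powr (k - 3) * (1 - x)\<^sup>2) * (r\<^sup>2 * (1 - r) powr (k - 3))"
          unfolding y1 y2 using True r by (simp add: powr_mult power_mult_distrib mult_ac)
        also have "(1 - x) powr (k - 3) * (1 - x)\<^sup>2 = (1 - x) powr (k - 1)"
          using True by (simp add: powr_numeral[symmetric] powr_add[symmetric] del: powr_numeral)
        finally show ?thesis using r by (simp add: b_def y_def)
      next
        case r: False
        have "f (x + (1 - x) * r) = 0"
        proof (cases "r < 0")
          case r: True
          define y where "y = x + (1 - x) * r"
          have "y \<le> x" using r True by (simp add: y_def mult_nonneg_nonpos)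
          then have "1 - x / y \<le> 0" if "0 < y" using that by (simp add: pos_le_divide_eq)
          then show ?thesis by (auto simp: f_def y_def[symmetric] indicator_def max_def)
        next
          case False
          then have "1 \<le> r" using r that by auto
          then have "(1 - x) * 1 \<le> (1 - x) * r" using True by (intro mult_left_mono) auto
          then have "1 \<le> x + (1 - x) * r" by simp
          then show ?thesis by (simp add: f_def indicator_def)
        qed
        then show ?thesis using r by (simp add: b_def)
      qed
      have [measurable]: "f \<in> borel_measurable borel" unfolding f_def by measurable
      have "(\<integral>r. f (x + (1 - x) * r) \<partial>lborel) = (\<integral>r. 1 / \<beta> * (1 - x) powr (k - 1) * b r \<partial>lborel)"
      proof (rule integral_cong_AE)
        have "AE r in lborel. r \<noteq> (0::real)" using AE_lborel_singleton[of "0::real"] by simp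
        then show "AE r in lborel. f (x + (1 - x) * r) = 1 / \<beta> * (1 - x) powr (k - 1) * b r"
          by eventually_elim (rule feq)
      qed (use bm in measurable)
      also have "\<dots> = (1 - x) powr (k - 1)" using \<beta> by (simp add: \<beta>_def)
      finally have "(\<integral>r. f r \<partial>lborel) = (1 - x) * (1 - x) powr (k - 1)"
        using lborel_integral_real_affine[of "1 - x" f x] True by simp
      also have "\<dots> = (max 0 (1 - x)) powr k"
        using True powr_add[of "1 - x" 1 "k - 1"] by simp
      finally show ?thesis by (simp add: f_def)
    next
      case False
      have "f r = 0" for r
      proof (cases "r \<in> {0<..<1}")
        case True
        then have "1 - x / r \<le> 0" using False by (simp add: pos_le_divide_eq)
        then show ?thesis by (simp add: f_def max_def)
      qed (simp add: f_def)
      then have "(\<integral>r. f r \<partial>lborel) = 0" by simp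
      then show ?thesis using False by (simp only: f_def) simp
    qed
  qed
qed

text \<open>
  A complex measure with density \<open>\<kappa>\<close> and position \<open>X\<close>, of finite total mass and first moment, whose
  Fourier transform on the nonnegative half-line is the Riesz weight. The base space is left general
  because the mixture is most easily built on pairs consisting of a dilation and a point.
\<close>

locale riesz_kernel = sigma_finite_measure M for M :: "'z measure" +
  fixes \<kappa> :: "'z \<Rightarrow> complex" and X :: "'z \<Rightarrow> real" and k :: real
  assumes kernel_integrable: "integrable M \<kappa>"
    and kernel_moment: "integrable M (\<lambda>z. norm (\<kappa> z) * \<bar>X z\<bar>)"
    and X_measurable [measurable]: "X \<in> borel_measurable M"
    and kernel_fourier: "0 \<le> x \<Longrightarrow> (\<integral>z. \<kappa> z * cis (- x * X z) \<partial>M) = of_real ((max 0 (1 - x)) powr k)"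

text \<open>
  A pair \<open>(r, v)\<close> carries the density \<open>w r * spline_kernel v\<close> at the position \<open>v / r\<close>. Dilation enlarges
  the first moment by \<open>1 / r\<close>, which the factor \<open>r^2\<close> in \<open>w\<close> absorbs.
\<close>

lemma riesz_kernel_exists:
  assumes k: "3 < k"
  shows "\<exists>\<kappa> X. riesz_kernel (lborel \<Otimes>\<^sub>M lborel :: (real \<times> real) measure) \<kappa> X k"
proof -
  obtain c where c: "0 < c" and
    mix: "\<And>x. 0 \<le> x \<Longrightarrow> (\<integral>r. indicator {0<..<1} r * (c * r\<^sup>2 * (1 - r) powr (k - 3)) * (max 0 (1 - x / r))\<^sup>2 \<partial>lborel) = (max 0 (1 - x)) powr k"
    using beta_mixture[OF k] by blast
  define w where "w r = indicator {0<..<1} r * (c * r\<^sup>2 * (1 - r) powr (k - 3))" for r :: real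
  have wm [measurable]: "w \<in> borel_measurable borel" unfolding w_def by measurable
  have w0: "0 \<le> w r" for r using c by (simp add: w_def)
  have w1: "w r \<le> c * indicator {0<..<1} r" "w r / \<bar>r\<bar> \<le> c * indicator {0<..<1} r" for r
  proof -
    have "w r \<le> c * indicator {0<..<1} r \<and> w r / \<bar>r\<bar> \<le> c * indicator {0<..<1} r"
    proof (cases "r \<in> {0<..<1}")
      case True
      have p: "(1 - r) powr (k - 3) \<le> 1" using True k powr_mono2[of "k - 3" "1 - r" 1] by auto
      have "r\<^sup>2 * (1 - r) powr (k - 3) \<le> 1 * 1" "r * (1 - r) powr (k - 3) \<le> 1 * 1"
        using p True by (intro mult_mono power_le_one; auto)+
      then have "c * (r\<^sup>2 * (1 - r) powr (k - 3)) \<le> c * 1" "c * (r * (1 - r) powr (k - 3)) \<le> c * 1"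
        using c by (auto intro!: mult_left_mono)
      then show ?thesis using True by (simp add: w_def power2_eq_square mult_ac)
    qed (simp add: w_def)
    then show "w r \<le> c * indicator {0<..<1} r" "w r / \<bar>r\<bar> \<le> c * indicator {0<..<1} r" by auto
  qed
  define \<kappa> where "\<kappa> z = of_real (w (fst z)) * spline_kernel (snd z)" for z :: "real \<times> real"
  define X where "X z = snd z / fst z" for z :: "real \<times> real"
  let ?M = "lborel \<Otimes>\<^sub>M lborel :: (real \<times> real) measure"
  have [measurable]: "\<kappa> \<in> borel_measurable ?M" unfolding \<kappa>_def by measurable
  have Xm [measurable]: "X \<in> borel_measurable ?M" unfolding X_def by measurable
  have [measurable]: "cis \<in> borel_measurable borel"
    by (intro borel_measurable_continuous_onI continuous_intros)
  have fin: "(\<integral>\<^sup>+(r::real). ennreal (c * indicator {0<..<1} r) \<partial>lborel) < \<infinity>"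
  proof -
    have "(\<integral>\<^sup>+(r::real). ennreal (c * indicator {0<..<1} r) \<partial>lborel) = (\<integral>\<^sup>+(r::real). ennreal c * indicator {0<..<1} r \<partial>lborel)"
      by (intro nn_integral_cong) (auto simp: indicator_def)
    also have "\<dots> = ennreal c" by (subst nn_integral_cmult_indicator) auto
    finally show ?thesis by simp
  qed
  have I1: "integrable ?M \<kappa>"
  proof (rule integrableI_bounded)
    have "(\<integral>\<^sup>+z. ennreal (norm (\<kappa> z)) \<partial>?M) = (\<integral>\<^sup>+r. \<integral>\<^sup>+v. ennreal (norm (\<kappa> (r, v))) \<partial>lborel \<partial>lborel)"
      by (subst lborel.nn_integral_fst[symmetric]) auto
    also have "\<dots> = (\<integral>\<^sup>+r. \<integral>\<^sup>+v. ennreal (w r) * ennreal (norm (spline_kernel v)) \<partial>lborel \<partial>lborel)"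
      by (simp add: \<kappa>_def norm_mult w0 ennreal_mult)
    also have "\<dots> = (\<integral>\<^sup>+r. ennreal (w r) \<partial>lborel) * (\<integral>\<^sup>+v. ennreal (norm (spline_kernel v)) \<partial>lborel)"
      by (simp add: nn_integral_cmult nn_integral_multc)
    also have "\<dots> < \<infinity>"
    proof -
      have "(\<integral>\<^sup>+r. ennreal (w r) \<partial>lborel) \<le> (\<integral>\<^sup>+(r::real). ennreal (c * indicator {0<..<1} r) \<partial>lborel)"
        by (intro nn_integral_mono ennreal_leI w1)
      then have "(\<integral>\<^sup>+r. ennreal (w r) \<partial>lborel) < \<infinity>" using fin by (rule le_less_trans)
      moreover have "(\<integral>\<^sup>+v. ennreal (norm (spline_kernel v)) \<partial>lborel) < \<infinity>"
        using spline_kernel_integrable(1) by (simp add: integrable_iff_bounded)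
      ultimately show ?thesis by (simp add: ennreal_mult_less_top)
    qed
    finally show "(\<integral>\<^sup>+z. ennreal (norm (\<kappa> z)) \<partial>?M) < \<infinity>" .
  qed simp
  have I2: "integrable ?M (\<lambda>z. norm (\<kappa> z) * \<bar>X z\<bar>)"
  proof (rule integrableI_bounded)
    have "(\<integral>\<^sup>+z. ennreal (norm (norm (\<kappa> z) * \<bar>X z\<bar>)) \<partial>?M) = (\<integral>\<^sup>+r. \<integral>\<^sup>+v. ennreal (norm (norm (\<kappa> (r, v)) * \<bar>X (r, v)\<bar>)) \<partial>lborel \<partial>lborel)"
      by (subst lborel.nn_integral_fst[symmetric]) auto
    also have "\<dots> = (\<integral>\<^sup>+r. \<integral>\<^sup>+v. ennreal (w r / \<bar>r\<bar>) * ennreal (norm (spline_kernel v) * \<bar>v\<bar>) \<partial>lborel \<partial>lborel)"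
      by (simp add: \<kappa>_def X_def norm_mult w0 ennreal_mult[symmetric] abs_mult mult_ac)
    also have "\<dots> = (\<integral>\<^sup>+r. ennreal (w r / \<bar>r\<bar>) \<partial>lborel) * (\<integral>\<^sup>+v. ennreal (norm (spline_kernel v) * \<bar>v\<bar>) \<partial>lborel)"
      by (simp add: nn_integral_cmult nn_integral_multc)
    also have "\<dots> < \<infinity>"
    proof -
      have "(\<integral>\<^sup>+r. ennreal (w r / \<bar>r\<bar>) \<partial>lborel) \<le> (\<integral>\<^sup>+(r::real). ennreal (c * indicator {0<..<1} r) \<partial>lborel)"
        by (intro nn_integral_mono ennreal_leI w1)
      then have "(\<integral>\<^sup>+r. ennreal (w r / \<bar>r\<bar>) \<partial>lborel) < \<infinity>" using fin by (rule le_less_trans)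
      moreover have "(\<integral>\<^sup>+v. ennreal (norm (spline_kernel v) * \<bar>v\<bar>) \<partial>lborel) < \<infinity>"
        using spline_kernel_integrable(2) by (simp add: integrable_iff_bounded abs_mult)
      ultimately show ?thesis by (simp add: ennreal_mult_less_top)
    qed
    finally show "(\<integral>\<^sup>+z. ennreal (norm (norm (\<kappa> z) * \<bar>X z\<bar>)) \<partial>?M) < \<infinity>" .
  qed simp
  have F: "(\<integral>z. \<kappa> z * cis (- x * X z) \<partial>?M) = of_real ((max 0 (1 - x)) powr k)" if x: "0 \<le> x" for x
  proof -
    have I: "integrable ?M (\<lambda>z. \<kappa> z * cis (- x * X z))"
      by (rule Bochner_Integration.integrable_bound[OF I1]) (auto simp: norm_mult)
    have "(\<integral>z. \<kappa> z * cis (- x * X z) \<partial>?M) = (\<integral>r. \<integral>v. \<kappa> (r, v) * cis (- x * X (r, v)) \<partial>lborel \<partial>lborel)"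
      using lborel_pair.integral_fst'[OF I] by simp
    also have "\<dots> = (\<integral>r. complex_of_real (w r * (max 0 (1 - x / r))\<^sup>2) \<partial>lborel)"
    proof (rule Bochner_Integration.integral_cong[OF refl])
      fix r :: real
      show "(\<integral>v. \<kappa> (r, v) * cis (- x * X (r, v)) \<partial>lborel) = of_real (w r * (max 0 (1 - x / r))\<^sup>2)"
      proof (cases "r \<in> {0<..<1}")
        case True
        have "(\<integral>v. \<kappa> (r, v) * cis (- x * X (r, v)) \<partial>lborel) = (\<integral>v. of_real (w r) * (spline_kernel v * cis (- (x / r) * v)) \<partial>lborel)"
          by (simp add: \<kappa>_def X_def mult.assoc)
        also have "\<dots> = of_real (w r) * of_real ((max 0 (1 - x / r))\<^sup>2)"
          using True x by (subst integral_mult_right_zero, subst spline_kernel_fourier) auto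
        finally show ?thesis by simp
      qed (simp add: \<kappa>_def w_def)
    qed
    also have "\<dots> = of_real (\<integral>r. w r * (max 0 (1 - x / r))\<^sup>2 \<partial>lborel)"
      by (rule integral_complex_of_real)
    also have "(\<integral>r. w r * (max 0 (1 - x / r))\<^sup>2 \<partial>lborel) = (max 0 (1 - x)) powr k"
      unfolding w_def by (rule mix[OF x])
    finally show ?thesis .
  qed
  have "sigma_finite_measure ?M" by (rule lborel_pair.sigma_finite_measure_axioms)
  then have "riesz_kernel ?M \<kappa> X k"
    using I1 I2 Xm F by (simp add: riesz_kernel_def riesz_kernel_axioms_def)
  then show ?thesis by blast
qed

section \<open>Growth and increments on vertical lines\<close>

lemma line_deriv_mean:
  assumes g: "line_bounded g C" and r: "0 < r" "r < \<sigma>" and T: "1 \<le> T"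
  shows "(\<integral>\<^sup>+t. ennreal (norm (deriv g (Complex \<sigma> t))) * indicator {-T..T} t \<partial>lborel) \<le> ennreal (1 / r * (2 * (T + r) * C))"
proof -
  note m [measurable] = circle_mean_measurable[OF g r]
  have "(\<integral>\<^sup>+t. ennreal (norm (deriv g (Complex \<sigma> t))) * indicator {-T..T} t \<partial>lborel)
    \<le> (\<integral>\<^sup>+t. ennreal (1 / r) * (ennreal (integral {0..1} (\<lambda>x. norm (g (Complex \<sigma> t + circ r x)))) * indicator {-T..T} t) \<partial>lborel)"
  proof (rule nn_integral_mono)
    fix t
    have "cball (Complex \<sigma> t) r \<subseteq> half_plane 0" using r by (intro cball_subset_half_plane) auto
    then have "norm (deriv g (Complex \<sigma> t)) \<le> 1 / r * integral {0..1} (\<lambda>x. norm (g (Complex \<sigma> t + circ r x)))"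
      using line_boundedD(3)[OF g] r by (intro deriv_circle_bound) (auto elim!: holomorphic_on_subset)
    then have "ennreal (norm (deriv g (Complex \<sigma> t))) \<le> ennreal (1 / r) * ennreal (integral {0..1} (\<lambda>x. norm (g (Complex \<sigma> t + circ r x))))"
      using r by (subst ennreal_mult'[symmetric]) (auto intro: ennreal_leI)
    then show "ennreal (norm (deriv g (Complex \<sigma> t))) * indicator {-T..T} t \<le>
      ennreal (1 / r) * (ennreal (integral {0..1} (\<lambda>x. norm (g (Complex \<sigma> t + circ r x)))) * indicator {-T..T} t)"
      by (auto simp: indicator_def)
  qed
  also have "\<dots> = ennreal (1 / r) * (\<integral>\<^sup>+t. ennreal (integral {0..1} (\<lambda>x. norm (g (Complex \<sigma> t + circ r x)))) * indicator {-T..T} t \<partial>lborel)"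
    by (rule nn_integral_cmult) measurable
  also have "\<dots> \<le> ennreal (1 / r) * ennreal (2 * (T + r) * C)"
    by (intro mult_left_mono line_bounded_circle_mean[OF g r T]) auto
  also have "\<dots> = ennreal (1 / r * (2 * (T + r) * C))"
    using r T line_boundedD(1)[OF g] by (intro ennreal_mult[symmetric]) auto
  finally show ?thesis .
qed

lemma vertical_increment_le:
  assumes g: "g holomorphic_on half_plane 0" and \<sigma>: "0 < \<sigma>" and ab: "a \<le> b"
  shows "ennreal (norm (g (Complex \<sigma> b) - g (Complex \<sigma> a))) \<le>
    (\<integral>\<^sup>+t. ennreal (norm (deriv g (Complex \<sigma> t))) * indicator {a..b} t \<partial>lborel)"
proof -
  have g': "deriv g holomorphic_on half_plane 0" by (intro holomorphic_deriv g) simp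
  have c: "continuous_on {a..b} (\<lambda>t. norm (deriv g (Complex \<sigma> t)))"
    by (intro continuous_intros line_continuous g' \<sigma>)
  have "((\<lambda>t. g (Complex \<sigma> t)) has_vector_derivative \<i> * deriv g (Complex \<sigma> t)) (at t within {a..b})" for t
  proof -
    have "(Complex \<sigma> has_vector_derivative \<i>) (at t)"
      unfolding Complex_eq by (auto intro!: derivative_eq_intros)
    moreover have "(g has_field_derivative deriv g (Complex \<sigma> t)) (at (Complex \<sigma> t))"
      using g \<sigma> by (intro holomorphic_derivI[of _ "half_plane 0"]) (auto simp: half_plane_def[of 0, symmetric], simp add: half_plane_def)
    ultimately have "((g \<circ> Complex \<sigma>) has_vector_derivative \<i> * deriv g (Complex \<sigma> t)) (at t)"
      by (rule field_vector_diff_chain_at)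
    then show ?thesis by (simp add: o_def has_vector_derivative_at_within)
  qed
  then have "((\<lambda>t. \<i> * deriv g (Complex \<sigma> t)) has_integral (g (Complex \<sigma> b) - g (Complex \<sigma> a))) {a..b}"
    using ab by (intro fundamental_theorem_of_calculus) auto
  then have "norm (g (Complex \<sigma> b) - g (Complex \<sigma> a)) \<le> integral {a..b} (\<lambda>t. norm (deriv g (Complex \<sigma> t)))"
  proof (subst integral_unique[symmetric], assumption, intro integral_norm_bound_integral)
    show "(\<lambda>t. norm (deriv g (Complex \<sigma> t))) integrable_on {a..b}" by (rule integrable_continuous_real[OF c])
  qed (auto simp: norm_mult)
  moreover have "(\<integral>\<^sup>+t. indicator {a..b} t * norm (deriv g (Complex \<sigma> t)) \<partial>lborel) = ennreal (integral {a..b} (\<lambda>t. norm (deriv g (Complex \<sigma> t))))"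
    by (intro nn_integral_has_integral_lebesgue integrable_integral integrable_continuous_real c) auto
  ultimately show ?thesis
    by (simp add: ennreal_mult' ennreal_indicator mult.commute ennreal_leI)
qed

text \<open>
  Pointwise growth is at most linear in the height, since the integral of \<open>|g'|\<close> over a vertical segment
  grows linearly with its length. Functions of this size are integrable against a kernel
  with finite first moment.
\<close>

lemma line_growth:
  assumes g: "line_bounded g C" and \<alpha>: "0 < \<alpha>" "\<alpha> \<le> \<sigma>"
  shows "norm (g (Complex \<sigma> y)) \<le> norm (g (Complex \<sigma> 0)) + 2 / \<alpha> * (2 * (1 + \<bar>y\<bar> + \<alpha> / 2) * C)"
proof -
  have gh: "g holomorphic_on half_plane 0" by (rule line_boundedD(3)[OF g])
  define T where "T = 1 + \<bar>y\<bar>"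
  have "ennreal (norm (g (Complex \<sigma> (max 0 y)) - g (Complex \<sigma> (min 0 y)))) \<le>
    (\<integral>\<^sup>+t. ennreal (norm (deriv g (Complex \<sigma> t))) * indicator {min 0 y..max 0 y} t \<partial>lborel)"
    using \<alpha> by (intro vertical_increment_le[OF gh]) auto
  also have "\<dots> \<le> (\<integral>\<^sup>+t. ennreal (norm (deriv g (Complex \<sigma> t))) * indicator {-T..T} t \<partial>lborel)"
    by (intro nn_integral_mono mult_left_mono) (auto simp: indicator_def T_def)
  also have "\<dots> \<le> ennreal (1 / (\<alpha> / 2) * (2 * (T + \<alpha> / 2) * C))"
    using \<alpha> by (intro line_deriv_mean[OF g]) (auto simp: T_def)
  finally have "norm (g (Complex \<sigma> (max 0 y)) - g (Complex \<sigma> (min 0 y))) \<le> 2 / \<alpha> * (2 * (T + \<alpha> / 2) * C)"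
    using \<alpha> line_boundedD(1)[OF g] by (subst (asm) ennreal_le_iff) (auto simp: T_def)
  moreover have "norm (g (Complex \<sigma> (max 0 y)) - g (Complex \<sigma> (min 0 y))) = norm (g (Complex \<sigma> y) - g (Complex \<sigma> 0))"
    by (cases "0 \<le> y") (auto simp: norm_minus_commute)
  moreover have "norm (g (Complex \<sigma> y)) \<le> norm (g (Complex \<sigma> 0)) + norm (g (Complex \<sigma> y) - g (Complex \<sigma> 0))"
    by (metis norm_triangle_sub)
  ultimately show ?thesis by (simp add: T_def)
qed

lemma local_growth:
  assumes g: "line_bounded g C" and d: "0 < d" "d < Re s0"
  obtains A where "0 \<le> A" "\<And>s y. s \<in> cball s0 d \<Longrightarrow> norm (g (s + \<i> * of_real y)) \<le> A * (1 + \<bar>y\<bar>)"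
proof -
  define \<alpha> where "\<alpha> = Re s0 - d"
  have \<alpha>: "0 < \<alpha>" using d by (simp add: \<alpha>_def)
  have gh: "g holomorphic_on half_plane 0" and C: "0 \<le> C" using line_boundedD[OF g] by auto
  have "continuous_on {\<alpha>..Re s0 + d} (\<lambda>\<sigma>. g (Complex \<sigma> 0))"
    by (rule continuous_on_compose2[OF holomorphic_on_imp_continuous_on[OF gh]])
       (use \<alpha> in \<open>auto intro!: continuous_on_Complex continuous_intros simp: half_plane_def\<close>)
  then have "compact ((\<lambda>\<sigma>. g (Complex \<sigma> 0)) ` {\<alpha>..Re s0 + d})" by (intro compact_continuous_image) auto
  then have "bounded ((\<lambda>\<sigma>. g (Complex \<sigma> 0)) ` {\<alpha>..Re s0 + d})" by (rule compact_imp_bounded)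
  then obtain B where B: "0 < B" "\<And>\<sigma>. \<sigma> \<in> {\<alpha>..Re s0 + d} \<Longrightarrow> norm (g (Complex \<sigma> 0)) \<le> B"
    unfolding bounded_pos by blast
  define E where "E = 2 / \<alpha> * (2 * C)"
  have E: "0 \<le> E" using \<alpha> C by (simp add: E_def)
  define A where "A = B + E * (1 + \<bar>Im s0\<bar> + d + \<alpha> / 2)"
  show thesis
  proof (rule that[of A])
    show "0 \<le> A" using B E d \<alpha> by (auto simp: A_def intro!: add_nonneg_nonneg mult_nonneg_nonneg)
    fix s y assume s: "s \<in> cball s0 d"
    have re: "\<bar>Re s - Re s0\<bar> \<le> d" and im: "\<bar>Im s - Im s0\<bar> \<le> d"
      using s abs_Re_le_cmod[of "s - s0"] abs_Im_le_cmod[of "s - s0"] by (auto simp: dist_norm norm_minus_commute)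
    have "s + \<i> * of_real y = Complex (Re s) (Im s + y)" by (simp add: complex_eq_iff)
    then have "norm (g (s + \<i> * of_real y)) \<le> norm (g (Complex (Re s) 0)) + 2 / \<alpha> * (2 * (1 + \<bar>Im s + y\<bar> + \<alpha> / 2) * C)"
      using re line_growth[OF g \<alpha>, of "Re s" "Im s + y"] by (simp add: \<alpha>_def)
    also have "\<dots> = norm (g (Complex (Re s) 0)) + E * (1 + \<bar>Im s + y\<bar> + \<alpha> / 2)" by (simp add: E_def)
    also have "\<dots> \<le> B + E * (1 + \<bar>Im s0\<bar> + d + \<alpha> / 2 + \<bar>y\<bar>)"
    proof (rule add_mono)
      show "norm (g (Complex (Re s) 0)) \<le> B" using re by (intro B(2)) (simp add: \<alpha>_def abs_le_iff)
      have "\<bar>Im s + y\<bar> \<le> \<bar>Im s0\<bar> + d + \<bar>y\<bar>" using im by linarith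
      then show "E * (1 + \<bar>Im s + y\<bar> + \<alpha> / 2) \<le> E * (1 + \<bar>Im s0\<bar> + d + \<alpha> / 2 + \<bar>y\<bar>)"
        using E by (intro mult_left_mono) auto
    qed
    also have "\<dots> = A + E * \<bar>y\<bar>" by (simp add: A_def algebra_simps)
    also have "\<dots> \<le> A + A * \<bar>y\<bar>"
    proof -
      have "E * 1 \<le> E * (1 + \<bar>Im s0\<bar> + d + \<alpha> / 2)" using E d \<alpha> by (intro mult_left_mono) auto
      then have "E \<le> A" using B by (simp add: A_def)
      then show ?thesis by (simp add: mult_right_mono)
    qed
    finally show "norm (g (s + \<i> * of_real y)) \<le> A * (1 + \<bar>y\<bar>)" by (simp add: distrib_left)
  qed
qed

text \<open>
  For \<open>|u| \<le> 1\<close> the increment is an integral of \<open>g'\<close>, and Fubini's theorem gives the factor \<open>|u|\<close>; for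
  larger \<open>u\<close> the triangle inequality suffices. The linear bound in \<open>|u|\<close> matches the first moment of
  the kernel.
\<close>

lemma increment_mean:
  assumes g: "line_bounded g C" and \<alpha>: "0 < \<alpha>" "\<alpha> \<le> \<sigma>" and T: "1 \<le> T"
  shows "(\<integral>\<^sup>+t. ennreal (norm (g (Complex \<sigma> (t + u)) - g (Complex \<sigma> t))) * indicator {-T..T} t \<partial>lborel)
    \<le> ennreal (2 * T * ((2 / \<alpha> * (2 + \<alpha> / 2) + 3) * C * \<bar>u\<bar>))"
proof -
  note C = line_boundedD(1)[OF g] and [measurable] = line_boundedD(2)[OF g]
  have gh: "g holomorphic_on half_plane 0" by (rule line_boundedD(3)[OF g])
  have \<sigma>: "0 < \<sigma>" using \<alpha> by simp
  show ?thesis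
  proof (cases "\<bar>u\<bar> \<le> 1")
    case True
    define h where "h t = ennreal (norm (deriv g (Complex \<sigma> t)))" for t
    have "deriv g holomorphic_on half_plane 0" by (intro holomorphic_deriv gh) simp
    then have "(\<lambda>t. deriv g (Complex \<sigma> t)) \<in> borel_measurable borel"
      by (intro borel_measurable_continuous_onI line_continuous \<sigma>)
    then have [measurable]: "h \<in> borel_measurable borel" unfolding h_def by measurable
    have meas2: "(\<lambda>(\<tau>, t). h \<tau> * indicator {min t (t+u)..max t (t+u)} \<tau> * indicator {-T..T} t) \<in> borel_measurable (lborel \<Otimes>\<^sub>M lborel)"
    proof -
      have "(\<lambda>(\<tau>, t). h \<tau> * (if min t (t+u) \<le> \<tau> \<and> \<tau> \<le> max t (t+u) then 1 else 0) * indicator {-T..T} t) \<in> borel_measurable (lborel \<Otimes>\<^sub>M lborel)"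
        by measurable
      then show ?thesis by (simp add: indicator_def of_bool_def)
    qed
    have "(\<integral>\<^sup>+t. ennreal (norm (g (Complex \<sigma> (t + u)) - g (Complex \<sigma> t))) * indicator {-T..T} t \<partial>lborel)
      \<le> (\<integral>\<^sup>+t. \<integral>\<^sup>+\<tau>. h \<tau> * indicator {min t (t+u)..max t (t+u)} \<tau> * indicator {-T..T} t \<partial>lborel \<partial>lborel)"
    proof (rule nn_integral_mono)
      fix t
      have "ennreal (norm (g (Complex \<sigma> (t + u)) - g (Complex \<sigma> t))) \<le> (\<integral>\<^sup>+\<tau>. h \<tau> * indicator {min t (t+u)..max t (t+u)} \<tau> \<partial>lborel)"
        using vertical_increment_le[OF gh \<sigma>, of "min t (t+u)" "max t (t+u)"]
        by (cases "0 \<le> u") (auto simp: h_def norm_minus_commute)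
      then show "ennreal (norm (g (Complex \<sigma> (t + u)) - g (Complex \<sigma> t))) * indicator {-T..T} t
        \<le> (\<integral>\<^sup>+\<tau>. h \<tau> * indicator {min t (t+u)..max t (t+u)} \<tau> * indicator {-T..T} t \<partial>lborel)"
        by (subst nn_integral_multc) (auto intro: mult_right_mono)
    qed
    also have "\<dots> = (\<integral>\<^sup>+\<tau>. \<integral>\<^sup>+t. h \<tau> * indicator {min t (t+u)..max t (t+u)} \<tau> * indicator {-T..T} t \<partial>lborel \<partial>lborel)"
      by (rule lborel_pair.Fubini'[OF meas2])
    also have "\<dots> \<le> (\<integral>\<^sup>+\<tau>. \<integral>\<^sup>+t. h \<tau> * indicator {-(T+1)..T+1} \<tau> * indicator {min \<tau> (\<tau>-u)..max \<tau> (\<tau>-u)} t \<partial>lborel \<partial>lborel)"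
    proof (intro nn_integral_mono)
      fix \<tau> t :: real
      have "t \<in> {min \<tau> (\<tau>-u)..max \<tau> (\<tau>-u)} \<and> \<tau> \<in> {-(T+1)..T+1}" if "\<tau> \<in> {min t (t+u)..max t (t+u)}" "t \<in> {-T..T}"
      proof (cases "0 \<le> u")
        case u: True
        then have "min t (t+u) = t" "max t (t+u) = t+u" "min \<tau> (\<tau>-u) = \<tau>-u" "max \<tau> (\<tau>-u) = \<tau>" by auto
        then show ?thesis using that u True by auto
      next
        case u: False
        then have "min t (t+u) = t+u" "max t (t+u) = t" "min \<tau> (\<tau>-u) = \<tau>" "max \<tau> (\<tau>-u) = \<tau>-u" by auto
        then show ?thesis using that u True by auto
      qed
      then show "h \<tau> * indicator {min t (t+u)..max t (t+u)} \<tau> * indicator {-T..T} t \<le> h \<tau> * indicator {-(T+1)..T+1} \<tau> * indicator {min \<tau> (\<tau>-u)..max \<tau> (\<tau>-u)} t"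
        by (cases "\<tau> \<in> {min t (t+u)..max t (t+u)} \<and> t \<in> {-T..T}") (auto simp del: atLeastAtMost_iff)
    qed
    also have "\<dots> = (\<integral>\<^sup>+\<tau>. h \<tau> * indicator {-(T+1)..T+1} \<tau> * ennreal \<bar>u\<bar> \<partial>lborel)"
    proof (intro nn_integral_cong)
      fix \<tau> :: real
      have "emeasure lborel {min \<tau> (\<tau>-u)..max \<tau> (\<tau>-u)} = ennreal \<bar>u\<bar>" by (cases "0 \<le> u") auto
      then show "(\<integral>\<^sup>+t. h \<tau> * indicator {-(T+1)..T+1} \<tau> * indicator {min \<tau> (\<tau>-u)..max \<tau> (\<tau>-u)} t \<partial>lborel) = h \<tau> * indicator {-(T+1)..T+1} \<tau> * ennreal \<bar>u\<bar>"
        by (subst nn_integral_cmult_indicator) auto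
    qed
    also have "\<dots> = (\<integral>\<^sup>+\<tau>. h \<tau> * indicator {-(T+1)..T+1} \<tau> \<partial>lborel) * ennreal \<bar>u\<bar>"
      by (rule nn_integral_multc) measurable
    also have "\<dots> \<le> ennreal (1 / (\<alpha> / 2) * (2 * (T + 1 + \<alpha> / 2) * C)) * ennreal \<bar>u\<bar>"
      unfolding h_def using \<alpha> T by (intro mult_right_mono line_deriv_mean[OF g]) auto
    also have "\<dots> = ennreal (1 / (\<alpha> / 2) * (2 * (T + 1 + \<alpha> / 2) * C) * \<bar>u\<bar>)"
      using \<alpha> T C by (intro ennreal_mult[symmetric]) auto
    also have "\<dots> \<le> ennreal (2 * T * ((2 / \<alpha> * (2 + \<alpha> / 2) + 3) * C * \<bar>u\<bar>))"
    proof (rule ennreal_leI)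
      have "1 * (\<alpha> / 2) \<le> T * (\<alpha> / 2)" using T \<alpha> by (intro mult_right_mono) auto
      then have "T + 1 + \<alpha> / 2 \<le> T * (2 + \<alpha> / 2)" unfolding distrib_left using T by linarith
      then have "2 / \<alpha> * 2 * C * \<bar>u\<bar> * (T + 1 + \<alpha> / 2) \<le> 2 / \<alpha> * 2 * C * \<bar>u\<bar> * (T * (2 + \<alpha> / 2))"
        using \<alpha> C by (intro mult_left_mono) auto
      moreover have "0 \<le> 2 * T * (3 * C * \<bar>u\<bar>)" using T C by simp
      moreover have "1 / (\<alpha> / 2) * (2 * (T + 1 + \<alpha> / 2) * C) * \<bar>u\<bar> = 2 / \<alpha> * 2 * C * \<bar>u\<bar> * (T + 1 + \<alpha> / 2)"
        by simp
      moreover have "2 * T * ((2 / \<alpha> * w + 3) * C * \<bar>u\<bar>) = 2 / \<alpha> * 2 * C * \<bar>u\<bar> * (T * w) + 2 * T * (3 * C * \<bar>u\<bar>)" for w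
        by (simp add: divide_inverse algebra_simps)
      ultimately show "1 / (\<alpha> / 2) * (2 * (T + 1 + \<alpha> / 2) * C) * \<bar>u\<bar> \<le> 2 * T * ((2 / \<alpha> * (2 + \<alpha> / 2) + 3) * C * \<bar>u\<bar>)"
        by (simp only:)
    qed
    finally show ?thesis .
  next
    case False
    have "(\<integral>\<^sup>+t. ennreal (norm (g (Complex \<sigma> (t + u)) - g (Complex \<sigma> t))) * indicator {-T..T} t \<partial>lborel)
      \<le> (\<integral>\<^sup>+t. ennreal (norm (g (Complex \<sigma> (t + u)))) * indicator {-T..T} t + ennreal (norm (g (Complex \<sigma> t))) * indicator {-T..T} t \<partial>lborel)"
      unfolding distrib_right[symmetric]
      by (intro nn_integral_mono mult_right_mono) (auto simp flip: ennreal_plus intro!: ennreal_leI norm_triangle_ineq4)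
    also have "\<dots> = (\<integral>\<^sup>+t. ennreal (norm (g (Complex \<sigma> (t + u)))) * indicator {-T..T} t \<partial>lborel) + (\<integral>\<^sup>+t. ennreal (norm (g (Complex \<sigma> t))) * indicator {-T..T} t \<partial>lborel)"
      by (intro nn_integral_add) auto
    also have "\<dots> \<le> ennreal (2 * (T + \<bar>u\<bar>) * C) + ennreal (2 * T * C)"
      by (intro add_mono line_bounded_shift[OF g \<sigma> T] line_boundedD(4)[OF g \<sigma> T])
    also have "\<dots> = ennreal (2 * (T + \<bar>u\<bar>) * C + 2 * T * C)" using T C by (intro ennreal_plus[symmetric]) auto
    also have "\<dots> \<le> ennreal (2 * T * ((2 / \<alpha> * (2 + \<alpha> / 2) + 3) * C * \<bar>u\<bar>))"
    proof (rule ennreal_leI)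
      have u: "1 \<le> \<bar>u\<bar>" using False by simp
      have "T * 1 \<le> T * \<bar>u\<bar>" "1 * \<bar>u\<bar> \<le> T * \<bar>u\<bar>" using u T by (intro mult_left_mono mult_right_mono; simp)+
      then have "(T + \<bar>u\<bar> + T) * (2 * C) \<le> (3 * (T * \<bar>u\<bar>)) * (2 * C)" using C by (intro mult_right_mono) auto
      moreover have "0 \<le> 2 * T * (2 / \<alpha> * (2 + \<alpha> / 2) * C * \<bar>u\<bar>)" using T C \<alpha> by simp
      moreover have "2 * T * ((2 / \<alpha> * (2 + \<alpha> / 2) + 3) * C * \<bar>u\<bar>) = 2 * T * (2 / \<alpha> * (2 + \<alpha> / 2) * C * \<bar>u\<bar>) + (3 * (T * \<bar>u\<bar>)) * (2 * C)"
        by (simp add: distrib_left distrib_right)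
      moreover have "2 * (T + \<bar>u\<bar>) * C + 2 * T * C = (T + \<bar>u\<bar> + T) * (2 * C)" by (simp add: algebra_simps)
      ultimately show "2 * (T + \<bar>u\<bar>) * C + 2 * T * C \<le> 2 * T * ((2 / \<alpha> * (2 + \<alpha> / 2) + 3) * C * \<bar>u\<bar>)"
        by linarith
    qed
    finally show ?thesis .
  qed
qed

section \<open>Riesz means as vertical averages\<close>

lemma of_nat_powr_vertical:
  assumes "1 \<le> n"
  shows "of_nat n powr (- (s + \<i> * of_real y)) = of_nat n powr (- s) * cis (- ln (real n) * y)"
proof -
  have "s + \<i> * of_real y = Complex (Re s) (Im s + y)" by (simp add: complex_eq_iff)
  moreover have "of_nat n powr (- s) = of_nat n powr (- Complex (Re s) (Im s))" by simp
  ultimately show ?thesis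
    using assms by (simp only: powr_Complex) (simp add: cis_mult distrib_left add.commute)
qed

context riesz_kernel
begin

text \<open>
  The vertical average of \<open>f\<close> against the kernel at scale \<open>1 / L\<close>; for Riesz means \<open>L = log N\<close>.
\<close>

definition smooth :: "real \<Rightarrow> (complex \<Rightarrow> complex) \<Rightarrow> complex \<Rightarrow> complex" where
  "smooth L f s = (\<integral>z. \<kappa> z * f (s + \<i> * of_real (X z / L)) \<partial>M)"

lemma kernel_measurable [measurable]: "\<kappa> \<in> borel_measurable M"
  using kernel_integrable by (rule borel_measurable_integrable)

lemma weight_integrable: "integrable M (\<lambda>z. norm (\<kappa> z) * (A * (1 + \<bar>X z / L\<bar>)))"
proof -
  have "integrable M (\<lambda>z. A * norm (\<kappa> z) + A / \<bar>L\<bar> * (norm (\<kappa> z) * \<bar>X z\<bar>))"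
    by (intro Bochner_Integration.integrable_add integrable_mult_right integrable_norm kernel_integrable kernel_moment)
  then show ?thesis by (simp add: distrib_left mult_ac)
qed

lemma vertical_measurable:
  assumes "g holomorphic_on half_plane 0" "0 < Re s"
  shows "(\<lambda>z. g (s + \<i> * of_real (X z / L))) \<in> borel_measurable M"
proof -
  have "(\<lambda>t. g (Complex (Re s) t)) \<in> borel_measurable borel"
    by (intro borel_measurable_continuous_onI line_continuous assms)
  moreover have "(\<lambda>z. Im s + X z / L) \<in> borel_measurable M" by measurable
  ultimately have "(\<lambda>z. g (Complex (Re s) (Im s + X z / L))) \<in> borel_measurable M"
    by (rule measurable_compose[rotated])
  moreover have "Complex (Re s) (Im s + y) = s + \<i> * of_real y" for y by (simp add: complex_eq_iff)
  ultimately show ?thesis by simp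
qed

lemma smooth_integrable:
  assumes g: "line_bounded g C" and s: "0 < Re s"
  shows "integrable M (\<lambda>z. \<kappa> z * g (s + \<i> * of_real (X z / L)))"
proof -
  obtain A where A: "0 \<le> A" "\<And>s' y. s' \<in> cball s (Re s / 2) \<Longrightarrow> norm (g (s' + \<i> * of_real y)) \<le> A * (1 + \<bar>y\<bar>)"
    using local_growth[OF g, of "Re s / 2" s] s by auto
  show ?thesis
  proof (rule Bochner_Integration.integrable_bound[OF weight_integrable[of A L]])
    have "norm (\<kappa> z * g (s + \<i> * of_real (X z / L))) \<le> norm (norm (\<kappa> z) * (A * (1 + \<bar>X z / L\<bar>)))" for z
    proof -
      have "norm (\<kappa> z * g (s + \<i> * of_real (X z / L))) \<le> norm (\<kappa> z) * (A * (1 + \<bar>X z / L\<bar>))"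
        unfolding norm_mult using s by (intro mult_left_mono A(2)) auto
      then show ?thesis by simp
    qed
    then show "AE z in M. norm (\<kappa> z * g (s + \<i> * of_real (X z / L))) \<le> norm (norm (\<kappa> z) * (A * (1 + \<bar>X z / L\<bar>)))"
      by simp
    show "(\<lambda>z. \<kappa> z * g (s + \<i> * of_real (X z / L))) \<in> borel_measurable M"
      using vertical_measurable[OF line_boundedD(3)[OF g] s] by measurable
  qed
qed

text \<open>
  Differentiation under the integral by dominated convergence: near \<open>s0\<close> the difference quotients grow
  at most linearly in the height, by Cauchy's inequality for \<open>g'\<close>.
\<close>

lemma smooth_holomorphic:
  assumes g: "line_bounded g C"
  shows "smooth L g holomorphic_on half_plane 0"
proof -
  have gh: "g holomorphic_on half_plane 0" by (rule line_boundedD(3)[OF g])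
  have g'h: "deriv g holomorphic_on half_plane 0" by (intro holomorphic_deriv gh) simp
  have "\<exists>D. (smooth L g has_field_derivative D) (at s0)" if "s0 \<in> half_plane 0" for s0
  proof -
    have s0: "0 < Re s0" using that by (simp add: half_plane_def)
    define d where "d = Re s0 / 4"
    have d: "0 < d" "2 * d < Re s0" using s0 by (auto simp: d_def)
    obtain A where A: "0 \<le> A" "\<And>s y. s \<in> cball s0 (2 * d) \<Longrightarrow> norm (g (s + \<i> * of_real y)) \<le> A * (1 + \<bar>y\<bar>)"
      using local_growth[OF g, of "2 * d" s0] d by auto
    define B where "B = A / d"
    have B: "0 \<le> B" using A d by (simp add: B_def)
    have pos: "0 < Re s" if "s \<in> cball s0 (2 * d)" for s
      using that d abs_Re_le_cmod[of "s0 - s"] by (auto simp: dist_norm)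
    have g': "norm (deriv g (s + \<i> * of_real y)) \<le> B * (1 + \<bar>y\<bar>)" if s: "s \<in> cball s0 d" for s y
    proof -
      have sub: "w - \<i> * of_real y \<in> cball s0 (2 * d)" if "dist (s + \<i> * of_real y) w \<le> d" for w
        using that s norm_triangle_ineq[of "s0 - s" "s + \<i> * of_real y - w"]
        by (simp add: dist_norm) (simp add: algebra_simps)
      have "cball (s + \<i> * of_real y) d \<subseteq> half_plane 0"
        using pos sub by (force simp: half_plane_def)
      then have hc: "g holomorphic_on cball (s + \<i> * of_real y) d" by (rule holomorphic_on_subset[OF gh])
      then have "norm ((deriv ^^ 1) g (s + \<i> * of_real y)) \<le> fact 1 * (A * (1 + \<bar>y\<bar>)) / d ^ 1"
      proof (intro Cauchy_inequality)
        fix w assume "norm (s + \<i> * of_real y - w) = d"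
        then have "w - \<i> * of_real y \<in> cball s0 (2 * d)" by (intro sub) (simp add: dist_norm)
        from A(2)[OF this, of y] show "norm (g w) \<le> A * (1 + \<bar>y\<bar>)" by simp
      qed (use d hc holomorphic_on_subset[OF hc ball_subset_cball] in \<open>auto intro: holomorphic_on_imp_continuous_on\<close>)
      then show ?thesis by (simp add: B_def)
    qed
    have lip: "norm (g (s + \<i> * of_real y) - g (s0 + \<i> * of_real y)) \<le> B * (1 + \<bar>y\<bar>) * norm (s - s0)"
      if s: "s \<in> cball s0 d" for s y
    proof -
      have "norm (g (s + \<i> * of_real y) - g (s0 + \<i> * of_real y)) \<le> B * (1 + \<bar>y\<bar>) * norm (s + \<i> * of_real y - (s0 + \<i> * of_real y))"
      proof (rule field_differentiable_bound[where S = "cball (s0 + \<i> * of_real y) d" and f' = "deriv g"])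
        fix w assume w: "w \<in> cball (s0 + \<i> * of_real y) d"
        then have w': "w - \<i> * of_real y \<in> cball s0 d" by (simp add: dist_norm algebra_simps)
        from g'[OF this, of y] show "norm (deriv g w) \<le> B * (1 + \<bar>y\<bar>)" by simp
        have "w - \<i> * of_real y \<in> cball s0 (2 * d)" using w' d by auto
        from pos[OF this] have "w \<in> half_plane 0" by (simp add: half_plane_def)
        then show "(g has_field_derivative deriv g w) (at w within cball (s0 + \<i> * of_real y) d)"
          using holomorphic_derivI[OF gh open_half_plane] by blast
      qed (use s d in \<open>auto simp: dist_norm\<close>)
      then show ?thesis by simp
    qed
    define D where "D = (\<integral>z. \<kappa> z * deriv g (s0 + \<i> * of_real (X z / L)) \<partial>M)"
    have "((\<lambda>s. (smooth L g s - smooth L g s0) / (s - s0)) \<longlongrightarrow> D) (at s0)"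
      unfolding tendsto_at_iff_sequentially o_def
    proof (intro allI impI)
      fix Y :: "nat \<Rightarrow> complex" assume Y: "\<forall>i. Y i \<in> UNIV - {s0}" "Y \<longlonglongrightarrow> s0"
      then have "\<forall>\<^sub>F i in sequentially. dist (Y i) s0 < d" using d by (intro tendstoD) auto
      then obtain n0 where n0: "\<And>i. n0 \<le> i \<Longrightarrow> dist (Y i) s0 < d" by (auto simp: eventually_sequentially)
      define y where "y i = Y (i + n0)" for i
      have y: "y i \<in> cball s0 d" "y i \<noteq> s0" "0 < Re (y i)" for i
      proof -
        show 1: "y i \<in> cball s0 d" using n0[of "i + n0"] by (simp add: y_def dist_commute)
        show "y i \<noteq> s0" using Y by (simp add: y_def)
        show "0 < Re (y i)" using 1 d by (intro pos) auto
      qed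
      have ylim: "y \<longlonglongrightarrow> s0" unfolding y_def using Y(2) by (rule LIMSEQ_ignore_initial_segment)
      define q where "q i z = \<kappa> z * ((g (y i + \<i> * of_real (X z / L)) - g (s0 + \<i> * of_real (X z / L))) / (y i - s0))" for i z
      have "(\<lambda>i. \<integral>z. q i z \<partial>M) \<longlonglongrightarrow> D"
        unfolding D_def
      proof (rule integral_dominated_convergence[where w = "\<lambda>z. norm (\<kappa> z) * (B * (1 + \<bar>X z / L\<bar>))"])
        show "(\<lambda>z. \<kappa> z * deriv g (s0 + \<i> * of_real (X z / L))) \<in> borel_measurable M"
          using vertical_measurable[OF g'h s0] by measurable
        show "q i \<in> borel_measurable M" for i
          unfolding q_def using vertical_measurable[OF gh s0] vertical_measurable[OF gh y(3)[of i]] by measurable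
        show "integrable M (\<lambda>z. norm (\<kappa> z) * (B * (1 + \<bar>X z / L\<bar>)))" by (rule weight_integrable)
        have "(\<lambda>i. q i z) \<longlonglongrightarrow> \<kappa> z * deriv g (s0 + \<i> * of_real (X z / L))" for z
        proof -
          define a where "a = \<i> * complex_of_real (X z / L)"
          have "s0 + a \<in> half_plane 0" using s0 by (simp add: half_plane_def a_def)
          then have "(g has_field_derivative deriv g (s0 + a)) (at (s0 + a))"
            using holomorphic_derivI[OF gh open_half_plane] by blast
          then have "((\<lambda>w. (g w - g (s0 + a)) / (w - (s0 + a))) \<longlongrightarrow> deriv g (s0 + a)) (at (s0 + a))"
            by (simp add: has_field_derivative_iff)
          moreover have "filterlim (\<lambda>i. y i + a) (at (s0 + a)) sequentially"
            unfolding filterlim_at using ylim y(2) by (auto intro!: tendsto_intros)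
          ultimately have "(\<lambda>i. (g (y i + a) - g (s0 + a)) / (y i + a - (s0 + a))) \<longlonglongrightarrow> deriv g (s0 + a)"
            by (rule filterlim_compose)
          then show ?thesis unfolding q_def a_def[symmetric] by (intro tendsto_mult tendsto_const) simp
        qed
        then show "AE z in M. (\<lambda>i. q i z) \<longlonglongrightarrow> \<kappa> z * deriv g (s0 + \<i> * of_real (X z / L))" by simp
        have "norm (q i z) \<le> norm (\<kappa> z) * (B * (1 + \<bar>X z / L\<bar>))" for i z
        proof -
          have "0 < norm (y i - s0)" using y(2)[of i] by simp
          with lip[OF y(1)[of i], of "X z / L"]
          have "norm (g (y i + \<i> * of_real (X z / L)) - g (s0 + \<i> * of_real (X z / L))) / norm (y i - s0) \<le> B * (1 + \<bar>X z / L\<bar>)"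
            by (simp only: pos_divide_le_eq)
          then show ?thesis unfolding q_def norm_mult norm_divide by (intro mult_left_mono) auto
        qed
        then show "AE z in M. norm (q i z) \<le> norm (\<kappa> z) * (B * (1 + \<bar>X z / L\<bar>))" for i by simp
      qed
      moreover have "(\<integral>z. q i z \<partial>M) = (smooth L g (y i) - smooth L g s0) / (y i - s0)" for i
      proof -
        have "q i z = (\<kappa> z * g (y i + \<i> * of_real (X z / L)) - \<kappa> z * g (s0 + \<i> * of_real (X z / L))) / (y i - s0)" for z
          by (simp add: q_def right_diff_distrib)
        then show ?thesis unfolding smooth_def
          using smooth_integrable[OF g y(3)[of i], of L] smooth_integrable[OF g s0, of L]
          by (simp add: Bochner_Integration.integral_diff)
      qed
      ultimately have "(\<lambda>i. (smooth L g (y i) - smooth L g s0) / (y i - s0)) \<longlonglongrightarrow> D" by simp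
      then show "(\<lambda>i. (smooth L g (Y i) - smooth L g s0) / (Y i - s0)) \<longlonglongrightarrow> D"
        unfolding y_def by (rule LIMSEQ_offset)
    qed
    then show ?thesis by (auto simp: has_field_derivative_iff)
  qed
  then show ?thesis by (auto simp: holomorphic_on_open[OF open_half_plane])
qed

text \<open>
  Where the series converges absolutely, averaging term by term multiplies the \<open>n\<close>-th term by the
  Fourier transform of the kernel at \<open>log n / log N\<close>, which is the Riesz weight for \<open>n \<le> N\<close> and 0 beyond.
\<close>

lemma smooth_dirichlet_series:
  assumes N: "2 \<le> N" and S: "summable (\<lambda>n. norm (a (Suc n)) * real (Suc n) powr (- \<sigma>1))"
    and f: "\<And>w. Re w = Re s \<Longrightarrow> dirichlet_term a w sums f w" and s: "\<sigma>1 \<le> Re s"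
  shows "smooth (ln N) f s = riesz_mean k a N s"
proof -
  define L where "L = ln (real N)"
  have L: "0 < L" using N by (simp add: L_def)
  define t where "t n z = \<kappa> z * (dirichlet_term a s n * cis (- (ln (real (Suc n)) / L) * X z))" for n z
  have vert: "dirichlet_term a (s + \<i> * of_real (X z / L)) n = dirichlet_term a s n * cis (- (ln (real (Suc n)) / L) * X z)" for n z
    unfolding dirichlet_term_def by (subst of_nat_powr_vertical) (auto simp: mult_ac)
  have tn: "norm (dirichlet_term a s n) \<le> norm (a (Suc n)) * real (Suc n) powr (- \<sigma>1)" for n
    unfolding dirichlet_term_def norm_mult norm_of_nat_powr using s by (intro mult_left_mono powr_mono) auto
  have sn: "summable (\<lambda>n. norm (dirichlet_term a s n))"
    by (rule summable_comparison_test[OF _ S]) (use tn in auto)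
  have [measurable]: "cis \<in> borel_measurable borel"
    by (intro borel_measurable_continuous_onI continuous_intros)
  have tm: "t n \<in> borel_measurable M" for n unfolding t_def by measurable
  have nt: "norm (t n z) = norm (\<kappa> z) * norm (dirichlet_term a s n)" for n z by (simp add: t_def norm_mult)
  have ti: "integrable M (t n)" for n
  proof (rule Bochner_Integration.integrable_bound)
    show "integrable M (\<lambda>z. norm (\<kappa> z) * norm (dirichlet_term a s n))"
      by (intro integrable_mult_left integrable_norm kernel_integrable)
  qed (use tm nt in auto)
  have "(\<lambda>n. \<integral>z. t n z \<partial>M) sums (\<integral>z. (\<Sum>n. t n z) \<partial>M)"
  proof (rule sums_integral[OF ti])
    show "AE z in M. summable (\<lambda>n. norm (t n z))"
      unfolding nt by (intro always_eventually allI summable_mult sn)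
    have "(\<integral>z. norm (t n z) \<partial>M) = (\<integral>z. norm (\<kappa> z) \<partial>M) * norm (dirichlet_term a s n)" for n
      unfolding nt by simp
    then show "summable (\<lambda>n. \<integral>z. norm (t n z) \<partial>M)" by (simp add: summable_mult sn)
  qed
  moreover have "(\<Sum>n. t n z) = \<kappa> z * f (s + \<i> * of_real (X z / L))" for z
  proof -
    have "(\<lambda>n. \<kappa> z * dirichlet_term a (s + \<i> * of_real (X z / L)) n) sums (\<kappa> z * f (s + \<i> * of_real (X z / L)))"
      by (intro sums_mult f) simp
    then show ?thesis unfolding vert t_def by (simp add: sums_iff)
  qed
  ultimately have 1: "(\<lambda>n. \<integral>z. t n z \<partial>M) sums smooth L f s" by (simp add: smooth_def)
  have It: "(\<integral>z. t n z \<partial>M) = dirichlet_term a s n * of_real ((max 0 (1 - ln (real (Suc n)) / L)) powr k)" for n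
  proof -
    have "t n z = dirichlet_term a s n * (\<kappa> z * cis (- (ln (real (Suc n)) / L) * X z))" for z by (simp add: t_def)
    then have "(\<integral>z. t n z \<partial>M) = dirichlet_term a s n * (\<integral>z. \<kappa> z * cis (- (ln (real (Suc n)) / L) * X z) \<partial>M)" by simp
    also have "\<dots> = dirichlet_term a s n * of_real ((max 0 (1 - ln (real (Suc n)) / L)) powr k)"
      using L by (subst kernel_fourier) auto
    finally show ?thesis .
  qed
  have "(\<lambda>n. \<integral>z. t n z \<partial>M) sums (\<Sum>n<N. \<integral>z. t n z \<partial>M)"
  proof (rule sums_finite)
    fix n assume "n \<notin> {..<N}"
    then have "real N \<le> real (Suc n)" by simp
    then have "L \<le> ln (real (Suc n))" unfolding L_def using N by (subst ln_le_cancel_iff) auto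
    then have "1 - ln (real (Suc n)) / L \<le> 0" using L by (simp add: pos_le_divide_eq)
    then show "(\<integral>z. t n z \<partial>M) = 0" by (simp add: It max_def)
  qed simp
  then have "smooth L f s = (\<Sum>n<N. \<integral>z. t n z \<partial>M)" using 1 sums_unique2 by blast
  also have "\<dots> = riesz_mean k a N s"
    unfolding riesz_mean_def
  proof (rule sum.reindex_bij_witness[of _ "\<lambda>n. n - 1" Suc])
    fix n assume "n \<in> {..<N}"
    then have "ln (real (Suc n)) \<le> L" unfolding L_def by (subst ln_le_cancel_iff) auto
    then have "0 \<le> 1 - ln (real (Suc n)) / L" using L by simp
    then show "a (Suc n) * of_real ((1 - ln (real (Suc n)) / ln (real N)) powr k) * of_nat (Suc n) powr - s = (\<integral>z. t n z \<partial>M)"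
      unfolding It L_def[symmetric] by (simp add: dirichlet_term_def max_absorb2)
  qed auto
  finally show ?thesis by (simp add: L_def)
qed

text \<open>
  Both sides are holomorphic in the right half-plane and agree in the half-plane of absolute convergence.
\<close>

lemma riesz_mean_eq_smooth:
  assumes N: "2 \<le> N" and S: "summable (\<lambda>n. norm (a (Suc n)) * real (Suc n) powr (- \<sigma>1))"
    and f: "\<And>w. \<sigma>1 \<le> Re w \<Longrightarrow> dirichlet_term a w sums f w" and fb: "line_bounded f C" and s: "0 < Re s"
  shows "riesz_mean k a N s = smooth (ln N) f s"
proof (rule analytic_continuation_open[of "half_plane (max 0 \<sigma>1)" "half_plane 0" "riesz_mean k a N"])
  have "complex_of_real (max 0 \<sigma>1 + 1) \<in> half_plane (max 0 \<sigma>1)" by (auto simp: half_plane_def max_def)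
  then show "half_plane (max 0 \<sigma>1) \<noteq> {}" by blast
  show "connected (half_plane 0)" by (simp add: convex_connected)
  show "half_plane (max 0 \<sigma>1) \<subseteq> half_plane 0" by (auto simp: half_plane_def)
  show "riesz_mean k a N holomorphic_on half_plane 0"
    unfolding riesz_mean_def by (intro holomorphic_intros) auto
  show "smooth (ln N) f holomorphic_on half_plane 0" by (rule smooth_holomorphic[OF fb])
  show "riesz_mean k a N w = smooth (ln N) f w" if "w \<in> half_plane (max 0 \<sigma>1)" for w
    using that by (intro smooth_dirichlet_series[symmetric, OF N S] f) (auto simp: half_plane_def)
qed (use s in \<open>auto simp: half_plane_def[of 0, symmetric], auto simp: half_plane_def\<close>)

definition kernel_mass :: real where "kernel_mass = (\<integral>z. norm (\<kappa> z) \<partial>M)"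
definition kernel_first_moment :: real where "kernel_first_moment = (\<integral>z. norm (\<kappa> z) * \<bar>X z\<bar> \<partial>M)"

lemma kernel_nn:
  "(\<integral>\<^sup>+z. ennreal (norm (\<kappa> z)) \<partial>M) = ennreal kernel_mass"
  "(\<integral>\<^sup>+z. ennreal (norm (\<kappa> z) * \<bar>X z\<bar>) \<partial>M) = ennreal kernel_first_moment"
  unfolding kernel_mass_def kernel_first_moment_def
  by (intro nn_integral_eq_integral integrable_norm kernel_integrable kernel_moment; simp)+

lemma kernel_nonneg: "0 \<le> kernel_mass" "0 \<le> kernel_first_moment"
  unfolding kernel_mass_def kernel_first_moment_def by (intro integral_nonneg_AE; simp)+

lemma smooth_mean_bound:
  assumes g: "line_bounded g C" and L: "1 \<le> L" and \<sigma>: "0 < \<sigma>" and T: "1 \<le> T"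
  shows "(\<integral>\<^sup>+t. ennreal (norm (smooth L g (Complex \<sigma> t))) * indicator {-T..T} t \<partial>lborel)
    \<le> ennreal (2 * T * (C * (kernel_mass + kernel_first_moment)))"
proof -
  interpret P: pair_sigma_finite M lborel by standard
  note C = line_boundedD(1)[OF g] and [measurable] = line_boundedD(2)[OF g]
  have eq: "Complex \<sigma> t + \<i> * of_real y = Complex \<sigma> (t + y)" for t y by (simp add: complex_eq_iff)
  have "(\<integral>\<^sup>+t. ennreal (norm (smooth L g (Complex \<sigma> t))) * indicator {-T..T} t \<partial>lborel)
    \<le> (\<integral>\<^sup>+t. \<integral>\<^sup>+z. ennreal (norm (\<kappa> z)) * (ennreal (norm (g (Complex \<sigma> (t + X z / L)))) * indicator {-T..T} t) \<partial>M \<partial>lborel)"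
  proof (rule nn_integral_mono)
    fix t
    have "ennreal (norm (smooth L g (Complex \<sigma> t))) \<le> (\<integral>\<^sup>+z. ennreal (norm (\<kappa> z * g (Complex \<sigma> (t + X z / L)))) \<partial>M)"
      unfolding smooth_def eq using smooth_integrable[OF g, of "Complex \<sigma> t" L, unfolded eq] \<sigma>
      by (intro integral_norm_bound_ennreal) simp
    then have "ennreal (norm (smooth L g (Complex \<sigma> t))) * indicator {-T..T} t
      \<le> (\<integral>\<^sup>+z. ennreal (norm (\<kappa> z * g (Complex \<sigma> (t + X z / L)))) \<partial>M) * indicator {-T..T} t" by (intro mult_right_mono) auto
    also have "\<dots> = (\<integral>\<^sup>+z. ennreal (norm (\<kappa> z * g (Complex \<sigma> (t + X z / L)))) * indicator {-T..T} t \<partial>M)"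
      by (rule nn_integral_multc[symmetric]) measurable
    finally show "ennreal (norm (smooth L g (Complex \<sigma> t))) * indicator {-T..T} t
      \<le> (\<integral>\<^sup>+z. ennreal (norm (\<kappa> z)) * (ennreal (norm (g (Complex \<sigma> (t + X z / L)))) * indicator {-T..T} t) \<partial>M)"
      by (simp add: norm_mult ennreal_mult mult.assoc)
  qed
  also have "\<dots> = (\<integral>\<^sup>+z. \<integral>\<^sup>+t. ennreal (norm (\<kappa> z)) * (ennreal (norm (g (Complex \<sigma> (t + X z / L)))) * indicator {-T..T} t) \<partial>lborel \<partial>M)"
    by (rule P.Fubini') measurable
  also have "\<dots> = (\<integral>\<^sup>+z. ennreal (norm (\<kappa> z)) * (\<integral>\<^sup>+t. ennreal (norm (g (Complex \<sigma> (t + X z / L)))) * indicator {-T..T} t \<partial>lborel) \<partial>M)"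
    by (intro nn_integral_cong nn_integral_cmult) measurable
  also have "\<dots> \<le> (\<integral>\<^sup>+z. ennreal (2 * T * C) * (ennreal (norm (\<kappa> z)) + ennreal (norm (\<kappa> z) * \<bar>X z\<bar>)) \<partial>M)"
  proof (rule nn_integral_mono)
    fix z
    have "(\<integral>\<^sup>+t. ennreal (norm (g (Complex \<sigma> (t + X z / L)))) * indicator {-T..T} t \<partial>lborel) \<le> ennreal (2 * (T + \<bar>X z / L\<bar>) * C)"
      by (rule line_bounded_shift[OF g \<sigma> T])
    also have "\<dots> \<le> ennreal (2 * T * C * (1 + \<bar>X z\<bar>))"
    proof (rule ennreal_leI)
      have "\<bar>X z / L\<bar> \<le> \<bar>X z\<bar> / 1" using L unfolding abs_divide by (intro divide_left_mono) auto
      also have "\<dots> \<le> T * \<bar>X z\<bar>" using T mult_right_mono[of 1 T "\<bar>X z\<bar>"] by simp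
      finally have "(T + \<bar>X z / L\<bar>) * (2 * C) \<le> (T + T * \<bar>X z\<bar>) * (2 * C)" using C by (intro mult_right_mono) auto
      then show "2 * (T + \<bar>X z / L\<bar>) * C \<le> 2 * T * C * (1 + \<bar>X z\<bar>)" by (simp add: algebra_simps)
    qed
    finally have "ennreal (norm (\<kappa> z)) * (\<integral>\<^sup>+t. ennreal (norm (g (Complex \<sigma> (t + X z / L)))) * indicator {-T..T} t \<partial>lborel)
      \<le> ennreal (norm (\<kappa> z)) * ennreal (2 * T * C * (1 + \<bar>X z\<bar>))" by (intro mult_left_mono) auto
    also have "\<dots> = ennreal (2 * T * C * (norm (\<kappa> z) + norm (\<kappa> z) * \<bar>X z\<bar>))"
      by (subst ennreal_mult'[symmetric]) (auto simp: algebra_simps)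
    also have "\<dots> = ennreal (2 * T * C) * (ennreal (norm (\<kappa> z)) + ennreal (norm (\<kappa> z) * \<bar>X z\<bar>))"
      using T C by (subst ennreal_mult) (auto simp: ennreal_plus)
    finally show "ennreal (norm (\<kappa> z)) * (\<integral>\<^sup>+t. ennreal (norm (g (Complex \<sigma> (t + X z / L)))) * indicator {-T..T} t \<partial>lborel)
      \<le> ennreal (2 * T * C) * (ennreal (norm (\<kappa> z)) + ennreal (norm (\<kappa> z) * \<bar>X z\<bar>))" .
  qed
  also have "\<dots> = ennreal (2 * T * C) * (ennreal kernel_mass + ennreal kernel_first_moment)"
    by (subst nn_integral_cmult, measurable, subst nn_integral_add, measurable, simp add: kernel_nn)
  also have "\<dots> = ennreal (2 * T * (C * (kernel_mass + kernel_first_moment)))"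
    using T C kernel_nonneg by (simp add: ennreal_mult mult.assoc flip: ennreal_plus)
  finally show ?thesis .
qed

text \<open>
  The kernel has total mass 1, so the difference is an average of increments of \<open>g\<close> by \<open>X / L\<close>.
\<close>

lemma smooth_mean_diff:
  assumes g: "line_bounded g C" and L: "0 < L" and \<alpha>: "0 < \<alpha>" "\<alpha> \<le> \<sigma>" and T: "1 \<le> T"
  shows "(\<integral>\<^sup>+t. ennreal (norm (smooth L g (Complex \<sigma> t) - g (Complex \<sigma> t))) * indicator {-T..T} t \<partial>lborel)
    \<le> ennreal (2 * T * ((2 / \<alpha> * (2 + \<alpha> / 2) + 3) * C * kernel_first_moment / L))"
proof -
  interpret P: pair_sigma_finite M lborel by standard
  note C = line_boundedD(1)[OF g] and [measurable] = line_boundedD(2)[OF g]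
  have \<sigma>: "0 < \<sigma>" using \<alpha> by simp
  define E where "E = (2 / \<alpha> * (2 + \<alpha> / 2) + 3) * C"
  have E: "0 \<le> E" using \<alpha> C by (simp add: E_def)
  have eq: "Complex \<sigma> t + \<i> * of_real y = Complex \<sigma> (t + y)" for t y by (simp add: complex_eq_iff)
  have one: "(\<integral>z. \<kappa> z \<partial>M) = 1" using kernel_fourier[of 0] by simp
  have "(\<integral>\<^sup>+t. ennreal (norm (smooth L g (Complex \<sigma> t) - g (Complex \<sigma> t))) * indicator {-T..T} t \<partial>lborel)
    \<le> (\<integral>\<^sup>+t. \<integral>\<^sup>+z. ennreal (norm (\<kappa> z)) * (ennreal (norm (g (Complex \<sigma> (t + X z / L)) - g (Complex \<sigma> t))) * indicator {-T..T} t) \<partial>M \<partial>lborel)"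
  proof (rule nn_integral_mono)
    fix t
    have i1: "integrable M (\<lambda>z. \<kappa> z * g (Complex \<sigma> (t + X z / L)))"
      using smooth_integrable[OF g, of "Complex \<sigma> t" L, unfolded eq] \<sigma> by simp
    have i2: "integrable M (\<lambda>z. \<kappa> z * g (Complex \<sigma> t))" by (intro integrable_mult_left kernel_integrable)
    have "smooth L g (Complex \<sigma> t) - g (Complex \<sigma> t) = (\<integral>z. \<kappa> z * g (Complex \<sigma> (t + X z / L)) \<partial>M) - (\<integral>z. \<kappa> z * g (Complex \<sigma> t) \<partial>M)"
      unfolding smooth_def eq by (simp add: one)
    also have "\<dots> = (\<integral>z. \<kappa> z * g (Complex \<sigma> (t + X z / L)) - \<kappa> z * g (Complex \<sigma> t) \<partial>M)"
      by (rule Bochner_Integration.integral_diff[symmetric, OF i1 i2])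
    finally have "ennreal (norm (smooth L g (Complex \<sigma> t) - g (Complex \<sigma> t))) \<le>
      (\<integral>\<^sup>+z. ennreal (norm (\<kappa> z * g (Complex \<sigma> (t + X z / L)) - \<kappa> z * g (Complex \<sigma> t))) \<partial>M)"
      using integral_norm_bound_ennreal[OF Bochner_Integration.integrable_diff[OF i1 i2]] by simp
    then have "ennreal (norm (smooth L g (Complex \<sigma> t) - g (Complex \<sigma> t))) * indicator {-T..T} t
      \<le> (\<integral>\<^sup>+z. ennreal (norm (\<kappa> z * g (Complex \<sigma> (t + X z / L)) - \<kappa> z * g (Complex \<sigma> t))) \<partial>M) * indicator {-T..T} t"
      by (intro mult_right_mono) auto
    also have "\<dots> = (\<integral>\<^sup>+z. ennreal (norm (\<kappa> z * g (Complex \<sigma> (t + X z / L)) - \<kappa> z * g (Complex \<sigma> t))) * indicator {-T..T} t \<partial>M)"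
      by (rule nn_integral_multc[symmetric]) measurable
    finally show "ennreal (norm (smooth L g (Complex \<sigma> t) - g (Complex \<sigma> t))) * indicator {-T..T} t
      \<le> (\<integral>\<^sup>+z. ennreal (norm (\<kappa> z)) * (ennreal (norm (g (Complex \<sigma> (t + X z / L)) - g (Complex \<sigma> t))) * indicator {-T..T} t) \<partial>M)"
      by (simp add: norm_mult ennreal_mult mult.assoc flip: right_diff_distrib)
  qed
  also have "\<dots> = (\<integral>\<^sup>+z. \<integral>\<^sup>+t. ennreal (norm (\<kappa> z)) * (ennreal (norm (g (Complex \<sigma> (t + X z / L)) - g (Complex \<sigma> t))) * indicator {-T..T} t) \<partial>lborel \<partial>M)"
    by (rule P.Fubini') measurable
  also have "\<dots> = (\<integral>\<^sup>+z. ennreal (norm (\<kappa> z)) * (\<integral>\<^sup>+t. ennreal (norm (g (Complex \<sigma> (t + X z / L)) - g (Complex \<sigma> t))) * indicator {-T..T} t \<partial>lborel) \<partial>M)"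
    by (intro nn_integral_cong nn_integral_cmult) measurable
  also have "\<dots> \<le> (\<integral>\<^sup>+z. ennreal (2 * T * E / L) * ennreal (norm (\<kappa> z) * \<bar>X z\<bar>) \<partial>M)"
  proof (rule nn_integral_mono)
    fix z
    have "(\<integral>\<^sup>+t. ennreal (norm (g (Complex \<sigma> (t + X z / L)) - g (Complex \<sigma> t))) * indicator {-T..T} t \<partial>lborel)
      \<le> ennreal (2 * T * (E * \<bar>X z / L\<bar>))"
      unfolding E_def by (rule increment_mean[OF g \<alpha> T])
    then have "ennreal (norm (\<kappa> z)) * (\<integral>\<^sup>+t. ennreal (norm (g (Complex \<sigma> (t + X z / L)) - g (Complex \<sigma> t))) * indicator {-T..T} t \<partial>lborel)
      \<le> ennreal (norm (\<kappa> z)) * ennreal (2 * T * (E * \<bar>X z / L\<bar>))" by (intro mult_left_mono) auto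
    also have "\<dots> = ennreal (2 * T * E / L) * ennreal (norm (\<kappa> z) * \<bar>X z\<bar>)"
      using T E L by (simp add: ennreal_mult[symmetric] abs_divide mult_ac)
    finally show "ennreal (norm (\<kappa> z)) * (\<integral>\<^sup>+t. ennreal (norm (g (Complex \<sigma> (t + X z / L)) - g (Complex \<sigma> t))) * indicator {-T..T} t \<partial>lborel)
      \<le> ennreal (2 * T * E / L) * ennreal (norm (\<kappa> z) * \<bar>X z\<bar>)" .
  qed
  also have "\<dots> = ennreal (2 * T * E / L) * ennreal kernel_first_moment"
    by (subst nn_integral_cmult) (auto simp: kernel_nn)
  also have "\<dots> = ennreal (2 * T * (E * kernel_first_moment / L))"
    using T E L kernel_nonneg by (simp add: ennreal_mult[symmetric] mult_ac)
  finally show ?thesis by (simp add: E_def)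
qed

end

section \<open>Logarithmic means under Riesz summation\<close>

text \<open>
  The terms at a point of convergence are bounded, so moving right by 2 gains a summable factor \<open>n^(-2)\<close>.
\<close>

lemma somewhere_convergent_imp_abs_summable:
  assumes "somewhere_convergent a"
  obtains \<sigma>1 where "\<And>\<sigma>. \<sigma>1 \<le> \<sigma> \<Longrightarrow> summable (\<lambda>n. norm (a (Suc n)) * real (Suc n) powr (- \<sigma>))"
proof -
  obtain s where "summable (dirichlet_term a s)" using assms by (auto simp: somewhere_convergent_def)
  then have "dirichlet_term a s \<longlonglongrightarrow> 0" by (rule summable_LIMSEQ_zero)
  then have "Bseq (dirichlet_term a s)" by (rule convergent_imp_Bseq[OF convergentI])
  then obtain B where B: "\<And>n. norm (dirichlet_term a s n) \<le> B" by (metis BseqE)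
  have sum2: "summable (\<lambda>n. real (Suc n) powr (- 2))"
    using summable_real_powr_iff[of "-2"] by (subst summable_Suc_iff[of "\<lambda>n. real n powr (- 2)"]) simp
  show thesis
  proof (rule that[of "Re s + 2"])
    fix \<sigma> assume \<sigma>: "Re s + 2 \<le> \<sigma>"
    show "summable (\<lambda>n. norm (a (Suc n)) * real (Suc n) powr (- \<sigma>))"
    proof (rule summable_comparison_test[OF _ summable_mult[OF sum2, of B]], intro exI allI impI)
      fix n
      have "norm (a (Suc n)) * real (Suc n) powr (- \<sigma>) \<le> norm (a (Suc n)) * real (Suc n) powr (- Re s - 2)"
        using \<sigma> by (intro mult_left_mono powr_mono) auto
      also have "\<dots> = norm (dirichlet_term a s n) * real (Suc n) powr (- 2)"
        unfolding dirichlet_term_def norm_mult norm_of_nat_powr mult.assoc powr_add[symmetric] by simp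
      also have "\<dots> \<le> B * real (Suc n) powr (- 2)" by (intro mult_right_mono B) auto
      finally show "norm (norm (a (Suc n)) * real (Suc n) powr (- \<sigma>)) \<le> B * real (Suc n) powr (- 2)" by simp
    qed
  qed
qed

lemma line_bounded_mono: "line_bounded g C \<Longrightarrow> C \<le> C' \<Longrightarrow> line_bounded g C'"
  unfolding line_bounded_def
proof (elim conjE, intro conjI allI impI)
  fix \<sigma> T :: real
  assume b: "\<forall>\<sigma>>0. \<forall>T\<ge>1. (\<integral>\<^sup>+t. ennreal (norm (g (Complex \<sigma> t))) * indicator {-T..T} t \<partial>lborel) \<le> ennreal (2 * T * C)"
    and *: "C \<le> C'" "0 < \<sigma>" "1 \<le> T"
  have "(\<integral>\<^sup>+t. ennreal (norm (g (Complex \<sigma> t))) * indicator {-T..T} t \<partial>lborel) \<le> ennreal (2 * T * C)" using b * by blast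
  also have "\<dots> \<le> ennreal (2 * T * C')" using * by (intro ennreal_leI mult_left_mono) auto
  finally show "(\<integral>\<^sup>+t. ennreal (norm (g (Complex \<sigma> t))) * indicator {-T..T} t \<partial>lborel) \<le> ennreal (2 * T * C')" .
qed auto

lemma riesz_mean_dpoly: "riesz_mean k a N = dpoly (\<lambda>n. a n * of_real ((1 - ln (real n) / ln (real N)) powr k)) N"
  by (intro ext) (simp add: riesz_mean_def dpoly_def)

text \<open>
  Riesz means as Dirichlet series with coefficients dominated by \<open>a\<close>. The cutoff at \<open>N\<close> is explicit
  so that the estimates for series dominated by \<open>a\<close> apply to them.
\<close>

definition riesz_coeff :: "real \<Rightarrow> (nat \<Rightarrow> complex) \<Rightarrow> nat \<Rightarrow> nat \<Rightarrow> complex" where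
  "riesz_coeff k a N n = (if n \<le> N then a n * of_real ((1 - ln (real n) / ln (real N)) powr k) else 0)"

lemma riesz_mean_sums: "dirichlet_term (riesz_coeff k a N) s sums riesz_mean k a N s"
  using dpoly_sums[of N "\<lambda>n. a n * of_real ((1 - ln (real n) / ln (real N)) powr k)" s]
  by (simp add: riesz_mean_dpoly riesz_coeff_def[abs_def])

lemma norm_riesz_coeff_le:
  assumes "2 \<le> N" "0 < k" shows "norm (riesz_coeff k a N n) \<le> norm (a n)"
proof (cases "n \<le> N")
  case True
  have L: "0 < ln (real N)" using assms by simp
  have "0 \<le> ln (real n)" by (cases "n = 0") auto
  moreover have "ln (real n) \<le> ln (real N)"
    using True assms by (cases "n = 0") auto
  ultimately have "0 \<le> 1 - ln (real n) / ln (real N)" "1 - ln (real n) / ln (real N) \<le> 1"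
    using L by (auto simp: divide_le_eq)
  then have "(1 - ln (real n) / ln (real N)) powr k \<le> 1 powr k" using assms by (intro powr_mono2) auto
  then show ?thesis using True by (simp add: riesz_coeff_def norm_mult mult_left_le)
qed (simp add: riesz_coeff_def)

lemma riesz_coeff_eventually_large:
  assumes "1 \<le> m" "a m \<noteq> 0" "0 < k"
  shows "\<forall>\<^sub>F N in sequentially. norm (a m) / 2 \<le> norm (riesz_coeff k a N m)"
proof -
  have "filterlim (\<lambda>N. ln (real N)) at_top sequentially"
    by (rule filterlim_compose[OF ln_at_top filterlim_real_sequentially])
  then have "(\<lambda>N. ln (real m) / ln (real N)) \<longlonglongrightarrow> 0"
    by (intro tendsto_divide_0[OF tendsto_const] filterlim_at_top_imp_at_infinity)
  then have "(\<lambda>N. (1 - ln (real m) / ln (real N)) powr k) \<longlonglongrightarrow> (1 - 0) powr k"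
    by (intro tendsto_powr tendsto_diff tendsto_const) auto
  then have "\<forall>\<^sub>F N in sequentially. 1 / 2 < (1 - ln (real m) / ln (real N)) powr k"
    by (rule order_tendstoD(1)) simp
  then show ?thesis using eventually_ge_at_top[of m]
  proof eventually_elim
    case (elim N)
    then have "norm (a m) * (1 / 2) \<le> norm (a m) * (1 - ln (real m) / ln (real N)) powr k"
      by (intro mult_left_mono) auto
    then show ?case using elim by (simp add: riesz_coeff_def norm_mult)
  qed
qed

lemma jessen_mean_diff:
  assumes g: "g holomorphic_on half_plane 0" "log_controlled g K \<sigma>" and h: "h holomorphic_on half_plane 0" "log_controlled h K \<sigma>"
    and \<sigma>: "0 < \<sigma>" and \<epsilon>: "0 < \<epsilon>" "\<epsilon> < 1" and T: "1 \<le> T" and \<eta>: "0 \<le> \<eta>"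
    and b: "(\<integral>\<^sup>+t. ennreal (norm (g (Complex \<sigma> t) - h (Complex \<sigma> t))) * indicator {-T..T} t \<partial>lborel) \<le> ennreal (2 * T * \<eta>)"
  shows "\<bar>jessen_mean g \<sigma> T - jessen_mean h \<sigma> T\<bar> \<le> 2 * (K / ln (1 / \<epsilon>)) + \<eta> / \<epsilon>"
proof -
  have 1: "\<bar>jessen_mean g \<sigma> T - tlog_mean \<epsilon> g \<sigma> T\<bar> \<le> K / ln (1 / \<epsilon>)"
    by (rule jessen_tlog_mean[OF g(1) \<sigma> g(2) \<epsilon> T])
  have 2: "\<bar>jessen_mean h \<sigma> T - tlog_mean \<epsilon> h \<sigma> T\<bar> \<le> K / ln (1 / \<epsilon>)"
    by (rule jessen_tlog_mean[OF h(1) \<sigma> h(2) \<epsilon> T])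
  have 3: "\<bar>tlog_mean \<epsilon> g \<sigma> T - tlog_mean \<epsilon> h \<sigma> T\<bar> \<le> \<eta> / \<epsilon>"
    using T by (intro tlog_mean_diff[OF g(1) h(1) \<sigma> \<sigma> \<epsilon>(1) _ \<eta> b]) auto
  have "\<bar>a - b\<bar> \<le> 2 * x + y" if "\<bar>a - a'\<bar> \<le> x" "\<bar>b - b'\<bar> \<le> x" "\<bar>a' - b'\<bar> \<le> y" for a b a' b' x y :: real
    using that by linarith
  from this[OF 1 2 3] show ?thesis .
qed

text \<open>
  A function with bounded means on vertical lines that is represented by an absolutely convergent
  Dirichlet series on a far right half-plane; \<open>m\<close> is the index of the leading coefficient.
\<close>

locale dirichlet_hardy =
  fixes a :: "nat \<Rightarrow> complex" and g :: "complex \<Rightarrow> complex" and C \<sigma>1 :: real and m :: nat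
  assumes bounded: "line_bounded g C"
    and abs_conv: "summable (\<lambda>n. norm (a (Suc n)) * real (Suc n) powr (- \<sigma>1))"
    and series: "\<sigma>1 \<le> Re s \<Longrightarrow> dirichlet_term a s sums g s"
    and m: "1 \<le> m" "a m \<noteq> 0" and m_least: "1 \<le> n \<Longrightarrow> n < m \<Longrightarrow> a n = 0"
begin

lemma g_holomorphic: "g holomorphic_on half_plane 0" by (rule line_boundedD(3)[OF bounded])

lemma riesz_nonzero:
  assumes "0 < k" shows "\<forall>\<^sub>F N in sequentially. \<exists>n\<in>{1..N}. a n * of_real ((1 - ln (real n) / ln (real N)) powr k) \<noteq> 0"
  using riesz_coeff_eventually_large[of m a k, OF m assms] eventually_ge_at_top[of m]
proof eventually_elim
  case (elim N)
  then have "riesz_coeff k a N m \<noteq> 0" using m by auto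
  then show ?case using m elim by (intro bexI[of _ m]) (auto simp: riesz_coeff_def)
qed

text \<open>
  One line and one lower bound serve the function and all its Riesz means of large order, which is what
  a common constant for the logarithms requires.
\<close>

lemma uniform_lower_bound:
  assumes k: "0 < k"
  obtains \<sigma>0 \<delta> where "\<beta> \<le> \<sigma>0" "0 < \<delta>" "\<delta> \<le> 1" "\<And>t. \<delta> \<le> norm (g (Complex \<sigma>0 t))"
    "\<forall>\<^sub>F N in sequentially. \<forall>t. \<delta> \<le> norm (riesz_mean k a N (Complex \<sigma>0 t))"
proof -
  obtain \<sigma>2 where \<sigma>2: "\<sigma>1 \<le> \<sigma>2"
    "\<And>c s F. (\<And>n. norm (c n) \<le> norm (a n)) \<Longrightarrow> (\<And>n. 1 \<le> n \<Longrightarrow> n < m \<Longrightarrow> c n = 0) \<Longrightarrow>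
      norm (a m) / 2 \<le> norm (c m) \<Longrightarrow> \<sigma>2 \<le> Re s \<Longrightarrow> dirichlet_term c s sums F \<Longrightarrow>
      norm (a m) / 4 * real m powr (- Re s) \<le> norm F"
    using leading_term_lower_bound[OF abs_conv m] by blast
  define \<sigma>0 where "\<sigma>0 = max \<beta> \<sigma>2"
  define \<delta> where "\<delta> = min 1 (norm (a m) / 4 * real m powr (- \<sigma>0))"
  have p: "0 < norm (a m) / 4 * real m powr (- \<sigma>0)" using m by simp
  show thesis
  proof (rule that[of \<sigma>0 \<delta>])
    show "\<beta> \<le> \<sigma>0" "0 < \<delta>" "\<delta> \<le> 1" using p by (auto simp: \<sigma>0_def \<delta>_def)
    have "norm (a m) / 4 * real m powr (- \<sigma>0) \<le> norm (g (Complex \<sigma>0 t))" for t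
      using \<sigma>2(2)[of a "Complex \<sigma>0 t" "g (Complex \<sigma>0 t)"] series[of "Complex \<sigma>0 t"] m_least \<sigma>2(1)
      by (simp add: \<sigma>0_def)
    then show "\<delta> \<le> norm (g (Complex \<sigma>0 t))" for t by (auto simp: \<delta>_def intro: min.coboundedI2)
    show "\<forall>\<^sub>F N in sequentially. \<forall>t. \<delta> \<le> norm (riesz_mean k a N (Complex \<sigma>0 t))"
      using riesz_coeff_eventually_large[of m a k, OF m k] eventually_ge_at_top[of 2]
    proof eventually_elim
      case (elim N)
      have "norm (a m) / 4 * real m powr (- \<sigma>0) \<le> norm (riesz_mean k a N (Complex \<sigma>0 t))" for t
        using \<sigma>2(2)[of "riesz_coeff k a N" "Complex \<sigma>0 t", OF norm_riesz_coeff_le[OF elim(2) k] _ elim(1) _ riesz_mean_sums]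
          m_least by (simp add: \<sigma>0_def riesz_coeff_def)
      then show ?case by (auto simp: \<delta>_def intro: min.coboundedI2)
    qed
  qed
qed

lemma one_le_ln: "3 \<le> N \<Longrightarrow> 1 \<le> ln (real N)"
proof -
  assume N: "3 \<le> N"
  have "exp 1 \<le> real N" using exp_le N by linarith
  then show ?thesis using N by (subst ln_ge_iff) auto
qed

lemma riesz_mean_line_bounded:
  assumes k: "3 < k"
  shows "\<exists>C'\<ge>0. \<forall>\<^sub>F N in sequentially. line_bounded (riesz_mean k a N) C'"
proof -
  obtain \<kappa> X where "riesz_kernel (lborel \<Otimes>\<^sub>M lborel :: (real \<times> real) measure) \<kappa> X k"
    using riesz_kernel_exists[OF k] by blast
  then interpret R: riesz_kernel "lborel \<Otimes>\<^sub>M lborel :: (real \<times> real) measure" \<kappa> X k .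
  define C' where "C' = C * (R.kernel_mass + R.kernel_first_moment)"
  have C': "0 \<le> C'" using line_boundedD(1)[OF bounded] R.kernel_nonneg by (simp add: C'_def)
  have "\<forall>\<^sub>F N in sequentially. line_bounded (riesz_mean k a N) C'"
    using eventually_ge_at_top[of 3]
  proof eventually_elim
    case (elim N)
    show ?case unfolding line_bounded_def
    proof (intro conjI allI impI C')
      show "riesz_mean k a N \<in> borel_measurable borel" "riesz_mean k a N holomorphic_on half_plane 0"
        unfolding riesz_mean_dpoly using dpoly_line_bounded by (auto simp: line_bounded_def)
      fix \<sigma> T :: real assume \<sigma>: "0 < \<sigma>" "1 \<le> T"
      have eq: "riesz_mean k a N (Complex \<sigma> t) = R.smooth (ln (real N)) g (Complex \<sigma> t)" for t
        using elim \<sigma> by (intro R.riesz_mean_eq_smooth[OF _ abs_conv series bounded]) auto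
      show "(\<integral>\<^sup>+t. ennreal (norm (riesz_mean k a N (Complex \<sigma> t))) * indicator {-T..T} t \<partial>lborel) \<le> ennreal (2 * T * C')"
        unfolding eq C'_def by (rule R.smooth_mean_bound[OF bounded one_le_ln[OF elim] \<sigma>])
    qed
  qed
  then show ?thesis using C' by blast
qed

lemma riesz_mean_diff:
  assumes k: "3 < k" and \<alpha>: "0 < \<alpha>"
  shows "\<exists>E\<ge>0. \<forall>\<^sub>F N in sequentially. \<forall>\<sigma>\<ge>\<alpha>. \<forall>T\<ge>1.
      (\<integral>\<^sup>+t. ennreal (norm (g (Complex \<sigma> t) - riesz_mean k a N (Complex \<sigma> t))) * indicator {-T..T} t \<partial>lborel)
      \<le> ennreal (2 * T * (E / ln (real N)))"
proof -
  obtain \<kappa> X where "riesz_kernel (lborel \<Otimes>\<^sub>M lborel :: (real \<times> real) measure) \<kappa> X k"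
    using riesz_kernel_exists[OF k] by blast
  then interpret R: riesz_kernel "lborel \<Otimes>\<^sub>M lborel :: (real \<times> real) measure" \<kappa> X k .
  define E where "E = (2 / \<alpha> * (2 + \<alpha> / 2) + 3) * C * R.kernel_first_moment"
  have E: "0 \<le> E" using \<alpha> line_boundedD(1)[OF bounded] R.kernel_nonneg by (simp add: E_def)
  have "\<forall>\<^sub>F N in sequentially. \<forall>\<sigma>\<ge>\<alpha>. \<forall>T\<ge>1.
    (\<integral>\<^sup>+t. ennreal (norm (g (Complex \<sigma> t) - riesz_mean k a N (Complex \<sigma> t))) * indicator {-T..T} t \<partial>lborel)
    \<le> ennreal (2 * T * (E / ln (real N)))"
    using eventually_ge_at_top[of 3]
  proof eventually_elim
    case (elim N)
    show ?case
    proof (intro allI impI)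
      fix \<sigma> T :: real assume \<sigma>: "\<alpha> \<le> \<sigma>" "1 \<le> T"
      then have s0: "0 < \<sigma>" using \<alpha> by simp
      have eq: "riesz_mean k a N (Complex \<sigma> t) = R.smooth (ln (real N)) g (Complex \<sigma> t)" for t
        using elim s0 by (intro R.riesz_mean_eq_smooth[OF _ abs_conv series bounded]) auto
      have "0 < ln (real N)" using one_le_ln[OF elim] by linarith
      from R.smooth_mean_diff[OF bounded this \<alpha> \<sigma>]
      show "(\<integral>\<^sup>+t. ennreal (norm (g (Complex \<sigma> t) - riesz_mean k a N (Complex \<sigma> t))) * indicator {-T..T} t \<partial>lborel)
        \<le> ennreal (2 * T * (E / ln (real N)))"
        unfolding eq E_def by (simp only: norm_minus_commute)
    qed
  qed
  then show ?thesis using E by blast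
qed

lemma log_controlled_riesz:
  assumes k: "3 < k" and \<alpha>: "0 < \<alpha>"
  obtains K where "0 \<le> K" "\<And>\<sigma>. \<alpha> \<le> \<sigma> \<Longrightarrow> \<sigma> \<le> \<beta> \<Longrightarrow> log_controlled g K \<sigma>"
    "\<forall>\<^sub>F N in sequentially. \<forall>\<sigma>. \<alpha> \<le> \<sigma> \<longrightarrow> \<sigma> \<le> \<beta> \<longrightarrow> log_controlled (riesz_mean k a N) K \<sigma>"
proof -
  have k0: "0 < k" using k by simp
  obtain \<sigma>0 \<delta> where \<sigma>0: "max \<alpha> \<beta> \<le> \<sigma>0" and \<delta>: "0 < \<delta>" "\<delta> \<le> 1" and low: "\<And>t. \<delta> \<le> norm (g (Complex \<sigma>0 t))"
    and lowN: "\<forall>\<^sub>F N in sequentially. \<forall>t. \<delta> \<le> norm (riesz_mean k a N (Complex \<sigma>0 t))"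
    using uniform_lower_bound[OF k0, of "max \<alpha> \<beta>"] by blast
  obtain C' where C': "0 \<le> C'" "\<forall>\<^sub>F N in sequentially. line_bounded (riesz_mean k a N) C'"
    using riesz_mean_line_bounded[OF k] by blast
  have C0: "0 \<le> C + C'" using C'(1) line_boundedD(1)[OF bounded] by simp
  obtain K where K: "0 \<le> K"
    "\<And>h \<sigma>. line_bounded h (C + C') \<Longrightarrow> (\<And>t. \<delta> \<le> norm (h (Complex \<sigma>0 t))) \<Longrightarrow> \<alpha> \<le> \<sigma> \<Longrightarrow> \<sigma> \<le> \<sigma>0 \<Longrightarrow> log_controlled h K \<sigma>"
    using log_controlled_family[OF \<alpha> _ \<delta> C0, of \<sigma>0] \<sigma>0 by auto
  show thesis
  proof (rule that[of K])
    show "0 \<le> K" by fact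
    show "log_controlled g K \<sigma>" if "\<alpha> \<le> \<sigma>" "\<sigma> \<le> \<beta>" for \<sigma>
      using that \<sigma>0 C'(1) by (intro K(2) line_bounded_mono[OF bounded] low) auto
    show "\<forall>\<^sub>F N in sequentially. \<forall>\<sigma>. \<alpha> \<le> \<sigma> \<longrightarrow> \<sigma> \<le> \<beta> \<longrightarrow> log_controlled (riesz_mean k a N) K \<sigma>"
      using C'(2) lowN
    proof eventually_elim
      case (elim N)
      have "line_bounded (riesz_mean k a N) (C + C')"
        using elim(1) by (rule line_bounded_mono) (use line_boundedD(1)[OF bounded] in simp)
      then show ?case using \<sigma>0 elim(2) by (intro allI impI K(2)) auto
    qed
  qed
qed

text \<open>
  First \<open>\<epsilon>\<close> is chosen to make the truncation errors small, uniformly in \<open>N\<close>; then \<open>N\<close> is taken so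
  large that the Lipschitz constant \<open>1/\<epsilon>\<close> times the mean difference \<open>E / log N\<close> is small.
\<close>

lemma jessen_mean_riesz_close:
  assumes k: "3 < k" and \<alpha>: "0 < \<alpha>" and e: "0 < e"
  shows "\<forall>\<^sub>F N in sequentially. \<forall>\<sigma>\<in>{\<alpha>..\<beta>}. \<forall>T\<ge>1. \<bar>jessen_mean g \<sigma> T - jessen_mean (riesz_mean k a N) \<sigma> T\<bar> \<le> e"
proof -
  obtain K where K: "0 \<le> K" "\<And>\<sigma>. \<alpha> \<le> \<sigma> \<Longrightarrow> \<sigma> \<le> \<beta> \<Longrightarrow> log_controlled g K \<sigma>"
    "\<forall>\<^sub>F N in sequentially. \<forall>\<sigma>. \<alpha> \<le> \<sigma> \<longrightarrow> \<sigma> \<le> \<beta> \<longrightarrow> log_controlled (riesz_mean k a N) K \<sigma>"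
    using log_controlled_riesz[OF k \<alpha>, where \<beta> = \<beta>] by blast
  obtain E where E: "0 \<le> E" "\<forall>\<^sub>F N in sequentially. \<forall>\<sigma>\<ge>\<alpha>. \<forall>T\<ge>1.
      (\<integral>\<^sup>+t. ennreal (norm (g (Complex \<sigma> t) - riesz_mean k a N (Complex \<sigma> t))) * indicator {-T..T} t \<partial>lborel)
      \<le> ennreal (2 * T * (E / ln (real N)))"
    using riesz_mean_diff[OF k \<alpha>] by blast
  obtain \<epsilon> where \<epsilon>: "0 < \<epsilon>" "\<epsilon> < 1" "K / ln (1 / \<epsilon>) \<le> e / 4" using ex_small_log[of "e/4" K] e by auto
  have "filterlim (\<lambda>N. ln (real N)) at_top sequentially"
    by (rule filterlim_compose[OF ln_at_top filterlim_real_sequentially])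
  then have "(\<lambda>N. E / ln (real N)) \<longlonglongrightarrow> 0"
    by (intro tendsto_divide_0[OF tendsto_const] filterlim_at_top_imp_at_infinity)
  moreover have "0 < e / 2 * \<epsilon>" using e \<epsilon> by simp
  ultimately have "\<forall>\<^sub>F N in sequentially. E / ln (real N) < e / 2 * \<epsilon>" by (rule order_tendstoD(2))
  then show ?thesis using K(3) E(2) eventually_ge_at_top[of 2]
  proof eventually_elim
    case (elim N)
    show ?case
    proof (intro ballI allI impI)
      fix \<sigma> T :: real assume \<sigma>: "\<sigma> \<in> {\<alpha>..\<beta>}" and T: "1 \<le> T"
      have "\<bar>jessen_mean g \<sigma> T - jessen_mean (riesz_mean k a N) \<sigma> T\<bar> \<le> 2 * (K / ln (1 / \<epsilon>)) + (E / ln (real N)) / \<epsilon>"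
      proof (rule jessen_mean_diff[OF g_holomorphic _ _ _ _ \<epsilon>(1,2) T])
        show "riesz_mean k a N holomorphic_on half_plane 0" unfolding riesz_mean_dpoly by (rule dpoly_holomorphic)
        show "0 \<le> E / ln (real N)" using E(1) elim(4) by (intro divide_nonneg_nonneg) auto
      qed (use K(2) elim \<sigma> \<alpha> T in auto)
      moreover have "(E / ln (real N)) / \<epsilon> \<le> e / 2" 
        by (rule pos_divide_le_eq[THEN iffD2, OF \<epsilon>(1) less_imp_le[OF elim(1)]])
      ultimately show "\<bar>jessen_mean g \<sigma> T - jessen_mean (riesz_mean k a N) \<sigma> T\<bar> \<le> e" using \<epsilon>(3) by linarith
    qed
  qed
qed

lemma riesz_jessen_ucauchy:
  assumes "0 < k"
  shows "\<forall>\<^sub>F N in sequentially. \<forall>\<alpha>>0. \<forall>\<beta>. ucauchy {\<alpha>..\<beta>} (\<lambda>T \<sigma>. jessen_mean (riesz_mean k a N) \<sigma> T)"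
  using riesz_nonzero[OF assms]
  by eventually_elim (use dpoly_jessen_ucauchy in \<open>auto simp: riesz_mean_dpoly\<close>)

lemma jessen_ucauchy:
  assumes \<alpha>: "0 < \<alpha>"
  shows "ucauchy {\<alpha>..\<beta>} (\<lambda>T \<sigma>. jessen_mean g \<sigma> T)"
proof (rule ucauchy_approx)
  fix e :: real assume e: "0 < e"
  have "\<forall>\<^sub>F N in sequentially. ucauchy {\<alpha>..\<beta>} (\<lambda>T \<sigma>. jessen_mean (riesz_mean 4 a N) \<sigma> T) \<and>
    (\<forall>\<sigma>\<in>{\<alpha>..\<beta>}. \<forall>T\<ge>1. \<bar>jessen_mean g \<sigma> T - jessen_mean (riesz_mean 4 a N) \<sigma> T\<bar> \<le> e)"
    using riesz_jessen_ucauchy[of 4, OF zero_less_numeral] jessen_mean_riesz_close[of 4 \<alpha> e \<beta>, OF _ \<alpha> e, simplified]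
    by eventually_elim (use \<alpha> in blast)
  then obtain N where "ucauchy {\<alpha>..\<beta>} (\<lambda>T \<sigma>. jessen_mean (riesz_mean 4 a N) \<sigma> T)"
    "\<forall>\<sigma>\<in>{\<alpha>..\<beta>}. \<forall>T\<ge>1. \<bar>jessen_mean g \<sigma> T - jessen_mean (riesz_mean 4 a N) \<sigma> T\<bar> \<le> e"
    using eventually_happens'[OF sequentially_bot] by blast
  then show "\<exists>G T0. ucauchy {\<alpha>..\<beta>} G \<and> (\<forall>T\<ge>T0. \<forall>x\<in>{\<alpha>..\<beta>}. \<bar>jessen_mean g x T - G T x\<bar> \<le> e)"
    by blast
qed

lemma jessen_lim: "0 < \<sigma> \<Longrightarrow> (jessen_mean g \<sigma> \<longlongrightarrow> jessen g \<sigma>) at_top"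
  by (rule jessen_tendsto[OF jessen_ucauchy[of \<sigma> \<sigma>]]) simp_all

lemma jessen_riesz_close:
  assumes k: "3 < k" and \<alpha>: "0 < \<alpha>" and e: "0 < e"
  shows "\<forall>\<^sub>F N in sequentially. \<forall>\<sigma>\<in>{\<alpha>..\<beta>}. \<bar>jessen g \<sigma> - jessen (riesz_mean k a N) \<sigma>\<bar> \<le> e"
proof -
  have k0: "0 < k" using k by simp
  show ?thesis using jessen_mean_riesz_close[OF k \<alpha> e, of \<beta>] riesz_jessen_ucauchy[OF k0]
  proof eventually_elim
    case (elim N)
    show ?case
    proof
      fix \<sigma> assume \<sigma>: "\<sigma> \<in> {\<alpha>..\<beta>}"
      then have s0: "0 < \<sigma>" using \<alpha> by auto
      show "\<bar>jessen g \<sigma> - jessen (riesz_mean k a N) \<sigma>\<bar> \<le> e"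
      proof (rule tendsto_upperbound)
        have "(jessen_mean (riesz_mean k a N) \<sigma> \<longlongrightarrow> jessen (riesz_mean k a N) \<sigma>) at_top"
          by (rule jessen_tendsto[of \<sigma> \<sigma>]) (use elim(2) s0 in blast, simp_all)
        then show "((\<lambda>T. \<bar>jessen_mean g \<sigma> T - jessen_mean (riesz_mean k a N) \<sigma> T\<bar>) \<longlongrightarrow> \<bar>jessen g \<sigma> - jessen (riesz_mean k a N) \<sigma>\<bar>) at_top"
          by (intro tendsto_intros jessen_lim[OF s0])
        show "\<forall>\<^sub>F T in at_top. \<bar>jessen_mean g \<sigma> T - jessen_mean (riesz_mean k a N) \<sigma> T\<bar> \<le> e"
          using eventually_ge_at_top[of 1] by eventually_elim (use elim(1) \<sigma> in auto)
      qed simp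
    qed
  qed
qed

lemma jessen_convex: "convex_on {0<..} (jessen g)"
proof -
  obtain N0 where N0: "\<And>N. N0 \<le> N \<Longrightarrow> \<exists>n\<in>{1..N}. a n * of_real ((1 - ln (real n) / ln (real N)) powr 4) \<noteq> 0"
    using riesz_nonzero[of 4] by (auto simp: eventually_sequentially)
  show ?thesis
  proof (rule convex_on_pointwise_limit)
    show "convex_on {0<..} (jessen (riesz_mean 4 a (n + N0)))" for n
      unfolding riesz_mean_dpoly by (rule dpoly_jessen_convex[OF N0]) simp
    fix \<sigma> :: real assume "\<sigma> \<in> {0<..}"
    then have \<sigma>: "0 < \<sigma>" by simp
    have "(\<lambda>N. jessen (riesz_mean 4 a N) \<sigma>) \<longlonglongrightarrow> jessen g \<sigma>"
    proof (rule tendstoI)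
      fix e :: real assume "0 < e"
      then have "\<forall>\<^sub>F N in sequentially. \<forall>\<sigma>\<in>{\<sigma>..\<sigma>}. \<bar>jessen g \<sigma> - jessen (riesz_mean 4 a N) \<sigma>\<bar> \<le> e / 2"
        by (intro jessen_riesz_close \<sigma>) auto
      then show "\<forall>\<^sub>F N in sequentially. dist (jessen (riesz_mean 4 a N) \<sigma>) (jessen g \<sigma>) < e"
        by eventually_elim (use \<open>0 < e\<close> in \<open>auto simp: dist_real_def abs_minus_commute\<close>)
    qed
    then show "(\<lambda>n. jessen (riesz_mean 4 a (n + N0)) \<sigma>) \<longlonglongrightarrow> jessen g \<sigma>"
      by (rule LIMSEQ_ignore_initial_segment)
  qed
qed

lemma g_log_controlled:
  assumes "0 < \<sigma>" obtains K where "log_controlled g K \<sigma>"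
  by (rule log_controlled_riesz[of 4 \<sigma> \<sigma>]) (use assms that in simp_all)

lemma g_jessen_exists: "0 < \<sigma> \<Longrightarrow> jessen_exists g \<sigma>"
proof -
  assume \<sigma>: "0 < \<sigma>"
  obtain K where K: "log_controlled g K \<sigma>" using g_log_controlled[OF \<sigma>] .
  show "jessen_exists g \<sigma>"
    unfolding jessen_exists_def
    using ln_norm_integrable(1)[OF g_holomorphic \<sigma> K] jessen_lim[OF \<sigma>] K by (auto simp: log_controlled_def)
qed

lemma riesz_jessen_exists:
  assumes "0 < k"
  shows "\<forall>\<^sub>F N in sequentially. \<forall>\<sigma>>0. jessen_exists (riesz_mean k a N) \<sigma>"
  using riesz_nonzero[OF assms]
proof eventually_elim
  case (elim N)
  show ?case
  proof (intro allI impI)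
    fix \<sigma> :: real assume \<sigma>: "0 < \<sigma>"
    obtain K where K: "log_controlled (riesz_mean k a N) K \<sigma>"
      using dpoly_log_controlled[OF elim \<sigma>, of \<sigma>] by (auto simp: riesz_mean_dpoly)
    have "(jessen_mean (riesz_mean k a N) \<sigma> \<longlongrightarrow> jessen (riesz_mean k a N) \<sigma>) at_top"
      using dpoly_jessen_ucauchy[OF elim \<sigma>, of \<sigma>] unfolding riesz_mean_dpoly by (rule jessen_tendsto) auto
    moreover have "riesz_mean k a N holomorphic_on half_plane 0" unfolding riesz_mean_dpoly by (rule dpoly_holomorphic)
    ultimately show "jessen_exists (riesz_mean k a N) \<sigma>"
      unfolding jessen_exists_def using ln_norm_integrable(1)[OF _ \<sigma> K] K by (auto simp: log_controlled_def)
  qed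
qed

lemma jessen_le: "0 < \<sigma> \<Longrightarrow> jessen g \<sigma> \<le> C"
proof -
  assume \<sigma>: "0 < \<sigma>"
  obtain K where K: "log_controlled g K \<sigma>" using g_log_controlled[OF \<sigma>] .
  note C0 = line_boundedD(1)[OF bounded] and [measurable] = line_boundedD(2)[OF bounded]
  have "\<forall>\<^sub>F T in at_top. jessen_mean g \<sigma> T \<le> C"
    using eventually_ge_at_top[of 1]
  proof eventually_elim
    case (elim T)
    have I: "set_integrable lborel {-T..T} (\<lambda>t. norm (g (Complex \<sigma> t)))" "(LBINT t:{-T..T}. norm (g (Complex \<sigma> t))) \<le> 2 * T * C"
      using set_integral_norm_le_nn[OF _ _ _ line_boundedD(4)[OF bounded \<sigma> elim]] C0 elim by auto
    have "(LBINT t:{-T..T}. ln (norm (g (Complex \<sigma> t)))) \<le> (LBINT t:{-T..T}. norm (g (Complex \<sigma> t)))"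
    proof (rule set_integral_mono[OF ln_norm_integrable(1)[OF g_holomorphic \<sigma> K] I(1)])
      show "ln (norm (g (Complex \<sigma> t))) \<le> norm (g (Complex \<sigma> t))" for t
        using ln_bound[of "norm (g (Complex \<sigma> t))"] by (cases "g (Complex \<sigma> t) = 0") auto
    qed
    then have "1 / (2 * T) * (LBINT t:{-T..T}. ln (norm (g (Complex \<sigma> t)))) \<le> 1 / (2 * T) * (2 * T * C)"
      using I(2) elim by (intro mult_left_mono) auto
    also have "\<dots> = C" using elim by simp
    finally show ?case by (simp only: jessen_mean_def)
  qed
  then show "jessen g \<sigma> \<le> C" by (rule tendsto_upperbound[OF jessen_lim[OF \<sigma>]]) simp
qed

end

section \<open>Monotonicity and the behaviour near infinity\<close>

text \<open>
  If \<open>J\<close> increased from \<open>x\<close> to \<open>y\<close>, convexity would keep it above the line through these two points to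
  the right of \<open>y\<close>, and this line exceeds every bound.
\<close>

lemma convex_bounded_imp_antimono:
  fixes J :: "real \<Rightarrow> real"
  assumes J: "convex_on {0<..} J" and b: "\<And>\<sigma>. 0 < \<sigma> \<Longrightarrow> J \<sigma> \<le> C"
  shows "antimono_on {0<..} J"
proof (rule monotone_onI)
  fix x y :: real assume xy: "x \<in> {0<..}" "y \<in> {0<..}" "x \<le> y"
  show "J y \<le> J x"
  proof (rule ccontr)
    assume "\<not> J y \<le> J x"
    then have d: "0 < J y - J x" and "x < y" using xy by (auto simp: less_le)
    \<comment> \<open>At \<open>x + w (y - x)\<close> the line through the two points takes the value \<open>C + (J y - J x)\<close>.\<close>
    define w where "w = (C - J x) / (J y - J x) + 1"
    have "J y \<le> C" using b xy by simp
    then have w: "2 \<le> w" using d by (simp add: w_def pos_le_divide_eq)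
    define z where "z = x + w * (y - x)"
    have z: "0 < z" using xy w \<open>x < y\<close> by (auto simp: z_def intro!: add_pos_nonneg)
    have "y = (1 - 1 / w) *\<^sub>R x + (1 / w) *\<^sub>R z"
      using w by (simp add: z_def field_simps)
    then have "J y \<le> (1 - 1 / w) * J x + (1 / w) * J z"
      using convex_onD[OF J, of "1 / w" x z] w xy z by simp
    also have "\<dots> \<le> (1 - 1 / w) * J x + (1 / w) * C"
      using b[OF z] w by (intro add_left_mono mult_left_mono) auto
    finally have "w * (J y - J x) \<le> C - J x" using w by (simp add: field_simps)
    moreover have "w * (J y - J x) = C - J x + (J y - J x)" using d by (simp add: w_def field_simps)
    ultimately show False using d by linarith
  qed
qed

lemma abs_ln_diff_le:
  fixes x y :: real assumes "0 < y" "\<bar>x - y\<bar> \<le> y / 2"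
  shows "\<bar>ln x - ln y\<bar> \<le> 2 * \<bar>x - y\<bar> / y"
proof -
  have x: "y / 2 \<le> x" "0 < x" using assms by linarith+
  have "ln x - ln y \<le> (x - y) / y" using ln_diff_le[of x y] x assms by simp
  also have "\<dots> \<le> \<bar>x - y\<bar> / y" using assms by (intro divide_right_mono) auto
  also have "\<dots> \<le> 2 * \<bar>x - y\<bar> / y" using assms by (intro divide_right_mono) auto
  finally have 1: "ln x - ln y \<le> 2 * \<bar>x - y\<bar> / y" .
  have "ln y - ln x \<le> (y - x) / x" using ln_diff_le[of y x] x assms by simp
  also have "\<dots> \<le> \<bar>x - y\<bar> / x" using x by (intro divide_right_mono) auto
  also have "\<dots> \<le> \<bar>x - y\<bar> / (y / 2)" using x assms by (intro divide_left_mono) auto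
  also have "\<dots> = 2 * \<bar>x - y\<bar> / y" by simp
  finally have 2: "ln y - ln x \<le> 2 * \<bar>x - y\<bar> / y" .
  show ?thesis using 1 2 by (simp only: abs_le_iff) simp
qed

lemma jessen_mean_near_constant:
  assumes h: "h holomorphic_on half_plane 0" and \<sigma>: "0 < \<sigma>" and T: "0 < T"
    and b: "\<And>t. h (Complex \<sigma> t) \<noteq> 0 \<and> \<bar>ln (norm (h (Complex \<sigma> t))) - l\<bar> \<le> e"
  shows "\<bar>jessen_mean h \<sigma> T - l\<bar> \<le> e"
proof -
  have "continuous_on {-T..T} (\<lambda>t. ln (norm (h (Complex \<sigma> t))))"
    using b by (intro continuous_intros line_continuous[OF h \<sigma>]) auto
  then have I: "set_integrable lborel {-T..T} (\<lambda>t. ln (norm (h (Complex \<sigma> t))))"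
    by (rule borel_integrable_atLeastAtMost')
  have Ic: "set_integrable lborel {-T..T} (\<lambda>t. c)" for c :: real
    by (rule borel_integrable_atLeastAtMost'[OF continuous_on_const])
  have c: "(LBINT t:{-T..T}. c) = 2 * T * c" for c :: real using T by (simp add: set_lebesgue_integral_def)
  have "(LBINT t:{-T..T}. ln (norm (h (Complex \<sigma> t)))) \<le> (LBINT t:{-T..T}. l + e)"
    using b by (intro set_integral_mono I Ic) (smt (verit))
  moreover have "(LBINT t:{-T..T}. l - e) \<le> (LBINT t:{-T..T}. ln (norm (h (Complex \<sigma> t))))"
    using b by (intro set_integral_mono I Ic) (smt (verit))
  ultimately have "1 / (2 * T) * (LBINT t:{-T..T}. ln (norm (h (Complex \<sigma> t)))) \<le> 1 / (2 * T) * (2 * T * (l + e))"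
    "1 / (2 * T) * (2 * T * (l - e)) \<le> 1 / (2 * T) * (LBINT t:{-T..T}. ln (norm (h (Complex \<sigma> t))))"
    unfolding c using T by (auto intro!: mult_left_mono simp del: times_divide_eq_left)
  then show ?thesis using T by (simp add: jessen_mean_def abs_le_iff)
qed

context dirichlet_hardy
begin

text \<open>
  If the constant term is the leading one, all other terms together tend to 0 as \<open>\<sigma>\<close> grows, uniformly
  in the height and over all Riesz means.
\<close>

lemma jessen_near_infinity:
  assumes m1: "m = 1" and e: "0 < e"
  obtains B where "0 < B"
    "\<And>\<sigma> T. B \<le> \<sigma> \<Longrightarrow> 0 < T \<Longrightarrow> \<bar>jessen_mean g \<sigma> T - ln (norm (a 1))\<bar> \<le> e"
    "\<And>\<sigma> T k N. B \<le> \<sigma> \<Longrightarrow> 0 < T \<Longrightarrow> 0 < k \<Longrightarrow> 2 \<le> N \<Longrightarrow> \<bar>jessen_mean (riesz_mean k a N) \<sigma> T - ln (norm (a 1))\<bar> \<le> e"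
proof -
  have a1: "a 1 \<noteq> 0" using m m1 by simp
  define S1 where "S1 = (\<Sum>n. norm (a (Suc n)) * real (Suc n) powr (- \<sigma>1))"
  have S1: "0 \<le> S1" unfolding S1_def by (intro suminf_nonneg abs_conv) auto
  \<comment> \<open>A deviation of at most \<open>r\<close> from \<open>a 1\<close> changes the logarithm of the modulus by at most \<open>e\<close>.\<close>
  define r where "r = norm (a 1) * min (1 / 2) (e / 2)"
  have r: "0 < r" "r \<le> norm (a 1) / 2" "2 * r / norm (a 1) \<le> e"
    using a1 e by (auto simp: r_def min_def field_simps)
  define B where "B = max (max 1 \<sigma>1) (\<sigma>1 + S1 / r / ln 2)"
  have tail: "2 powr (\<sigma>1 - \<sigma>) * S1 \<le> r" if "B \<le> \<sigma>" for \<sigma>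
  proof -
    have "S1 / r / ln 2 \<le> \<sigma> - \<sigma>1" using that by (simp add: B_def)
    then have "S1 / r \<le> (\<sigma> - \<sigma>1) * ln 2" by (rule pos_divide_le_eq[THEN iffD1, rotated]) simp
    also have "\<dots> \<le> exp ((\<sigma> - \<sigma>1) * ln 2)" using exp_ge_add_one_self[of "(\<sigma> - \<sigma>1) * ln 2"] by linarith
    also have "\<dots> = 2 powr (\<sigma> - \<sigma>1)" by (simp add: powr_def)
    finally have "S1 \<le> r * 2 powr (\<sigma> - \<sigma>1)" using r by (simp add: pos_divide_le_eq mult.commute)
    then have "2 powr (\<sigma>1 - \<sigma>) * S1 \<le> 2 powr (\<sigma>1 - \<sigma>) * (r * 2 powr (\<sigma> - \<sigma>1))" by (intro mult_left_mono) auto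
    also have "\<dots> = r * (2 powr (\<sigma>1 - \<sigma>) * 2 powr (\<sigma> - \<sigma>1))" by simp
    also have "2 powr (\<sigma>1 - \<sigma>) * 2 powr (\<sigma> - \<sigma>1) = (1::real)" by (simp flip: powr_add)
    finally show ?thesis by simp
  qed
  have near: "F \<noteq> 0 \<and> \<bar>ln (norm F) - ln (norm (a 1))\<bar> \<le> e"
    if \<sigma>: "B \<le> Re s" and c: "\<And>n. norm (c n) \<le> norm (a n)" "c 1 = a 1" and F: "dirichlet_term c s sums F" for c s F
  proof -
    have "norm (F - c 1 * of_nat 1 powr (- s)) \<le> real (1 + 1) powr (\<sigma>1 - Re s) * S1"
      unfolding S1_def using \<sigma> by (intro dirichlet_tail[OF abs_conv c(1) _ _ _ F]) (auto simp: B_def)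
    then have "norm (F - a 1) \<le> r" using tail[OF \<sigma>] c(2) by simp
    then have d: "\<bar>norm F - norm (a 1)\<bar> \<le> r" using norm_triangle_ineq3[of F "a 1"] by simp
    have "norm F \<noteq> 0" using d r a1 by auto
    moreover have "\<bar>ln (norm F) - ln (norm (a 1))\<bar> \<le> 2 * \<bar>norm F - norm (a 1)\<bar> / norm (a 1)"
      using d r a1 by (intro abs_ln_diff_le) auto
    moreover have "2 * \<bar>norm F - norm (a 1)\<bar> / norm (a 1) \<le> 2 * r / norm (a 1)"
      using d by (intro divide_right_mono) auto
    ultimately show ?thesis using r(3) by auto
  qed
  show thesis
  proof (rule that[of B])
    show "0 < B" by (simp add: B_def)
    fix \<sigma> T :: real assume \<sigma>: "B \<le> \<sigma>" and T: "0 < T"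
    have s0: "0 < \<sigma>" using \<sigma> by (simp add: B_def)
    show "\<bar>jessen_mean g \<sigma> T - ln (norm (a 1))\<bar> \<le> e"
    proof (rule jessen_mean_near_constant[OF g_holomorphic s0 T])
      show "g (Complex \<sigma> t) \<noteq> 0 \<and> \<bar>ln (norm (g (Complex \<sigma> t))) - ln (norm (a 1))\<bar> \<le> e" for t
        using \<sigma> by (intro near[of "Complex \<sigma> t" a] series) (auto simp: B_def)
    qed
    fix k :: real and N :: nat assume k: "0 < k" and N: "2 \<le> N"
    show "\<bar>jessen_mean (riesz_mean k a N) \<sigma> T - ln (norm (a 1))\<bar> \<le> e"
    proof (rule jessen_mean_near_constant[OF _ s0 T])
      show "riesz_mean k a N holomorphic_on half_plane 0" unfolding riesz_mean_dpoly by (rule dpoly_holomorphic)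
      show "riesz_mean k a N (Complex \<sigma> t) \<noteq> 0 \<and> \<bar>ln (norm (riesz_mean k a N (Complex \<sigma> t))) - ln (norm (a 1))\<bar> \<le> e" for t
        using \<sigma> N by (intro near[OF _ norm_riesz_coeff_le[OF N k] _ riesz_mean_sums]) (auto simp: riesz_coeff_def)
    qed
  qed
qed

lemma jessen_ucauchy_half_line:
  assumes m1: "m = 1" and \<kappa>: "0 < \<kappa>"
  shows "ucauchy {\<kappa><..} (\<lambda>T \<sigma>. jessen_mean g \<sigma> T)"
  unfolding ucauchy_def
proof (intro allI impI)
  fix e :: real assume e: "0 < e"
  obtain B where B: "\<And>\<sigma> T. B \<le> \<sigma> \<Longrightarrow> 0 < T \<Longrightarrow> \<bar>jessen_mean g \<sigma> T - ln (norm (a 1))\<bar> \<le> e / 2"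
    using jessen_near_infinity[OF m1, of "e / 2"] e by (metis half_gt_zero)
  obtain T0 where T0: "\<And>T T' \<sigma>. T0 \<le> T \<Longrightarrow> T0 \<le> T' \<Longrightarrow> \<sigma> \<in> {\<kappa>..B} \<Longrightarrow> \<bar>jessen_mean g \<sigma> T - jessen_mean g \<sigma> T'\<bar> \<le> e"
    using jessen_ucauchy[OF \<kappa>, of B] e unfolding ucauchy_def by blast
  have "\<bar>jessen_mean g \<sigma> T - jessen_mean g \<sigma> T'\<bar> \<le> e" if "max 1 T0 \<le> T" "max 1 T0 \<le> T'" "\<sigma> \<in> {\<kappa><..}" for T T' \<sigma>
  proof (cases "\<sigma> \<le> B")
    case True then show ?thesis using that by (intro T0) auto
  next
    case False
    have "\<bar>jessen_mean g \<sigma> T - ln (norm (a 1))\<bar> \<le> e / 2" "\<bar>jessen_mean g \<sigma> T' - ln (norm (a 1))\<bar> \<le> e / 2"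
      by (rule B; use False that in linarith)+
    then show ?thesis by linarith
  qed
  then show "\<exists>T0. \<forall>T\<ge>T0. \<forall>T'\<ge>T0. \<forall>\<sigma>\<in>{\<kappa><..}. \<bar>jessen_mean g \<sigma> T - jessen_mean g \<sigma> T'\<bar> \<le> e" by blast
qed

lemma jessen_riesz_close_half_line:
  assumes m1: "m = 1" and k: "3 < k" and \<kappa>: "0 < \<kappa>" and e: "0 < e"
  shows "\<forall>\<^sub>F N in sequentially. \<forall>\<sigma>\<in>{\<kappa><..}. \<bar>jessen g \<sigma> - jessen (riesz_mean k a N) \<sigma>\<bar> \<le> e"
proof -
  obtain B where B: "\<And>\<sigma> T. B \<le> \<sigma> \<Longrightarrow> 0 < T \<Longrightarrow> \<bar>jessen_mean g \<sigma> T - ln (norm (a 1))\<bar> \<le> e / 2"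
    "\<And>\<sigma> T k N. B \<le> \<sigma> \<Longrightarrow> 0 < T \<Longrightarrow> 0 < k \<Longrightarrow> 2 \<le> N \<Longrightarrow> \<bar>jessen_mean (riesz_mean k a N) \<sigma> T - ln (norm (a 1))\<bar> \<le> e / 2"
    using jessen_near_infinity[OF m1, of "e / 2"] e by (metis half_gt_zero)
  have k0: "0 < k" using k by simp
  show ?thesis using jessen_riesz_close[OF k \<kappa> e, of B] riesz_jessen_ucauchy[OF k0] eventually_ge_at_top[of 2]
  proof eventually_elim
    case (elim N)
    show ?case
    proof
      fix \<sigma> assume \<sigma>: "\<sigma> \<in> {\<kappa><..}"
      then have s0: "0 < \<sigma>" using \<kappa> by auto
      show "\<bar>jessen g \<sigma> - jessen (riesz_mean k a N) \<sigma>\<bar> \<le> e"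
      proof (cases "\<sigma> \<le> B")
        case True then show ?thesis using elim(1) \<sigma> by auto
      next
        case False
        have "(jessen_mean (riesz_mean k a N) \<sigma> \<longlongrightarrow> jessen (riesz_mean k a N) \<sigma>) at_top"
          by (rule jessen_tendsto[of \<sigma> \<sigma>]) (use elim(2) s0 in blast, simp_all)
        then have "((\<lambda>T. \<bar>jessen_mean g \<sigma> T - jessen_mean (riesz_mean k a N) \<sigma> T\<bar>) \<longlongrightarrow> \<bar>jessen g \<sigma> - jessen (riesz_mean k a N) \<sigma>\<bar>) at_top"
          by (intro tendsto_intros jessen_lim[OF s0])
        moreover have "\<forall>\<^sub>F T in at_top. \<bar>jessen_mean g \<sigma> T - jessen_mean (riesz_mean k a N) \<sigma> T\<bar> \<le> e"
          using eventually_gt_at_top[of 0]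
        proof eventually_elim
          case T: (elim T)
          have "B \<le> \<sigma>" using False by simp
          from B(1)[OF this T] B(2)[OF this T k0 elim(3)] show ?case by linarith
        qed
        ultimately show ?thesis by (rule tendsto_upperbound) simp
      qed
    qed
  qed
qed

end

section \<open>Existence, convexity and approximation of the Jessen function\<close>

lemma mean_norm_le_of_powr:
  assumes p: "1 \<le> p" and f: "f holomorphic_on half_plane 0" and \<sigma>: "0 < \<sigma>" and T: "1 \<le> T"
    and b: "1 / (2 * T) * (LBINT t:{-T..T}. norm (f (Complex \<sigma> t)) powr p) \<le> B"
  shows "(\<integral>\<^sup>+t. ennreal (norm (f (Complex \<sigma> t))) * indicator {-T..T} t \<partial>lborel) \<le> ennreal (2 * T * (1 + B))"
proof -
  have c: "continuous_on {-T..T} (\<lambda>t. norm (f (Complex \<sigma> t)))" by (intro continuous_intros line_continuous f \<sigma>)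
  have I: "set_integrable lborel {-T..T} (\<lambda>t. norm (f (Complex \<sigma> t)))" by (rule borel_integrable_atLeastAtMost'[OF c])
  have Ip: "set_integrable lborel {-T..T} (\<lambda>t. 1 + norm (f (Complex \<sigma> t)) powr p)"
    using p by (intro borel_integrable_atLeastAtMost' continuous_on_add continuous_on_const continuous_on_powr' c) auto
  have Ip': "set_integrable lborel {-T..T} (\<lambda>t. norm (f (Complex \<sigma> t)) powr p)"
    using p by (intro borel_integrable_atLeastAtMost' continuous_on_powr' continuous_on_const c) auto
  have "x \<le> 1 + x powr p" if "0 \<le> x" for x :: real
  proof (cases "1 \<le> x")
    case True
    then have "x powr 1 \<le> x powr p" using p by (intro powr_mono) auto
    then show ?thesis using True by simp
  next
    case False
    moreover have "0 \<le> x powr p" by simp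
    ultimately show ?thesis by linarith
  qed
  then have "(LBINT t:{-T..T}. norm (f (Complex \<sigma> t))) \<le> (LBINT t:{-T..T}. 1 + norm (f (Complex \<sigma> t)) powr p)"
    by (intro set_integral_mono I Ip) auto
  also have "\<dots> = (LBINT t:{-T..T}. 1) + (LBINT t:{-T..T}. norm (f (Complex \<sigma> t)) powr p)"
    by (intro set_integral_add Ip' borel_integrable_atLeastAtMost' continuous_on_const)
  also have "(LBINT t:{-T..T}. (1::real)) = 2 * T" using T by (simp add: set_lebesgue_integral_def)
  also have "(LBINT t:{-T..T}. norm (f (Complex \<sigma> t)) powr p) \<le> 2 * T * B"
    using b T by (simp add: pos_divide_le_eq mult.commute)
  finally have "(LBINT t:{-T..T}. norm (f (Complex \<sigma> t))) \<le> 2 * T * (1 + B)" by (simp add: distrib_left)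
  moreover have "(\<integral>\<^sup>+t. ennreal (norm (f (Complex \<sigma> t))) * indicator {-T..T} t \<partial>lborel) = ennreal (LBINT t:{-T..T}. norm (f (Complex \<sigma> t)))"
  proof -
    have "(\<integral>\<^sup>+t. ennreal (indicator {-T..T} t *\<^sub>R norm (f (Complex \<sigma> t))) \<partial>lborel) = ennreal (LBINT t:{-T..T}. norm (f (Complex \<sigma> t)))"
      using I unfolding set_integrable_def set_lebesgue_integral_def by (intro nn_integral_eq_integral) auto
    moreover have "ennreal (indicator {-T..T} t *\<^sub>R norm (f (Complex \<sigma> t))) = ennreal (norm (f (Complex \<sigma> t))) * indicator {-T..T} t" for t
      by (auto simp: indicator_def)
    ultimately show ?thesis by simp
  qed
  ultimately show ?thesis by (simp add: ennreal_leI)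
qed

theorem theorem4p1:
  fixes p :: real and a :: "nat \<Rightarrow> complex" and f :: "complex \<Rightarrow> complex"
  assumes "1 \<le> p"
    and "somewhere_convergent a"
    and "dirichlet_continuation a f"
    and "\<exists>s\<in>half_plane 0. f s \<noteq> 0"
    and "(SUP \<sigma>\<in>{0<..}. SUP T\<in>{1..}.
            ennreal (1 / (2 * T) * (LBINT t:{-T..T}. norm (f (Complex \<sigma> t)) powr p))) < \<infinity>"
  shows "(\<forall>\<sigma>>0. jessen_exists f \<sigma>)
    \<and> (\<forall>\<alpha> \<beta>. 0 < \<alpha> \<longrightarrow> \<alpha> < \<beta> \<longrightarrow>
          uniform_limit {\<alpha><..<\<beta>} (\<lambda>T \<sigma>. jessen_mean f \<sigma> T) (jessen f) at_top)
    \<and> antimono_on {0<..} (jessen f)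
    \<and> convex_on {0<..} (jessen f)
    \<and> (\<forall>k>3.
          (\<forall>\<^sub>F N in sequentially. \<forall>\<sigma>>0. jessen_exists (riesz_mean k a N) \<sigma>)
        \<and> (\<forall>\<alpha> \<beta>. 0 < \<alpha> \<longrightarrow> \<alpha> < \<beta> \<longrightarrow>
              uniform_limit {\<alpha><..<\<beta>} (\<lambda>N. jessen (riesz_mean k a N)) (jessen f) sequentially))
    \<and> (a 1 \<noteq> 0 \<longrightarrow>
          (\<forall>\<kappa>>0. uniform_limit {\<kappa><..} (\<lambda>T \<sigma>. jessen_mean f \<sigma> T) (jessen f) at_top)
        \<and> (\<forall>k>3. \<forall>\<kappa>>0.
              uniform_limit {\<kappa><..} (\<lambda>N. jessen (riesz_mean k a N)) (jessen f) sequentially))"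
proof -
  have fh: "f holomorphic_on half_plane 0" using assms(3) by (simp add: dirichlet_continuation_def)
  obtain \<kappa>0 where \<kappa>0: "0 \<le> \<kappa>0" "\<And>s. s \<in> half_plane \<kappa>0 \<Longrightarrow> dirichlet_term a s sums f s"
    using assms(3) by (auto simp: dirichlet_continuation_def)
  obtain \<sigma>a where \<sigma>a: "\<And>\<sigma>. \<sigma>a \<le> \<sigma> \<Longrightarrow> summable (\<lambda>n. norm (a (Suc n)) * real (Suc n) powr (- \<sigma>))"
    using somewhere_convergent_imp_abs_summable[OF assms(2)] by blast
  define \<sigma>1 where "\<sigma>1 = max \<sigma>a (\<kappa>0 + 1)"
  define S where "S = (SUP \<sigma>\<in>{0<..}. SUP T\<in>{1..}. ennreal (1 / (2 * T) * (LBINT t:{-T..T}. norm (f (Complex \<sigma> t)) powr p)))"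
  have Sf: "S < \<infinity>" using assms(5) by (simp only: S_def)
  define B where "B = enn2real S"
  have B: "1 / (2 * T) * (LBINT t:{-T..T}. norm (f (Complex \<sigma> t)) powr p) \<le> B" if "0 < \<sigma>" "1 \<le> T" for \<sigma> T
  proof -
    have "ennreal (1 / (2 * T) * (LBINT t:{-T..T}. norm (f (Complex \<sigma> t)) powr p)) \<le> S"
      unfolding S_def using that by (intro SUP_upper2[of \<sigma>] SUP_upper2[of T]) auto
    also have "S = ennreal B" using Sf by (simp add: B_def)
    finally show ?thesis by (simp add: B_def ennreal_le_iff)
  qed
  \<comment> \<open>Outside the right half-plane \<open>f\<close> is arbitrary; extending by 0 gives a Borel function on the plane.\<close>
  define g where "g s = (if s \<in> half_plane 0 then f s else 0)" for s
  have gf: "g (Complex \<sigma> t) = f (Complex \<sigma> t)" if "0 < \<sigma>" for \<sigma> t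
    using that by (simp add: g_def half_plane_def)
  have gb: "line_bounded g (1 + B)"
    unfolding line_bounded_def
  proof (intro conjI allI impI)
    show "0 \<le> 1 + B" by (simp add: B_def)
    have "(\<lambda>s. indicator (half_plane 0) s *\<^sub>R f s) \<in> borel_measurable borel"
      using holomorphic_on_imp_continuous_on[OF fh] by (intro borel_measurable_continuous_on_indicator) auto
    also have "(\<lambda>s. indicator (half_plane 0) s *\<^sub>R f s) = g" by (auto simp: g_def indicator_def)
    finally show "g \<in> borel_measurable borel" .
    show "g holomorphic_on half_plane 0" using fh by (rule holomorphic_transform) (simp add: g_def)
    fix \<sigma> T :: real assume *: "0 < \<sigma>" "1 \<le> T"
    show "(\<integral>\<^sup>+t. ennreal (norm (g (Complex \<sigma> t))) * indicator {-T..T} t \<partial>lborel) \<le> ennreal (2 * T * (1 + B))"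
      unfolding gf[OF *(1)] by (rule mean_norm_le_of_powr[OF assms(1) fh * B[OF *]])
  qed
  \<comment> \<open>If all coefficients vanished, the identity theorem would make \<open>f\<close> vanish on the right half-plane.\<close>
  have ex: "\<exists>n. 1 \<le> n \<and> a n \<noteq> 0"
  proof (rule ccontr)
    assume "\<not> ?thesis"
    then have z: "dirichlet_term a s = (\<lambda>n. 0)" for s by (auto simp: dirichlet_term_def)
    obtain s0 where s0: "s0 \<in> half_plane 0" "f s0 \<noteq> 0" using assms(4) by blast
    have "f s0 = 0"
    proof (rule analytic_continuation_open[of "half_plane \<kappa>0" "half_plane 0" f "\<lambda>_. 0"])
      have "complex_of_real (\<kappa>0 + 1) \<in> half_plane \<kappa>0" by (simp add: half_plane_def)
      then show "half_plane \<kappa>0 \<noteq> {}" by blast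
      show "connected (half_plane 0)" by (simp add: convex_connected)
      show "half_plane \<kappa>0 \<subseteq> half_plane 0" using \<kappa>0(1) by (auto simp: half_plane_def)
      show "f w = 0" if "w \<in> half_plane \<kappa>0" for w
        using \<kappa>0(2)[OF that] unfolding z using sums_unique2 sums_zero by blast
    qed (use fh s0 in auto)
    then show False using s0 by simp
  qed
  define m where "m = (LEAST n. 1 \<le> n \<and> a n \<noteq> 0)"
  have m: "1 \<le> m" "a m \<noteq> 0" using LeastI_ex[OF ex] by (auto simp: m_def)
  interpret D: dirichlet_hardy a g "1 + B" \<sigma>1 m
  proof
    show "line_bounded g (1 + B)" by (rule gb)
    show "summable (\<lambda>n. norm (a (Suc n)) * real (Suc n) powr (- \<sigma>1))" by (rule \<sigma>a) (simp add: \<sigma>1_def)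
    show "dirichlet_term a s sums g s" if "\<sigma>1 \<le> Re s" for s
      using \<kappa>0(1) \<kappa>0(2)[of s] that by (auto simp: g_def half_plane_def \<sigma>1_def)
    show "1 \<le> m" "a m \<noteq> 0" by (fact m)+
    show "a n = 0" if "1 \<le> n" "n < m" for n using not_less_Least[of n] that unfolding m_def by blast
  qed
  have jm: "jessen_mean g \<sigma> = jessen_mean f \<sigma>" if "0 < \<sigma>" for \<sigma>
    unfolding jessen_mean_def gf[OF that] by simp
  have J: "jessen g \<sigma> = jessen f \<sigma>" if "0 < \<sigma>" for \<sigma> by (simp add: jessen_def jm[OF that])
  have JE: "jessen_exists f \<sigma>" if "0 < \<sigma>" for \<sigma>
    using D.g_jessen_exists[OF that] unfolding jessen_exists_def gf[OF that] jm[OF that] .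
  have limT: "uniform_limit A (\<lambda>T \<sigma>. jessen_mean f \<sigma> T) (jessen f) at_top"
    if A: "A \<subseteq> {0<..}" and uc: "ucauchy A (\<lambda>T \<sigma>. jessen_mean g \<sigma> T)" for A
  proof -
    have "uniform_limit A (\<lambda>T \<sigma>. jessen_mean g \<sigma> T) (jessen g) at_top"
      using ucauchy_limit(2)[OF uc] by (simp add: jessen_def[abs_def])
    moreover have "jessen_mean g \<sigma> T = jessen_mean f \<sigma> T" "jessen g \<sigma> = jessen f \<sigma>" if "\<sigma> \<in> A" for \<sigma> T
      using that A jm[of \<sigma>] J[of \<sigma>] by auto
    ultimately show ?thesis by (subst (asm) uniform_limit_cong') assumption+
  qed
  have limN: "uniform_limit A (\<lambda>N. jessen (riesz_mean k a N)) (jessen f) sequentially"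
    if A: "A \<subseteq> {0<..}" and cl: "\<And>e. 0 < e \<Longrightarrow> \<forall>\<^sub>F N in sequentially. \<forall>\<sigma>\<in>A. \<bar>jessen g \<sigma> - jessen (riesz_mean k a N) \<sigma>\<bar> \<le> e" for A k
  proof (rule uniform_limitI)
    fix e :: real assume e: "0 < e"
    from cl[of "e / 2"] e have "\<forall>\<^sub>F N in sequentially. \<forall>\<sigma>\<in>A. \<bar>jessen g \<sigma> - jessen (riesz_mean k a N) \<sigma>\<bar> \<le> e / 2" by simp
    then show "\<forall>\<^sub>F N in sequentially. \<forall>\<sigma>\<in>A. dist (jessen (riesz_mean k a N) \<sigma>) (jessen f \<sigma>) < e"
    proof eventually_elim
      case (elim N)
      show ?case
      proof
        fix \<sigma> assume "\<sigma> \<in> A"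
        then have "\<bar>jessen f \<sigma> - jessen (riesz_mean k a N) \<sigma>\<bar> \<le> e / 2" using elim A J by force
        then show "dist (jessen (riesz_mean k a N) \<sigma>) (jessen f \<sigma>) < e" using e by (simp add: dist_real_def abs_minus_commute)
      qed
    qed
  qed
  have "convex_on {0<..} (jessen f)"
  proof (rule convex_onI)
    fix t x y :: real assume t: "0 < t" "t < 1" and xy: "x \<in> {0<..}" "y \<in> {0<..}"
    then have "0 < (1 - t) *\<^sub>R x + t *\<^sub>R y" by (simp add: add_pos_pos)
    then show "jessen f ((1 - t) *\<^sub>R x + t *\<^sub>R y) \<le> (1 - t) * jessen f x + t * jessen f y"
      using convex_onD[OF D.jessen_convex, of t x y] t xy by (simp only: J greaterThan_iff less_imp_le)
  qed simp
  moreover from this have "antimono_on {0<..} (jessen f)"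
    by (rule convex_bounded_imp_antimono[where C = "1 + B"]) (use D.jessen_le J in metis)
  moreover have "uniform_limit {\<alpha><..<\<beta>} (\<lambda>T \<sigma>. jessen_mean f \<sigma> T) (jessen f) at_top" if "0 < \<alpha>" for \<alpha> \<beta>
    using that by (intro limT ucauchy_subset[OF D.jessen_ucauchy[of \<alpha> \<beta>]]) auto
  moreover have "uniform_limit {\<alpha><..<\<beta>} (\<lambda>N. jessen (riesz_mean k a N)) (jessen f) sequentially" if "3 < k" "0 < \<alpha>" for k \<alpha> \<beta>
  proof (rule limN)
    fix e :: real assume "0 < e"
    from D.jessen_riesz_close[OF that this, of \<beta>]
    show "\<forall>\<^sub>F N in sequentially. \<forall>\<sigma>\<in>{\<alpha><..<\<beta>}. \<bar>jessen g \<sigma> - jessen (riesz_mean k a N) \<sigma>\<bar> \<le> e"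
      by eventually_elim auto
  qed (use that in auto)
  moreover have "\<forall>\<^sub>F N in sequentially. \<forall>\<sigma>>0. jessen_exists (riesz_mean k a N) \<sigma>" if "3 < k" for k
    using that by (intro D.riesz_jessen_exists) auto
  moreover have "uniform_limit {\<kappa><..} (\<lambda>T \<sigma>. jessen_mean f \<sigma> T) (jessen f) at_top" if "a 1 \<noteq> 0" "0 < \<kappa>" for \<kappa>
  proof -
    have "m = 1" unfolding m_def by (rule Least_equality) (use that in auto)
    then show ?thesis using that by (intro limT D.jessen_ucauchy_half_line) auto
  qed
  moreover have "uniform_limit {\<kappa><..} (\<lambda>N. jessen (riesz_mean k a N)) (jessen f) sequentially" if "a 1 \<noteq> 0" "3 < k" "0 < \<kappa>" for k \<kappa>
  proof -
    have "m = 1" unfolding m_def by (rule Least_equality) (use that in auto)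
    then show ?thesis using that by (intro limN D.jessen_riesz_close_half_line) auto
  qed
  ultimately show ?thesis using JE by blast
qed

end
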